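(* Let $\mathcal M_h$ be a mesh of a compact $n$-dimensional Riemannian manifold $\Omega$ for which affine compatible local coordinates $(I_f)_f$ exist (see context), and define on each cell $f\in\Delta_d(\mathcal M_h)$, $0\le d\le n$, with $J_f:=I_f^{-1}$, $$\mathcal H_r\Lambda^l(f):=J_f^*\mathcal H_r\Lambda^l(\mathbb R^d),\qquad \mathcal P_r\Lambda^l(f):=\bigoplus_{s\le r}\mathcal H_s\Lambda^l(f),\qquad \kappa_f:=\mathsf i_{X_f}\ \text{ with } X_f:=(I_f)_*X_d .$$ Then, for all $0\le d\le n$ and $f\in\Delta_d(\mathcal M_h)$, the spaces $\mathcal P_r\Lambda^l(f)$ form a complex for $\mathrm d$ (with $\mathrm d\mathcal P_r\Lambda^l(f)\subset\mathcal P_{r-1}\Lambda^{l+1}(f)$) and for $\kappa_f$ (with $\kappa_f\mathcal P_r\Lambda^l(f)\subset\mathcal P_{r+1}\Lambda^{l-1}(f)$ and $\kappa_f\kappa_f=0$), and the following properties hold: (a) for all $s,l\in\mathbb Z$ there is $\lambda_{s,l}\in\mathbb R$ such that $(\mathrm d\kappa_f+\kappa_f\mathrm d)p=\lambda_{s,l}\,p$ for all $p\in\mathcal H_s\Lambda^l(f)$; for $s<0$, $\mathcal H_s\Lambda^l(f)=\{0\}$ and one fixes $\lambda_{s,l}=\lambda_{s+l,0}$, with $\lambda_{s+l,0}=0$ if $s+l<0$; (b) these $\lambda_{s,l}$ can be taken such that: if $d>0$, $l\in[0,d]$, $s,s'\ge0$ and $\lambda_{s,l}=\lambda_{s',l}$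 then $s=s'$; and, for $s\ge0$ and $l\in[0,d]$, $\lambda_{s,l}=0$ if and only if $(s,l)=(0,0)$; (c) $\mathrm d\mathcal H_s\Lambda^l(f)\ne\{0\}$ when $s>0$ and $l<d$.
   Context: **Mesh.** $\mathcal M_h$ is a finite collection of pairwise disjoint submanifolds ("cells") of dimensions $0,\dots,n$, covering $\Omega$; $\Delta_d(\mathcal M_h)$ is the set of $d$-dimensional cells. If $f$ is a $d$-cell, $d\ge1$, and $f'$ a $d'$-cell with $d'<d$ and $f'\cap\overline f\neq\emptyset$, then $f'\subset\partial f$. $\Delta_{d'}(f)$ is the set of $d'$-cells contained in $\partial f$. **Affine compatible local coordinates.** For all $0\le d\le n$ and $f\in\Delta_d(\mathcal M_h)$ there is a $C^2$-diffeomorphism $I_f:U_f\subset\mathbb R^d\to\overline f$. Moreover, for all $f'\in\Delta_{d-1}(f)$, setting $J_f:=(I_f)^{-1}$ and denoting by $\mathfrak I_{f,f'}:f'\to\overline f$ the inclusion, the mapping $\mathcal T_{f,f'}:=J_f\circ\mathfrak I_{f,f'}\circ I_{f'}:U_{f'}\to\mathbb R^d$ is affine. **Notation.** $\mathcal H_r\Lambda^l(\mathbb R^d)$ is the space of $l$-forms on $\mathbb R^d$ whose coefficients are homogeneous polynomials of degree $r$ ($\{0\}$ if $r<0$ or $l\notin[0,d]$); $X_d$ is the identity vector field on $\mathbb R^d$, $X_d(\boldsymbol x)=\boldsymbol x$; $\mathsf i_X$ is the interior product, $\mathsf i_X\mu(v_1,\dots,v_{l-1})=\mu(X,v_1,\dots,v_{l-1})$;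 $\mathrm d$ is the exterior derivative; $\phi^*$, $\phi_*$ denote pullback and pushforward.
   Formalization: Property (c) is stated for 0 ≤ l < d only: for l < 0 the space H_sΛ^l(f) is {0} by convention, so dH_sΛ^l(f) ≠ {0} fails there. *)

theory Defs
  imports "HOL-Analysis.Analysis"
begin

text \<open>
  Dimensions vary within the statement, so vectors of R^d are functions
  \<^typ>\<open>nat \<Rightarrow> real\<close> vanishing at all indices \<open>\<ge> d\<close>, with the topology
  \<^term>\<open>Euclidean_space d\<close>. In particular R^d is a subset of R^n for \<open>d \<le> n\<close>, and R^0 is \<open>{0}\<close>.
\<close>

type_synonym vec = "nat \<Rightarrow> real"

abbreviation Rspace :: "nat \<Rightarrow> vec set"
  where "Rspace d \<equiv> topspace (Euclidean_space d)"

definition unit_vec :: "nat \<Rightarrow> vec"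
  where "unit_vec i = (\<lambda>j. if j = i then 1 else 0)"

definition lincomb :: "real \<Rightarrow> vec \<Rightarrow> real \<Rightarrow> vec \<Rightarrow> vec"
  where "lincomb a u b v = (\<lambda>i. a * u i + b * v i)"


section \<open>Differential calculus on open subsets of R^d\<close>

definition partial :: "nat \<Rightarrow> (vec \<Rightarrow> real) \<Rightarrow> vec \<Rightarrow> real"
  where "partial i g x = deriv (\<lambda>t. g (x(i := t))) (x i)"

primrec Ck_on :: "nat \<Rightarrow> nat \<Rightarrow> vec set \<Rightarrow> (vec \<Rightarrow> real) \<Rightarrow> bool"
  where
    "Ck_on d 0 V g \<longleftrightarrow> continuous_map (subtopology (Euclidean_space d) V) euclideanreal g"
  | "Ck_on d (Suc k) V g \<longleftrightarrow>
       continuous_map (subtopology (Euclidean_space d) V) euclideanreal g \<and>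
       (\<forall>i<d. (\<forall>x\<in>V. (\<lambda>t. g (x(i := t))) field_differentiable (at (x i))) \<and>
              Ck_on d k V (partial i g))"

definition smooth_on :: "nat \<Rightarrow> vec set \<Rightarrow> (vec \<Rightarrow> real) \<Rightarrow> bool"
  where "smooth_on d V g \<longleftrightarrow> (\<forall>k. Ck_on d k V g)"

definition jacobian :: "nat \<Rightarrow> (vec \<Rightarrow> vec) \<Rightarrow> vec \<Rightarrow> vec \<Rightarrow> vec"
  where "jacobian d G x v = (\<lambda>j. \<Sum>i<d. partial i (\<lambda>y. G y j) x * v i)"


section \<open>Manifolds\<close>

text \<open>A chart is a pair of an open domain and a coordinate map, only relevant on the domain.\<close>

type_synonym 'm chart = "'m set \<times> ('m \<Rightarrow> vec)"

definition chart_inv :: "'m chart \<Rightarrow> vec \<Rightarrow> 'm"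
  where "chart_inv ch = inv_into (fst ch) (snd ch)"

definition is_chart :: "nat \<Rightarrow> 'm topology \<Rightarrow> 'm chart \<Rightarrow> bool"
  where "is_chart n M ch \<longleftrightarrow>
    openin M (fst ch) \<and> openin (Euclidean_space n) (snd ch ` fst ch) \<and>
    homeomorphic_map (subtopology M (fst ch))
      (subtopology (Euclidean_space n) (snd ch ` fst ch)) (snd ch)"

definition smooth_transition :: "nat \<Rightarrow> 'm chart \<Rightarrow> 'm chart \<Rightarrow> bool"
  where "smooth_transition n ch ch' \<longleftrightarrow>
    (\<forall>j<n. smooth_on n (snd ch ` (fst ch \<inter> fst ch')) (\<lambda>x. snd ch' (chart_inv ch x) j))"

text \<open>The smooth structure is given as a maximal atlas.\<close>

definition smooth_manifold :: "nat \<Rightarrow> 'm topology \<Rightarrow> 'm chart set \<Rightarrow> bool"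
  where "smooth_manifold n M A \<longleftrightarrow>
    Hausdorff_space M \<and> second_countable M \<and>
    (\<forall>ch\<in>A. is_chart n M ch) \<and>
    (\<Union>ch\<in>A. fst ch) = topspace M \<and>
    (\<forall>ch\<in>A. \<forall>ch'\<in>A. smooth_transition n ch ch') \<and>
    (\<forall>ch. is_chart n M ch \<and>
       (\<forall>ch'\<in>A. smooth_transition n ch ch' \<and> smooth_transition n ch' ch) \<longrightarrow> ch \<in> A)"

text \<open>
  A tangent vector at \<open>p\<close> is the family of its component vectors in all charts around \<open>p\<close>,
  transforming with the Jacobians of the transition maps (and \<open>0\<close> at the other charts).
  Here and below, \<open>C\<close> is an atlas of charts into R^d.
\<close>

type_synonym 'm tvec = "'m chart \<Rightarrow> vec"

definition tangent_space :: "nat \<Rightarrow> 'm chart set \<Rightarrow> 'm \<Rightarrow> 'm tvec set"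
  where "tangent_space d C p = {v. \<forall>ch.
     if ch \<in> C \<and> p \<in> fst ch
     then v ch \<in> Rspace d \<and>
          (\<forall>ch'\<in>C. p \<in> fst ch' \<longrightarrow>
             v ch' = jacobian d (\<lambda>x. snd ch' (chart_inv ch x)) (snd ch p) (v ch))
     else v ch = (\<lambda>_. 0)}"

definition tlincomb :: "real \<Rightarrow> 'm tvec \<Rightarrow> real \<Rightarrow> 'm tvec \<Rightarrow> 'm tvec"
  where "tlincomb a u b v = (\<lambda>ch. lincomb a (u ch) b (v ch))"

text \<open>Differential at \<open>x\<close> of a map \<open>I\<close> from (an open subset of) R^d into the manifold.\<close>

definition diff_into ::
    "nat \<Rightarrow> 'm chart set \<Rightarrow> (vec \<Rightarrow> 'm) \<Rightarrow> vec \<Rightarrow> vec \<Rightarrow> 'm tvec"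
  where "diff_into d C I x u = (\<lambda>ch.
     if ch \<in> C \<and> I x \<in> fst ch then jacobian d (\<lambda>y. snd ch (I y)) x u else (\<lambda>_. 0))"

definition chart_at :: "'m chart set \<Rightarrow> 'm \<Rightarrow> 'm chart"
  where "chart_at C p = (SOME ch. ch \<in> C \<and> p \<in> fst ch)"

text \<open>
  Differential at \<open>p\<close> of a map \<open>J\<close> from the manifold into some R^m, in local coordinates.
  By the chain rule it does not depend on the chart around \<open>p\<close>.
\<close>

definition diff_from ::
    "nat \<Rightarrow> 'm chart set \<Rightarrow> ('m \<Rightarrow> vec) \<Rightarrow> 'm \<Rightarrow> 'm tvec \<Rightarrow> vec"
  where "diff_from d C J p v =
     (let ch = chart_at C p in jacobian d (\<lambda>x. J (chart_inv ch x)) (snd ch p) (v ch))"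

definition riemannian_metric ::
    "nat \<Rightarrow> 'm topology \<Rightarrow> 'm chart set \<Rightarrow> ('m \<Rightarrow> 'm tvec \<Rightarrow> 'm tvec \<Rightarrow> real) \<Rightarrow> bool"
  where "riemannian_metric n M A g \<longleftrightarrow>
    (\<forall>p\<in>topspace M.
       (\<forall>u\<in>tangent_space n A p. \<forall>v\<in>tangent_space n A p. g p u v = g p v u) \<and>
       (\<forall>u\<in>tangent_space n A p. \<forall>v\<in>tangent_space n A p. \<forall>w\<in>tangent_space n A p. \<forall>a b.
          g p (tlincomb a u b v) w = a * g p u w + b * g p v w) \<and>
       (\<forall>u\<in>tangent_space n A p. u \<noteq> (\<lambda>_ _. 0) \<longrightarrow> g p u u > 0)) \<and>
    (\<forall>ch\<in>A. \<forall>i<n. \<forall>j<n. smooth_on n (snd ch ` fst ch)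
       (\<lambda>x. g (chart_inv ch x) (diff_into n A (chart_inv ch) x (unit_vec i))
                               (diff_into n A (chart_inv ch) x (unit_vec j))))"


section \<open>Submanifolds\<close>

definition slice_chart :: "nat \<Rightarrow> 'm set \<Rightarrow> 'm chart \<Rightarrow> bool"
  where "slice_chart d f ch \<longleftrightarrow> snd ch ` (fst ch \<inter> f) = snd ch ` fst ch \<inter> Rspace d"

definition submanifold :: "nat \<Rightarrow> 'm topology \<Rightarrow> 'm chart set \<Rightarrow> nat \<Rightarrow> 'm set \<Rightarrow> bool"
  where "submanifold n M A d f \<longleftrightarrow>
    d \<le> n \<and> f \<subseteq> topspace M \<and> (\<forall>p\<in>f. \<exists>ch\<in>A. p \<in> fst ch \<and> slice_chart d f ch)"

text \<open>Charts of the submanifold \<open>f\<close>; their values lie in R^d.\<close>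

definition sub_charts :: "'m chart set \<Rightarrow> nat \<Rightarrow> 'm set \<Rightarrow> 'm chart set"
  where "sub_charts A d f = {(fst ch \<inter> f, snd ch) | ch. ch \<in> A \<and> slice_chart d f ch}"


section \<open>Diffeomorphisms of class C2 between arbitrary subsets of R^d and of the manifold\<close>

text \<open>A map on an arbitrary subset is C2 if it extends to a C2 map near each point of the subset.\<close>

definition C2_into ::
    "nat \<Rightarrow> 'm topology \<Rightarrow> 'm chart set \<Rightarrow> nat \<Rightarrow> vec set \<Rightarrow> (vec \<Rightarrow> 'm) \<Rightarrow> bool"
  where "C2_into n M A d U I \<longleftrightarrow>
    (\<forall>x\<in>U. \<exists>V G. openin (Euclidean_space d) V \<and> x \<in> V \<and>
       (\<forall>y\<in>U \<inter> V. G y = I y) \<and>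
       continuous_map (subtopology (Euclidean_space d) V) M G \<and>
       (\<forall>ch\<in>A. \<forall>j<n. Ck_on d 2 {y\<in>V. G y \<in> fst ch} (\<lambda>y. snd ch (G y) j)))"

definition C2_from ::
    "nat \<Rightarrow> 'm topology \<Rightarrow> 'm chart set \<Rightarrow> nat \<Rightarrow> 'm set \<Rightarrow> ('m \<Rightarrow> vec) \<Rightarrow> bool"
  where "C2_from n M A d B J \<longleftrightarrow>
    (\<forall>p\<in>B. \<exists>W G. openin M W \<and> p \<in> W \<and>
       (\<forall>q\<in>B \<inter> W. G q = J q) \<and>
       (\<forall>ch\<in>A. \<forall>j<d. Ck_on n 2 (snd ch ` (W \<inter> fst ch)) (\<lambda>x. G (chart_inv ch x) j)))"

definition C2_diffeo ::
    "nat \<Rightarrow> 'm topology \<Rightarrow> 'm chart set \<Rightarrow> nat \<Rightarrow> vec set \<Rightarrow> 'm set \<Rightarrow> (vec \<Rightarrow> 'm) \<Rightarrow> bool"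
  where "C2_diffeo n M A d U B I \<longleftrightarrow>
    U \<subseteq> Rspace d \<and> bij_betw I U B \<and>
    C2_into n M A d U I \<and> C2_from n M A d B (inv_into U I)"


section \<open>Meshes and affine compatible local coordinates\<close>

definition cells ::
    "nat \<Rightarrow> 'm topology \<Rightarrow> 'm chart set \<Rightarrow> 'm set set \<Rightarrow> nat \<Rightarrow> 'm set set"
  where "cells n M A \<M> d = {f \<in> \<M>. submanifold n M A d f}"

definition cell_boundary :: "'m topology \<Rightarrow> 'm set \<Rightarrow> 'm set"
  where "cell_boundary M f = M closure_of f - f"

definition subcells ::
    "nat \<Rightarrow> 'm topology \<Rightarrow> 'm chart set \<Rightarrow> 'm set set \<Rightarrow> nat \<Rightarrow> 'm set \<Rightarrow> 'm set set"
  where "subcells n M A \<M> d' f = {f' \<in> cells n M A \<M> d'. f' \<subseteq> cell_boundary M f}"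

definition mesh :: "nat \<Rightarrow> 'm topology \<Rightarrow> 'm chart set \<Rightarrow> 'm set set \<Rightarrow> bool"
  where "mesh n M A \<M> \<longleftrightarrow>
    finite \<M> \<and> pairwise disjnt \<M> \<and> \<Union>\<M> = topspace M \<and>
    (\<forall>f\<in>\<M>. f \<noteq> {} \<and> (\<exists>d\<le>n. f \<in> cells n M A \<M> d)) \<and>
    (\<forall>d\<le>n. \<forall>d'<d. \<forall>f\<in>cells n M A \<M> d. \<forall>f'\<in>cells n M A \<M> d'.
       f' \<inter> M closure_of f \<noteq> {} \<longrightarrow> f' \<subseteq> cell_boundary M f)"

definition affine_map_on :: "nat \<Rightarrow> nat \<Rightarrow> vec set \<Rightarrow> (vec \<Rightarrow> vec) \<Rightarrow> bool"
  where "affine_map_on d m U T \<longleftrightarrow>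
    (\<exists>B b. \<forall>x\<in>U. \<forall>i<m. T x i = (\<Sum>j<d. B i j * x j) + b i)"

definition affine_compatible_coordinates ::
    "nat \<Rightarrow> 'm topology \<Rightarrow> 'm chart set \<Rightarrow> 'm set set \<Rightarrow>
     ('m set \<Rightarrow> vec set) \<Rightarrow> ('m set \<Rightarrow> vec \<Rightarrow> 'm) \<Rightarrow> bool"
  where "affine_compatible_coordinates n M A \<M> U I \<longleftrightarrow>
    (\<forall>d\<le>n. \<forall>f\<in>cells n M A \<M> d.
       C2_diffeo n M A d (U f) (M closure_of f) (I f) \<and>
       (\<forall>d'. d = Suc d' \<longrightarrow> (\<forall>f'\<in>subcells n M A \<M> d' f.
          affine_map_on d' d (U f') (\<lambda>x. inv_into (U f) (I f) (I f' x)))))"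


section \<open>Differential forms\<close>

text \<open>
  An l-form maps a point and a list of l tangent vectors to a real number. Forms are
  extensional: they vanish at points outside their domain and on all other lists. The degree is
  thus carried by the form, and the zero form belongs to every degree.
\<close>

type_synonym ('p, 'v) form = "'p \<Rightarrow> 'v list \<Rightarrow> real"

definition zero_form :: "('p, 'v) form"
  where "zero_form = (\<lambda>_ _. 0)"

definition form_add :: "('p, 'v) form \<Rightarrow> ('p, 'v) form \<Rightarrow> ('p, 'v) form"
  where "form_add \<alpha> \<beta> = (\<lambda>p vs. \<alpha> p vs + \<beta> p vs)"

definition form_scale :: "real \<Rightarrow> ('p, 'v) form \<Rightarrow> ('p, 'v) form"
  where "form_scale a \<alpha> = (\<lambda>p vs. a * \<alpha> p vs)"

definition form_sum :: "('i \<Rightarrow> ('p, 'v) form) \<Rightarrow> 'i set \<Rightarrow> ('p, 'v) form"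
  where "form_sum h S = (\<lambda>p vs. \<Sum>s\<in>S. h s p vs)"

definition alternating_form :: "nat \<Rightarrow> vec set \<Rightarrow> (vec list \<Rightarrow> real) \<Rightarrow> bool"
  where "alternating_form l E \<phi> \<longleftrightarrow>
    (\<forall>vs. \<not> (length vs = l \<and> set vs \<subseteq> E) \<longrightarrow> \<phi> vs = 0) \<and>
    (\<forall>us ws u v a b. length us + length ws + 1 = l \<and> set us \<subseteq> E \<and> set ws \<subseteq> E \<and> u \<in> E \<and> v \<in> E \<longrightarrow>
       \<phi> (us @ lincomb a u b v # ws) = a * \<phi> (us @ u # ws) + b * \<phi> (us @ v # ws)) \<and>
    (\<forall>vs i j. length vs = l \<and> i < j \<and> j < l \<and> vs ! i = vs ! j \<longrightarrow> \<phi> vs = 0)"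

definition form_on_Rspace :: "nat \<Rightarrow> nat \<Rightarrow> (vec, vec) form \<Rightarrow> bool"
  where "form_on_Rspace d l \<alpha> \<longleftrightarrow>
    (\<forall>x\<in>Rspace d. alternating_form l (Rspace d) (\<alpha> x)) \<and> (\<forall>x. x \<notin> Rspace d \<longrightarrow> \<alpha> x = (\<lambda>_. 0))"

definition multiindices :: "nat \<Rightarrow> nat \<Rightarrow> (nat \<Rightarrow> nat) set"
  where "multiindices d r = {m. (\<forall>i\<ge>d. m i = 0) \<and> (\<Sum>i<d. m i) = r}"

definition homogeneous_poly :: "nat \<Rightarrow> nat \<Rightarrow> (vec \<Rightarrow> real) \<Rightarrow> bool"
  where "homogeneous_poly d r q \<longleftrightarrow>
    (\<exists>c. \<forall>x\<in>Rspace d. q x = (\<Sum>m\<in>multiindices d r. c m * (\<Prod>i<d. x i ^ m i)))"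

text \<open>
  The coefficient of \<open>\<alpha>\<close> along \<open>dx\<^sub>j\<^sub>1 \<and> \<dots> \<and> dx\<^sub>j\<^sub>l\<close> with \<open>j\<^sub>1 < \<dots> < j\<^sub>l\<close> is its value on the
  corresponding basis vectors.
\<close>

definition hom_forms :: "nat \<Rightarrow> int \<Rightarrow> int \<Rightarrow> (vec, vec) form set"
  where "hom_forms d r l =
    (if r < 0 \<or> l < 0 \<or> l > int d then {zero_form}
     else {\<alpha>. form_on_Rspace d (nat l) \<alpha> \<and>
              (\<forall>js. length js = nat l \<and> sorted_wrt (<) js \<and> set js \<subseteq> {..<d} \<longrightarrow>
                 homogeneous_poly d (nat r) (\<lambda>x. \<alpha> x (map unit_vec js)))})"

definition pullback ::
    "nat \<Rightarrow> 'm chart set \<Rightarrow> 'm set \<Rightarrow> ('m \<Rightarrow> vec) \<Rightarrow> (vec, vec) form \<Rightarrow> ('m, 'm tvec) form"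
  where "pullback d C f J \<alpha> = (\<lambda>p vs.
     if p \<in> f \<and> set vs \<subseteq> tangent_space d C p
     then \<alpha> (J p) (map (diff_from d C J p) vs) else 0)"

definition interior_product :: "('p \<Rightarrow> 'v) \<Rightarrow> ('p, 'v) form \<Rightarrow> ('p, 'v) form"
  where "interior_product X \<omega> = (\<lambda>p vs. \<omega> p (X p # vs))"

text \<open>
  Exterior derivative on R^d: alternating sum over \<open>i\<close> of the derivative in direction \<open>v\<^sub>i\<close>
  of the form evaluated on the remaining vectors.
\<close>

definition ext_deriv_Rspace :: "nat \<Rightarrow> (vec, vec) form \<Rightarrow> (vec, vec) form"
  where "ext_deriv_Rspace d \<alpha> = (\<lambda>x vs. \<Sum>i<length vs.
     (-1) ^ i * (\<Sum>j<d. partial j (\<lambda>y. \<alpha> y (take i vs @ drop (Suc i) vs)) x * (vs ! i) j))"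

text \<open>Representative of a form in a chart: its pullback by the inverse of the chart.\<close>

definition local_form ::
    "nat \<Rightarrow> 'm chart set \<Rightarrow> 'm chart \<Rightarrow> ('m, 'm tvec) form \<Rightarrow> (vec, vec) form"
  where "local_form d C ch \<omega> = (\<lambda>x us.
     if x \<in> snd ch ` fst ch \<and> set us \<subseteq> Rspace d
     then \<omega> (chart_inv ch x) (map (diff_into d C (chart_inv ch) x) us) else 0)"

text \<open>
  Exterior derivative on a manifold, in local coordinates; since the exterior derivative on R^d
  commutes with pullbacks, it does not depend on the chart around \<open>p\<close>.
\<close>

definition ext_deriv ::
    "nat \<Rightarrow> 'm chart set \<Rightarrow> 'm set \<Rightarrow> ('m, 'm tvec) form \<Rightarrow> ('m, 'm tvec) form"
  where "ext_deriv d C f \<omega> = (\<lambda>p vs.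
     if p \<in> f \<and> set vs \<subseteq> tangent_space d C p
     then let ch = chart_at C p
          in ext_deriv_Rspace d (local_form d C ch \<omega>) (snd ch p) (map (\<lambda>v. v ch) vs)
     else 0)"


section \<open>Polynomial forms on a cell\<close>

text \<open>
  In the following, \<open>f\<close> is a cell of dimension \<open>d\<close>, with coordinates \<open>I f\<close> defined on \<open>U f\<close>.
\<close>

definition cell_J :: "('m set \<Rightarrow> vec set) \<Rightarrow> ('m set \<Rightarrow> vec \<Rightarrow> 'm) \<Rightarrow> 'm set \<Rightarrow> 'm \<Rightarrow> vec"
  where "cell_J U I f = inv_into (U f) (I f)"

definition cell_hom_forms ::
    "'m chart set \<Rightarrow> ('m set \<Rightarrow> vec set) \<Rightarrow> ('m set \<Rightarrow> vec \<Rightarrow> 'm) \<Rightarrow>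
     nat \<Rightarrow> 'm set \<Rightarrow> int \<Rightarrow> int \<Rightarrow> ('m, 'm tvec) form set"
  where "cell_hom_forms A U I d f r l =
     pullback d (sub_charts A d f) f (cell_J U I f) ` hom_forms d r l"

definition cell_poly_forms ::
    "'m chart set \<Rightarrow> ('m set \<Rightarrow> vec set) \<Rightarrow> ('m set \<Rightarrow> vec \<Rightarrow> 'm) \<Rightarrow>
     nat \<Rightarrow> 'm set \<Rightarrow> int \<Rightarrow> int \<Rightarrow> ('m, 'm tvec) form set"
  where "cell_poly_forms A U I d f r l =
     {form_sum h S | h S. finite S \<and> S \<subseteq> {..r} \<and> (\<forall>s\<in>S. h s \<in> cell_hom_forms A U I d f s l)}"

definition cell_d :: "'m chart set \<Rightarrow> nat \<Rightarrow> 'm set \<Rightarrow> ('m, 'm tvec) form \<Rightarrow> ('m, 'm tvec) form"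
  where "cell_d A d f = ext_deriv d (sub_charts A d f) f"

text \<open>Push-forward by \<open>I f\<close> of the identity vector field on R^d.\<close>

definition cell_field ::
    "'m chart set \<Rightarrow> ('m set \<Rightarrow> vec set) \<Rightarrow> ('m set \<Rightarrow> vec \<Rightarrow> 'm) \<Rightarrow> nat \<Rightarrow> 'm set \<Rightarrow> 'm \<Rightarrow> 'm tvec"
  where "cell_field A U I d f p =
     diff_into d (sub_charts A d f) (I f) (cell_J U I f p) (cell_J U I f p)"

definition cell_kappa ::
    "'m chart set \<Rightarrow> ('m set \<Rightarrow> vec set) \<Rightarrow> ('m set \<Rightarrow> vec \<Rightarrow> 'm) \<Rightarrow> nat \<Rightarrow> 'm set \<Rightarrow>
     ('m, 'm tvec) form \<Rightarrow> ('m, 'm tvec) form"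
  where "cell_kappa A U I d f = interior_product (cell_field A U I d f)"

definition form_subspace :: "('p, 'v) form set \<Rightarrow> bool"
  where "form_subspace V \<longleftrightarrow> zero_form \<in> V \<and>
    (\<forall>\<alpha>\<in>V. \<forall>\<beta>\<in>V. form_add \<alpha> \<beta> \<in> V) \<and> (\<forall>\<alpha>\<in>V. \<forall>a. form_scale a \<alpha> \<in> V)"

definition form_linear_on :: "('p, 'v) form set \<Rightarrow> (('p, 'v) form \<Rightarrow> ('p, 'v) form) \<Rightarrow> bool"
  where "form_linear_on V T \<longleftrightarrow>
    (\<forall>\<alpha>\<in>V. \<forall>\<beta>\<in>V. T (form_add \<alpha> \<beta>) = form_add (T \<alpha>) (T \<beta>)) \<and>
    (\<forall>\<alpha>\<in>V. \<forall>a. T (form_scale a \<alpha>) = form_scale a (T \<alpha>))"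

text \<open>
  The spaces \<open>P r l\<close> form a complex for \<open>T\<close>, which shifts the polynomial degree \<open>r\<close> by \<open>\<rho>\<close>
  and the form degree \<open>l\<close> by \<open>\<sigma>\<close>.
\<close>

definition is_complex ::
    "(int \<Rightarrow> int \<Rightarrow> ('p, 'v) form set) \<Rightarrow> int \<Rightarrow> int \<Rightarrow> (('p, 'v) form \<Rightarrow> ('p, 'v) form) \<Rightarrow> bool"
  where "is_complex P \<rho> \<sigma> T \<longleftrightarrow>
    (\<forall>r l. form_subspace (P r l) \<and> form_linear_on (P r l) T \<and>
           T ` P r l \<subseteq> P (r + \<rho>) (l + \<sigma>) \<and> (\<forall>p\<in>P r l. T (T p) = zero_form))"

definition direct_family :: "(int \<Rightarrow> ('p, 'v) form set) \<Rightarrow> bool"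
  where "direct_family H \<longleftrightarrow>
    (\<forall>S h. finite S \<and> (\<forall>s\<in>S. h s \<in> H s) \<and> form_sum h S = zero_form \<longrightarrow> (\<forall>s\<in>S. h s = zero_form))"

end

(*
  In the coordinates J of a cell, kappa is the contraction with the Euler field X(x) = x, so
  everything reduces to forms with homogeneous coefficients on R^d. There Cartan's formula
  d i_X + i_X d = L_X and Euler's identity for homogeneous functions give the eigenvalue
  lambda(s, l) = s + l on H_s Lambda^l.

  The inverse of J is only given on the set U_f, and it can be differentiated at the points of
  J(f) because J(f) is open in R^d by invariance of domain. As J is C2, the second derivatives
  of J are symmetric and cancel in the alternating sum defining d, so d commutes with J^*.

  Directness of the sum over s follows from the eigenvalues s + l being distinct.
  Non-triviality of d is seen on the forms x_l^s omega_l, where omega_0 = 1 and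
  omega_(k+1) = d(x_k omega_k).
*)
theory Submission
  imports Defs "HOL-Homology.Invariance_of_Domain"
begin

section \<open>Alternating sums over omitted arguments\<close>

text \<open>The eigenvalue has two sources: \<open>s\<close> comes from differentiating the
  coefficients along X (Euler), and \<open>l\<close> from differentiating X itself, whose derivative
  is the identity and acts in each of the \<open>l\<close> arguments. No Lie derivative is formed;
  both parts drop out of an alternating sum. The pullback by J sees a form only on J(f), so an
  equality of pullbacks does not by itself give an equality of polynomials on R^d. Directness is
  therefore argued on the cell, where linearity of d kappa + kappa d is enough, and non-triviality
  uses a single point of f at which the chosen coordinate of J is nonzero. Such a point exists
  because J(f) is open. The obstacle for d is that its linearity depends on the existence of
  derivatives. All identities are therefore transported from R^d along J, and spaces of C1 forms
  serve as common domains of linearity for sums of different polynomial degrees.\<close>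

primrec altsum :: "'a list \<Rightarrow> ('a \<Rightarrow> 'a list \<Rightarrow> real) \<Rightarrow> real"
  where
    "altsum [] F = 0"
  | "altsum (v # vs) F = F v vs - altsum vs (\<lambda>w us. F w (v # us))"

text \<open>The recursion keeps each skipped argument in front of the rest handed to
  \<open>F\<close>, and its minus signs add up to \<open>(-1) ^ i\<close>. Inductions over argument
  lists use the recursive form; this closed form identifies it with the sum in
  \<open>ext_deriv_Rspace\<close>.\<close>

lemma altsum_eq_sum:
  "altsum vs F = (\<Sum>i<length vs. (-1) ^ i * F (vs ! i) (take i vs @ drop (Suc i) vs))"
  by (induction vs arbitrary: F) (simp_all add: sum.lessThan_Suc_shift sum_negf del: sum.lessThan_Suc)

text \<open>Most identities between summands need vectors in R^d or a list of the right length, so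
  the premise keeps what is known about \<open>v\<close> and \<open>us\<close>.\<close>

lemma altsum_cong:
  assumes "\<And>v us. v \<in> set vs \<Longrightarrow> set us \<subseteq> set vs \<Longrightarrow> length vs = Suc (length us) \<Longrightarrow> F v us = G v us"
  shows "altsum vs F = altsum vs G"
  using assms
proof (induction vs arbitrary: F G)
  case (Cons v vs)
  have "altsum vs (\<lambda>w us. F w (v # us)) = altsum vs (\<lambda>w us. G w (v # us))"
    by (rule Cons.IH, rule Cons.prems) auto
  moreover have "F v vs = G v vs" by (rule Cons.prems) auto
  ultimately show ?case by simp
qed simp

lemma altsum_zero: "altsum vs (\<lambda>_ _. 0) = 0"
  by (induction vs) auto

lemma altsum_lin:
  "altsum vs (\<lambda>v us. a * F v us + b * G v us) = a * altsum vs F + b * altsum vs G"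
  by (induction vs arbitrary: F G) (simp_all add: algebra_simps)

lemma altsum_add: "altsum vs (\<lambda>v us. F v us + G v us) = altsum vs F + altsum vs G"
  using altsum_lin[of vs 1 F 1 G] by simp

lemma altsum_scale: "altsum vs (\<lambda>v us. a * F v us) = a * altsum vs F"
  using altsum_lin[of vs a F 0 F] by simp

lemma altsum_uminus: "altsum vs (\<lambda>v us. - F v us) = - altsum vs F"
  using altsum_scale[of vs "-1" F] by simp

lemma altsum_sum: "finite S \<Longrightarrow> altsum vs (\<lambda>v us. \<Sum>s\<in>S. F s v us) = (\<Sum>s\<in>S. altsum vs (F s))"
  by (induction S rule: finite_induct) (simp_all add: altsum_zero altsum_add)

lemma altsum_map: "altsum (map h vs) F = altsum vs (\<lambda>v us. F (h v) (map h us))"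
  by (induction vs arbitrary: F) auto

text \<open>Each pair of arguments is omitted twice, in both orders and with opposite signs. This is
  the mechanism behind d d = 0 and behind the disappearance of the second derivatives of a
  coordinate change.\<close>

lemma altsum_altsum_symmetric:
  assumes "\<And>v w ts. v \<in> S \<Longrightarrow> w \<in> S \<Longrightarrow> F v w ts = F w v ts" and "set vs \<subseteq> S"
  shows "altsum vs (\<lambda>v us. altsum us (F v)) = 0"
  using assms
proof (induction vs arbitrary: F)
  case (Cons v vs)
  \<comment> \<open>Here \<open>w\<close> is omitted before \<open>v\<close>. The part that omits
    both cancels against \<open>altsum vs (F v)\<close>, where \<open>v\<close> goes first; the part
    that keeps \<open>v\<close> is an instance of the induction hypothesis.\<close>
  have "altsum vs (\<lambda>w us. altsum (v # us) (F w)) =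
      altsum vs (\<lambda>w us. F w v us) - altsum vs (\<lambda>w us. altsum us (\<lambda>u ts. F w u (v # ts)))"
    using altsum_add[of vs _ "\<lambda>w us. - altsum us (\<lambda>u ts. F w u (v # ts))"]
    by (simp add: altsum_uminus)
  moreover have "altsum vs (\<lambda>w us. altsum us (\<lambda>u ts. F w u (v # ts))) = 0"
    using Cons.prems by (intro Cons.IH) auto
  moreover have "altsum vs (\<lambda>w us. F w v us) = altsum vs (F v)"
    using Cons.prems by (intro altsum_cong) auto
  ultimately show ?case by simp
qed simp


section \<open>Alternating forms on coordinate space\<close>

lemma Rspace_iff: "x \<in> Rspace d \<longleftrightarrow> (\<forall>i\<ge>d. x i = 0)"
  by (simp add: topspace_Euclidean_space)

lemma lincomb_Rspace: "u \<in> Rspace d \<Longrightarrow> v \<in> Rspace d \<Longrightarrow> lincomb a u b v \<in> Rspace d"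
  by (simp add: Rspace_iff lincomb_def)

lemma unit_vec_Rspace: "i < d \<Longrightarrow> unit_vec i \<in> Rspace d"
  by (simp add: Rspace_iff unit_vec_def)

lemma fun_upd_Rspace: "x \<in> Rspace d \<Longrightarrow> i < d \<Longrightarrow> x(i := t) \<in> Rspace d"
  by (auto simp: Rspace_iff)

lemma fun_upd_Rspace_iff: "i < d \<Longrightarrow> x(i := t) \<in> Rspace d \<longleftrightarrow> x \<in> Rspace d"
  by (auto simp: Rspace_iff)

text \<open>
  In contrast to \<^const>\<open>alternating_form\<close> this fixes no degree, so that it is inherited by
  all partial applications of a form.
\<close>

definition skew :: "nat \<Rightarrow> (vec list \<Rightarrow> real) \<Rightarrow> bool"
  where "skew d \<phi> \<longleftrightarrow>
    (\<forall>us ws u v a b. u \<in> Rspace d \<longrightarrow> v \<in> Rspace d \<longrightarrow>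
       \<phi> (us @ lincomb a u b v # ws) = a * \<phi> (us @ u # ws) + b * \<phi> (us @ v # ws)) \<and>
    (\<forall>us ws u v. \<phi> (us @ u # v # ws) = - \<phi> (us @ v # u # ws))"

lemma skew_lincomb:
  "skew d \<phi> \<Longrightarrow> u \<in> Rspace d \<Longrightarrow> v \<in> Rspace d \<Longrightarrow>
    \<phi> (us @ lincomb a u b v # ws) = a * \<phi> (us @ u # ws) + b * \<phi> (us @ v # ws)"
  by (simp add: skew_def)

lemma skew_swap: "skew d \<phi> \<Longrightarrow> \<phi> (us @ u # v # ws) = - \<phi> (us @ v # u # ws)"
  unfolding skew_def by blast

lemma skew_append:
  assumes "skew d \<phi>"
  shows "skew d (\<lambda>us. \<phi> (ts @ us))"
  unfolding skew_def
proof (intro conjI allI impI)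
  fix us ws u v and a b :: real
  assume "u \<in> Rspace d" "v \<in> Rspace d"
  then show "\<phi> (ts @ us @ lincomb a u b v # ws) =
      a * \<phi> (ts @ us @ u # ws) + b * \<phi> (ts @ us @ v # ws)"
    using skew_lincomb[OF assms, of u v "ts @ us"] by simp
next
  fix us ws u v
  show "\<phi> (ts @ us @ u # v # ws) = - \<phi> (ts @ us @ v # u # ws)"
    using skew_swap[OF assms, of "ts @ us" u v ws] by simp
qed

lemma skew_Cons: "skew d \<phi> \<Longrightarrow> skew d (\<lambda>us. \<phi> (v # us))"
  using skew_append[of d \<phi> "[v]"] by simp

lemma skew_move:
  assumes "skew d \<phi>"
  shows "\<phi> (us @ ts @ b # ws) = (-1) ^ length ts * \<phi> (us @ b # ts @ ws)"
proof (induction ts arbitrary: ws rule: rev_induct)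
  case (snoc t ts)
  have "\<phi> (us @ (ts @ [t]) @ b # ws) = - \<phi> (us @ ts @ b # t # ws)"
    using skew_swap[OF assms, of "us @ ts" t b ws] by simp
  then show ?case using snoc[of "t # ws"] by simp
qed simp

text \<open>Bring the second \<open>v\<close> next to the first; swapping two equal neighbours turns
  the value into its own negative.\<close>

lemma skew_repeat:
  assumes "skew d \<phi>"
  shows "\<phi> (us @ v # ws @ v # ts) = 0"
  using skew_move[OF assms, of "us @ [v]" ws v ts] skew_swap[OF assms, of us v v "ws @ ts"]
  by simp

lemma skew_not_distinct:
  assumes "skew d \<phi>" and "\<not> distinct vs"
  shows "\<phi> vs = 0"
proof -
  obtain us ws ts v where "vs = us @ [v] @ ws @ [v] @ ts"
    using not_distinct_decomp[OF assms(2)] by blast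
  then show ?thesis using skew_repeat[OF assms(1)] by simp
qed

text \<open>\<open>skew\<close> provides linearity for combinations of two vectors, so
  \<open>v\<close> is assembled one coordinate at a time: \<open>tr m\<close> is \<open>v\<close>
  with its entries from \<open>m\<close> on replaced by 0.\<close>

lemma skew_expand:
  assumes \<phi>: "skew d \<phi>" and v: "v \<in> Rspace d"
  shows "\<phi> (us @ v # ws) = (\<Sum>j<d. v j * \<phi> (us @ unit_vec j # ws))"
proof -
  define tr where "tr m = (\<lambda>i. if i < m then v i else 0)" for m
  have tr: "tr m \<in> Rspace d" if "m \<le> d" for m
    using that by (simp add: tr_def Rspace_iff)
  have "\<phi> (us @ tr m # ws) = (\<Sum>j<m. v j * \<phi> (us @ unit_vec j # ws))" if "m \<le> d" for m
    using that
  proof (induction m)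
    case 0
    \<comment> \<open>Writing the zero vector as a combination with both coefficients 0 makes
      linearity give the value 0.\<close>
    have "tr 0 = lincomb 0 v 0 v" by (simp add: tr_def lincomb_def)
    then show ?case using skew_lincomb[OF \<phi> v v, of us 0 0 ws] by simp
  next
    case (Suc m)
    have "tr (Suc m) = lincomb 1 (tr m) (v m) (unit_vec m)"
      by (auto simp: tr_def lincomb_def unit_vec_def fun_eq_iff less_Suc_eq)
    then show ?case
      using skew_lincomb[OF \<phi> tr[of m] unit_vec_Rspace[of m d], of us 1 "v m" ws] Suc by simp
  qed
  moreover have "tr d = v" using v by (auto simp: tr_def Rspace_iff fun_eq_iff)
  ultimately show ?thesis by force
qed

text \<open>Returning the omitted argument to its place costs exactly the sign it carries in
  \<open>altsum\<close>, so every term equals \<open>\<phi> vs\<close>. The number of terms becomes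
  the summand \<open>l\<close> of the eigenvalue.\<close>

lemma altsum_skew: "skew d \<phi> \<Longrightarrow> altsum vs (\<lambda>v us. \<phi> (v # us)) = real (length vs) * \<phi> vs"
proof (induction vs arbitrary: \<phi>)
  case (Cons v vs)
  have "altsum vs (\<lambda>w us. \<phi> (w # v # us)) = - altsum vs (\<lambda>w us. \<phi> (v # w # us))"
    unfolding altsum_uminus[symmetric]
  proof (rule altsum_cong)
    show "\<phi> (w # v # us) = - \<phi> (v # w # us)" for w us
      using skew_swap[OF Cons.prems, of "[]" w v us] by simp
  qed
  then show ?case using Cons.IH[OF skew_Cons[OF Cons.prems], of v] by (simp add: algebra_simps)
qed simp

text \<open>Used for \<open>dir_deriv\<close>, it makes the exterior derivative alternating. When
  two neighbours are swapped, the terms omitting one of them trade places with opposite signs, and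
  all others change sign by the skewness of \<open>F\<close>.\<close>

lemma skew_altsum:
  assumes "\<And>v. skew d (F v)"
    and "\<And>u v a b us. F (lincomb a u b v) us = a * F u us + b * F v us"
  shows "skew d (\<lambda>vs. altsum vs F)"
  unfolding skew_def
proof (intro conjI allI impI)
  fix us ws u v and a b :: real
  assume uv: "u \<in> Rspace d" "v \<in> Rspace d"
  show "altsum (us @ lincomb a u b v # ws) F =
      a * altsum (us @ u # ws) F + b * altsum (us @ v # ws) F"
    using assms
  proof (induction us arbitrary: F)
    case Nil
    have "altsum ws (\<lambda>w us. F w (lincomb a u b v # us)) =
        a * altsum ws (\<lambda>w us. F w (u # us)) + b * altsum ws (\<lambda>w us. F w (v # us))"
      unfolding altsum_lin[symmetric]
      using skew_lincomb[OF Nil(1) uv, of _ "[]"] by simp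
    then show ?case using Nil(2) by (simp add: algebra_simps)
  next
    case (Cons y us)
    have "altsum (us @ lincomb a u b v # ws) (\<lambda>w us. F w (y # us)) =
        a * altsum (us @ u # ws) (\<lambda>w us. F w (y # us)) + b * altsum (us @ v # ws) (\<lambda>w us. F w (y # us))"
      using Cons.prems by (intro Cons.IH skew_Cons) auto
    then show ?case using skew_lincomb[OF Cons.prems(1) uv] by (simp add: algebra_simps)
  qed
next
  fix us ws u v
  show "altsum (us @ u # v # ws) F = - altsum (us @ v # u # ws) F"
    using assms(1)
  proof (induction us arbitrary: F)
    case Nil
    have "altsum ws (\<lambda>w us. F w (u # v # us)) = - altsum ws (\<lambda>w us. F w (v # u # us))"
      unfolding altsum_uminus[symmetric]
    proof (rule altsum_cong)
      show "F w (u # v # us) = - F w (v # u # us)" for w us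
        using skew_swap[OF Nil, of w "[]" u v us] by simp
    qed
    then show ?case by simp
  next
    case (Cons y us)
    have "altsum (us @ u # v # ws) (\<lambda>w us. F w (y # us)) =
        - altsum (us @ v # u # ws) (\<lambda>w us. F w (y # us))"
      using Cons.prems by (intro Cons.IH skew_Cons) auto
    then show ?case using skew_swap[OF Cons.prems, of y us u v ws] by simp
  qed
qed

section \<open>Passage between alternating forms of a fixed degree, skew functions and
  coefficients\<close>

lemma alternating_form_outside:
  "alternating_form l E \<phi> \<Longrightarrow> \<not> (length vs = l \<and> set vs \<subseteq> E) \<Longrightarrow> \<phi> vs = 0"
  unfolding alternating_form_def by blast

text \<open>\<open>skew\<close> restricts neither the length of the list nor its fixed entries; in
  the cases that the clauses of \<open>alternating_form\<close> do not cover, both sides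
  vanish.\<close>

lemma alternating_form_skew:
  assumes "alternating_form l (Rspace d) \<phi>"
  shows "skew d \<phi>"
proof -
  have out: "\<not> (length vs = l \<and> set vs \<subseteq> Rspace d) \<Longrightarrow> \<phi> vs = 0" for vs
    using assms by (rule alternating_form_outside)
  have lin: "\<phi> (us @ lincomb a u b v # ws) = a * \<phi> (us @ u # ws) + b * \<phi> (us @ v # ws)"
    if uv: "u \<in> Rspace d" "v \<in> Rspace d" for us ws u v a b
  proof (cases "length us + length ws + 1 = l \<and> set us \<subseteq> Rspace d \<and> set ws \<subseteq> Rspace d")
    case True
    then show ?thesis using assms uv unfolding alternating_form_def by blast
  next
    case False
    then have "\<phi> (us @ w # ws) = 0" for w by (intro out) auto
    then show ?thesis by simp
  qed
  have adj: "\<phi> (us @ v # v # ws) = 0" for us v ws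
  proof (cases "length us + length ws + 2 = l")
    case True
    have "\<forall>vs i j. length vs = l \<and> i < j \<and> j < l \<and> vs ! i = vs ! j \<longrightarrow> \<phi> vs = 0"
      using assms unfolding alternating_form_def by blast
    from this[rule_format, of "us @ v # v # ws" "length us" "Suc (length us)"] True
    show ?thesis by (simp add: nth_append)
  qed (auto intro: out)
  have "\<phi> (us @ u # v # ws) = - \<phi> (us @ v # u # ws)" for us ws u v
  proof (cases "u \<in> Rspace d \<and> v \<in> Rspace d")
    case True
    \<comment> \<open>Polarisation: a list with \<open>u + v\<close> in two adjacent places has
      value 0, and expanding both places leaves the two mixed terms.\<close>
    let ?w = "lincomb 1 u 1 v"
    have w: "?w \<in> Rspace d" using True lincomb_Rspace by blast
    have "0 = \<phi> (us @ ?w # ?w # ws)" by (simp add: adj)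
    also have "\<dots> = \<phi> (us @ u # ?w # ws) + \<phi> (us @ v # ?w # ws)"
      using lin[of u v us 1 1] True by simp
    also have "\<dots> = \<phi> (us @ u # v # ws) + \<phi> (us @ v # u # ws)"
      using lin[of u v "us @ [u]" 1 1] lin[of u v "us @ [v]" 1 1] True by (simp add: adj)
    finally show ?thesis by simp
  next
    case False
    then have "\<phi> (us @ u # v # ws) = 0" "\<phi> (us @ v # u # ws) = 0" by (auto intro!: out)
    then show ?thesis by simp
  qed
  with lin show ?thesis unfolding skew_def by blast
qed

lemma skew_alternating_form:
  assumes \<phi>: "skew d \<phi>" and out: "\<And>vs. \<not> (length vs = l \<and> set vs \<subseteq> Rspace d) \<Longrightarrow> \<phi> vs = 0"
  shows "alternating_form l (Rspace d) \<phi>"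
  unfolding alternating_form_def
proof (intro conjI allI impI)
  fix vs :: "vec list" and i j
  assume "length vs = l \<and> i < j \<and> j < l \<and> vs ! i = vs ! j"
  then have "\<not> distinct vs" by (metis less_irrefl nth_eq_iff_index_eq order.strict_trans)
  then show "\<phi> vs = 0" using skew_not_distinct[OF \<phi>] by blast
qed (use out skew_lincomb[OF \<phi>] in auto)

lemma insort_decomp: "\<exists>ys zs. xs = ys @ zs \<and> insort x xs = ys @ x # zs"
proof (induction xs)
  case (Cons a xs)
  then obtain ys zs where "xs = ys @ zs" "insort x xs = ys @ x # zs" by blast
  then have "\<not> x \<le> a \<Longrightarrow> a # xs = (a # ys) @ zs \<and> insort x (a # xs) = (a # ys) @ x # zs" by simp
  moreover have "x \<le> a \<Longrightarrow> a # xs = [] @ a # xs \<and> insort x (a # xs) = [] @ x # a # xs" by simp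
  ultimately show ?case by blast
qed simp

text \<open>The factor \<open>c\<close> is chosen before \<open>\<phi>\<close>: it depends on the
  index list only, and so is the same at all points when \<open>\<phi>\<close> is the value of a
  form.\<close>

lemma skew_sort:
  fixes js :: "nat list"
  shows "\<exists>c. \<forall>\<phi>. skew d \<phi> \<longrightarrow> \<phi> (map unit_vec js) = c * \<phi> (map unit_vec (sort js))"
proof (induction js)
  case Nil
  show ?case by (rule exI[of _ 1]) simp
next
  case (Cons j js)
  then obtain c where c: "\<And>\<phi>. skew d \<phi> \<Longrightarrow> \<phi> (map unit_vec js) = c * \<phi> (map unit_vec (sort js))"
    by blast
  obtain ys zs where yz: "sort js = ys @ zs" "insort j (sort js) = ys @ j # zs"
    using insort_decomp by metis
  have "\<phi> (map unit_vec (j # js)) = c * (-1) ^ length ys * \<phi> (map unit_vec (sort (j # js)))"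
    if \<phi>: "skew d \<phi>" for \<phi>
  proof -
    have "\<phi> (map unit_vec (j # js)) = c * \<phi> (unit_vec j # map unit_vec ys @ map unit_vec zs)"
      using c[OF skew_Cons[OF \<phi>]] yz by simp
    moreover have "\<phi> (map unit_vec (sort (j # js))) =
        (-1) ^ length ys * \<phi> (unit_vec j # map unit_vec ys @ map unit_vec zs)"
      using skew_move[OF \<phi>, of "[]" "map unit_vec ys" "unit_vec j"] yz by simp
    ultimately show ?thesis by (simp flip: power_add mult_2)
  qed
  then show ?case by blast
qed

text \<open>Bridge from coefficients along increasing index lists to values on arbitrary lists. For
  fixed vectors \<open>vs\<close> the value is a linear combination of these coefficients, with
  factors independent of \<open>x\<close>.\<close>

lemma coefficients_induct:
  fixes P :: "(vec \<Rightarrow> real) \<Rightarrow> bool"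
  assumes \<alpha>: "\<And>x. alternating_form l (Rspace d) (\<alpha> x)"
    and zero: "P (\<lambda>_. 0)" and lin: "\<And>f g a b. P f \<Longrightarrow> P g \<Longrightarrow> P (\<lambda>x. a * f x + b * g x)"
    and coeff: "\<And>js. length js = l \<Longrightarrow> sorted_wrt (<) js \<Longrightarrow> set js \<subseteq> {..<d} \<Longrightarrow>
      P (\<lambda>x. \<alpha> x (map unit_vec js))"
  shows "P (\<lambda>x. \<alpha> x vs)"
proof -
  have sk: "skew d (\<alpha> x)" for x using \<alpha> alternating_form_skew by blast
  have scale: "P f \<Longrightarrow> P (\<lambda>x. a * f x)" for f a using lin[of f f a 0] by simp
  have sum: "finite S \<Longrightarrow> (\<And>s. s \<in> S \<Longrightarrow> P (f s)) \<Longrightarrow> P (\<lambda>x. \<Sum>s\<in>S. c s * f s x)" for f S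
    and c :: "nat \<Rightarrow> real"
  proof (induction S rule: finite_induct)
    case (insert s S)
    then show ?case using lin[of "f s" "\<lambda>x. \<Sum>s\<in>S. c s * f s x" "c s" 1] by simp
  qed (simp add: zero)
  have basis: "P (\<lambda>x. \<alpha> x (map unit_vec js))" if js: "length js = l" "set js \<subseteq> {..<d}" for js
  proof (cases "distinct js")
    case True
    obtain c where "\<And>x. \<alpha> x (map unit_vec js) = c * \<alpha> x (map unit_vec (sort js))"
      using skew_sort[of d js] sk by blast
    moreover have "P (\<lambda>x. \<alpha> x (map unit_vec (sort js)))"
      using js True by (intro coeff) (auto simp: strict_sorted_iff)
    ultimately show ?thesis using scale by simp
  next
    case False
    then have "\<not> distinct (map unit_vec js)" by (simp add: distinct_map)
    then have "\<alpha> x (map unit_vec js) = 0" for x using skew_not_distinct[OF sk] by blast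
    then show ?thesis using zero by simp
  qed
  \<comment> \<open>Arguments are replaced by unit vectors from the left: \<open>js\<close> are the
    indices already chosen, \<open>ws\<close> the arguments still to be expanded.\<close>
  have "P (\<lambda>x. \<alpha> x (map unit_vec js @ ws))"
    if "length js + length ws = l" "set js \<subseteq> {..<d}" "set ws \<subseteq> Rspace d" for js ws
    using that
  proof (induction ws arbitrary: js)
    case (Cons w ws)
    have "P (\<lambda>x. \<alpha> x (map unit_vec (js @ [j]) @ ws))" if "j < d" for j
      using Cons.prems that by (intro Cons.IH) auto
    then have "P (\<lambda>x. \<Sum>j<d. w j * \<alpha> x (map unit_vec js @ unit_vec j # ws))"
      by (intro sum) auto
    then show ?case using skew_expand[OF sk] Cons.prems by simp
  qed (auto intro: basis)
  from this[of "[]" vs] show ?thesis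
    using alternating_form_outside[OF \<alpha>] zero by (cases "length vs = l \<and> set vs \<subseteq> Rspace d") auto
qed

section \<open>Partial derivatives\<close>

text \<open>The topology comes from a product over all natural numbers, but vectors of R^d can
  differ only in the first \<open>d\<close> coordinates, so a small cube in these suffices.\<close>

lemma openin_box:
  assumes "openin (Euclidean_space d) V" and "x \<in> V"
  obtains e where "e > 0" and "\<And>y. y \<in> Rspace d \<Longrightarrow> (\<And>i. i < d \<Longrightarrow> \<bar>y i - x i\<bar> < e) \<Longrightarrow> y \<in> V"
proof -
  obtain T where T: "openin (powertop_real UNIV) T" "V = T \<inter> Rspace d"
    using assms(1) unfolding Euclidean_space_def topspace_subtopology openin_subtopology by auto
  obtain X where X: "x \<in> (\<Pi>\<^sub>E i\<in>UNIV. X i)" "\<And>i. openin euclideanreal (X i)"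
      "(\<Pi>\<^sub>E i\<in>UNIV. X i) \<subseteq> T"
    using product_topology_open_contains_basis[OF T(1), of x] assms(2) T(2) by blast
  have "\<exists>e>0. \<forall>y. \<bar>y - x i\<bar> < e \<longrightarrow> y \<in> X i" for i
  proof -
    have "open (X i)" "x i \<in> X i" using X by auto
    then show ?thesis by (metis dist_real_def open_dist)
  qed
  then obtain e where e: "\<And>i. e i > 0" "\<And>i y. \<bar>y - x i\<bar> < e i \<Longrightarrow> y \<in> X i" by metis
  \<comment> \<open>A minimum over finitely many radii; the 1 keeps the set nonempty for
    \<open>d = 0\<close>.\<close>
  let ?e = "Min (insert 1 (e ` {..<d}))"
  show thesis
  proof
    show "?e > 0" using e(1) by (subst Min_gr_iff) auto
    fix y assume y: "y \<in> Rspace d" "\<And>i. i < d \<Longrightarrow> \<bar>y i - x i\<bar> < ?e"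
    have x: "x \<in> Rspace d" using assms(2) T(2) by blast
    have "y i \<in> X i" for i
    proof (cases "i < d")
      case True
      then have "?e \<le> e i" by (intro Min_le) auto
      then show ?thesis using e(2) less_le_trans[OF y(2)[OF True]] by blast
    next
      case False
      then have "y i = x i" using x y(1) by (simp add: Rspace_iff)
      then show ?thesis using e by simp
    qed
    then show "y \<in> V" using X(3) y(1) T(2) by (auto simp: PiE_iff)
  qed
qed

lemma continuous_map_box:
  assumes "openin (Euclidean_space d) V" and "x \<in> V"
    and h: "continuous_map (subtopology (Euclidean_space d) V) euclideanreal h" and "\<eta> > 0"
  obtains e where "e > 0"
    and "\<And>y. y \<in> Rspace d \<Longrightarrow> (\<And>i. i < d \<Longrightarrow> \<bar>y i - x i\<bar> < e) \<Longrightarrow> y \<in> V \<and> \<bar>h y - h x\<bar> < \<eta>"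
proof -
  let ?W = "{y \<in> topspace (subtopology (Euclidean_space d) V). h y \<in> ball (h x) \<eta>}"
  have "openin (subtopology (Euclidean_space d) V) ?W"
    using h by (rule openin_continuous_map_preimage) simp
  then have W: "openin (Euclidean_space d) ?W" using assms(1) by (rule openin_trans_full)
  have "x \<in> ?W" using assms openin_subset[OF assms(1)] by auto
  show thesis
  proof (rule openin_box[OF W \<open>x \<in> ?W\<close>])
    fix e :: real
    assume e: "e > 0" "\<And>y. y \<in> Rspace d \<Longrightarrow> (\<And>i. i < d \<Longrightarrow> \<bar>y i - x i\<bar> < e) \<Longrightarrow> y \<in> ?W"
    show thesis
    proof (rule that[OF e(1)])
      fix y assume "y \<in> Rspace d" "\<And>i. i < d \<Longrightarrow> \<bar>y i - x i\<bar> < e"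
      then have "y \<in> ?W" by (rule e(2))
      then show "y \<in> V \<and> \<bar>h y - h x\<bar> < \<eta>" by (simp add: dist_real_def abs_minus_commute)
    qed
  qed
qed

lemma eventually_fun_upd:
  assumes "openin (Euclidean_space d) V" and "x \<in> V" and "i < d"
  shows "\<forall>\<^sub>F t in nhds (x i). x(i := t) \<in> V"
proof -
  obtain e where e: "e > 0" "\<And>y. y \<in> Rspace d \<Longrightarrow> (\<And>i. i < d \<Longrightarrow> \<bar>y i - x i\<bar> < e) \<Longrightarrow> y \<in> V"
    using openin_box[OF assms(1,2)] by blast
  have "x \<in> Rspace d" using assms(1,2) openin_subset by blast
  then have "x(i := t) \<in> V" if "dist t (x i) < e" for t
    using that e assms(3) by (intro e(2)) (auto simp: fun_upd_Rspace dist_real_def)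
  then show ?thesis using e(1) unfolding eventually_nhds_metric by blast
qed

text \<open>\<open>partial\<close> has a value even where no derivative exists. This predicate adds
  existence, and the rules of calculus are proved for it before passing to
  \<open>partial\<close>.\<close>

definition has_pd :: "(vec \<Rightarrow> real) \<Rightarrow> nat \<Rightarrow> vec \<Rightarrow> real \<Rightarrow> bool"
  where "has_pd g i x D \<longleftrightarrow> ((\<lambda>t. g (x(i := t))) has_real_derivative D) (at (x i))"

lemma has_pd_partial: "has_pd g i x D \<Longrightarrow> partial i g x = D"
  unfolding has_pd_def partial_def by (rule DERIV_imp_deriv)

lemma Ck_on_has_pd: "Ck_on d (Suc k) V g \<Longrightarrow> i < d \<Longrightarrow> x \<in> V \<Longrightarrow> has_pd g i x (partial i g x)"
  unfolding has_pd_def partial_def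
  by (auto simp: field_differentiable_derivI)

lemma has_pd_line:
  assumes "Ck_on d (Suc k) V g" and "i < d" and "x(i := s) \<in> V"
  shows "((\<lambda>t. g (x(i := t))) has_real_derivative partial i g (x(i := s))) (at s)"
  using Ck_on_has_pd[OF assms] by (simp add: has_pd_def)

lemma has_pd_cong:
  assumes "openin (Euclidean_space d) V" and "x \<in> V" and "i < d" and "\<And>y. y \<in> V \<Longrightarrow> g y = h y"
  shows "has_pd g i x D \<longleftrightarrow> has_pd h i x D"
  unfolding has_pd_def
  by (rule DERIV_cong_ev) (use eventually_fun_upd[OF assms(1-3)] assms(4) in \<open>auto elim: eventually_mono\<close>)

lemma partial_cong:
  assumes "openin (Euclidean_space d) V" and "x \<in> V" and "i < d" and "\<And>y. y \<in> V \<Longrightarrow> g y = h y"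
  shows "partial i g x = partial i h x"
  unfolding partial_def
  by (rule deriv_cong_ev) (use eventually_fun_upd[OF assms(1-3)] assms(4) in \<open>auto elim: eventually_mono\<close>)

lemma has_pd_const: "has_pd (\<lambda>_. a) i x 0"
  by (simp add: has_pd_def)

lemma has_pd_coordinate: "has_pd (\<lambda>y. y j) i x (if i = j then 1 else 0)"
  by (auto simp: has_pd_def)

lemma has_pd_add: "has_pd g i x D \<Longrightarrow> has_pd h i x E \<Longrightarrow> has_pd (\<lambda>y. g y + h y) i x (D + E)"
  by (auto simp: has_pd_def intro: DERIV_add)

lemma has_pd_minus: "has_pd g i x D \<Longrightarrow> has_pd (\<lambda>y. - g y) i x (- D)"
  by (auto simp: has_pd_def intro: DERIV_minus)

lemma has_pd_mult:
  "has_pd g i x D \<Longrightarrow> has_pd h i x E \<Longrightarrow> has_pd (\<lambda>y. g y * h y) i x (D * h x + g x * E)"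
  unfolding has_pd_def by (drule (1) DERIV_mult) (simp add: algebra_simps)

lemma has_pd_cmult: "has_pd g i x D \<Longrightarrow> has_pd (\<lambda>y. a * g y) i x (a * D)"
  by (auto simp: has_pd_def intro: DERIV_cmult)

lemma has_pd_sum:
  "(\<And>s. s \<in> S \<Longrightarrow> has_pd (g s) i x (D s)) \<Longrightarrow> has_pd (\<lambda>y. \<Sum>s\<in>S. g s y) i x (\<Sum>s\<in>S. D s)"
  by (auto simp: has_pd_def intro!: DERIV_sum)

section \<open>Functions of class Ck on open sets\<close>

lemma Ck_on_cong:
  assumes "openin (Euclidean_space d) V" and "\<And>y. y \<in> V \<Longrightarrow> g y = h y"
  shows "Ck_on d k V g \<longleftrightarrow> Ck_on d k V h"
proof -
  have 1: "Ck_on d k V h" if "Ck_on d k V g" "\<And>y. y \<in> V \<Longrightarrow> g y = h y" for g h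
    using that
  proof (induction k arbitrary: g h)
    case 0
    then show ?case by (auto elim: continuous_map_eq)
  next
    case (Suc k)
    have "(\<lambda>t. h (x(i := t))) field_differentiable (at (x i))" if "i < d" "x \<in> V" for i x
      using Ck_on_has_pd[OF Suc.prems(1) that] has_pd_cong[OF assms(1) that(2,1), of g h] Suc.prems(2)
      unfolding has_pd_def field_differentiable_def by blast
    moreover have "Ck_on d k V (partial i h)" if "i < d" for i
    proof (rule Suc.IH)
      show "Ck_on d k V (partial i g)" using Suc.prems(1) that by simp
      show "partial i g y = partial i h y" if "y \<in> V" for y
        using partial_cong[OF assms(1) that \<open>i < d\<close>] Suc.prems(2) by blast
    qed
    moreover have "continuous_map (subtopology (Euclidean_space d) V) euclideanreal h"
      using Suc.prems by (auto elim: continuous_map_eq)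
    ultimately show ?case by auto
  qed
  show ?thesis using 1[of g h] 1[of h g] assms(2) by auto
qed

lemma Ck_on_eq:
  "openin (Euclidean_space d) V \<Longrightarrow> Ck_on d k V g \<Longrightarrow> (\<And>y. y \<in> V \<Longrightarrow> h y = g y) \<Longrightarrow> Ck_on d k V h"
  using Ck_on_cong[of d V h g k] by blast

lemma Ck_on_subset: "Ck_on d k V g \<Longrightarrow> W \<subseteq> V \<Longrightarrow> Ck_on d k W g"
  by (induction k arbitrary: g) (auto intro: continuous_map_from_subtopology_mono)

lemma Ck_on_Suc: "Ck_on d (Suc k) V g \<Longrightarrow> Ck_on d k V g"
  by (induction k arbitrary: g) auto

lemma Ck_on_continuous: "Ck_on d k V g \<Longrightarrow> continuous_map (subtopology (Euclidean_space d) V) euclideanreal g"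
  by (cases k) auto

lemma openin_Rspace: "openin (Euclidean_space d) (Rspace d)"
  by simp

lemma Ck_on_lincomb:
  assumes V: "openin (Euclidean_space d) V"
  shows "Ck_on d k V g \<Longrightarrow> Ck_on d k V h \<Longrightarrow> Ck_on d k V (\<lambda>x. a * g x + b * h x)"
proof (induction k arbitrary: g h)
  case 0
  then show ?case by (auto intro!: continuous_intros)
next
  case (Suc k)
  have pd: "has_pd (\<lambda>x. a * g x + b * h x) i x (a * partial i g x + b * partial i h x)"
    if "i < d" "x \<in> V" for i x
    using Suc.prems that by (intro has_pd_add has_pd_cmult Ck_on_has_pd)
  have "(\<lambda>t. a * g (x(i := t)) + b * h (x(i := t))) field_differentiable (at (x i))"
    if "i < d" "x \<in> V" for i x
    using pd[OF that] unfolding has_pd_def field_differentiable_def by blast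
  moreover have "Ck_on d k V (partial i (\<lambda>x. a * g x + b * h x))" if i: "i < d" for i
  proof -
    have "Ck_on d k V (\<lambda>x. a * partial i g x + b * partial i h x)"
      using Suc.prems i by (intro Suc.IH) auto
    moreover have "partial i (\<lambda>x. a * g x + b * h x) x = a * partial i g x + b * partial i h x"
      if "x \<in> V" for x
      using pd[OF i that] by (rule has_pd_partial)
    ultimately show ?thesis by (subst Ck_on_cong[OF V]) auto
  qed
  moreover have "continuous_map (subtopology (Euclidean_space d) V) euclideanreal (\<lambda>x. a * g x + b * h x)"
    using Suc.prems by (auto intro!: continuous_intros)
  ultimately show ?case by simp
qed

text \<open>Extensions of maps given on arbitrary subsets are only available near each point, so
  regularity has to be assembled from neighbourhoods.\<close>

lemma Ck_on_local:
  assumes V: "openin (Euclidean_space d) V"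
    and "\<And>x. x \<in> V \<Longrightarrow> \<exists>W. openin (Euclidean_space d) W \<and> x \<in> W \<and> W \<subseteq> V \<and> Ck_on d k W g"
  shows "Ck_on d k V g"
  using assms(2)
proof (induction k arbitrary: g)
  case 0
  have "openin (subtopology (Euclidean_space d) V) {x \<in> V. g x \<in> T}" if "open T" for T
  proof (subst openin_subopen, safe)
    fix x assume x: "x \<in> V" "g x \<in> T"
    then obtain W where W: "openin (Euclidean_space d) W" "x \<in> W" "W \<subseteq> V" "Ck_on d 0 W g"
      using 0 by blast
    let ?S = "{y \<in> topspace (subtopology (Euclidean_space d) W). g y \<in> T}"
    have "openin (subtopology (Euclidean_space d) W) ?S"
      using W(4) that by (intro openin_continuous_map_preimage[of _ euclideanreal]) auto
    then have "openin (Euclidean_space d) ?S" using W(1) by (rule openin_trans_full)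
    then have "openin (subtopology (Euclidean_space d) V) ?S"
      using W by (intro openin_subset_topspace_eq[THEN iffD2] openin_open_subtopology[THEN iffD2, OF V]) auto
    moreover have "x \<in> ?S" using W x openin_subset[OF W(1)] by auto
    ultimately show "\<exists>S. openin (subtopology (Euclidean_space d) V) S \<and> x \<in> S \<and> S \<subseteq> {x \<in> V. g x \<in> T}"
      using W(3) by (intro exI[of _ ?S]) auto
  qed
  moreover have "topspace (subtopology (Euclidean_space d) V) = V" using openin_subset[OF V] by auto
  ultimately show ?case by (simp add: continuous_map_def)
next
  case (Suc k)
  have "Ck_on d k V g"
    by (rule Suc.IH) (use Suc.prems in \<open>blast intro: Ck_on_Suc\<close>)
  then have "continuous_map (subtopology (Euclidean_space d) V) euclideanreal g"
    by (rule Ck_on_continuous)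
  moreover have "Ck_on d k V (partial i g)" if "i < d" for i
  proof (rule Suc.IH)
    fix x assume "x \<in> V"
    then obtain W where "openin (Euclidean_space d) W" "x \<in> W" "W \<subseteq> V" "Ck_on d (Suc k) W g"
      using Suc.prems by meson
    then show "\<exists>W. openin (Euclidean_space d) W \<and> x \<in> W \<and> W \<subseteq> V \<and> Ck_on d k W (partial i g)"
      using that by auto
  qed
  moreover have "(\<lambda>t. g (x(i := t))) field_differentiable (at (x i))" if ix: "i < d" "x \<in> V" for i x
  proof -
    obtain W where "x \<in> W" "Ck_on d (Suc k) W g" using Suc.prems[OF ix(2)] by meson
    then show ?thesis using ix(1) by simp
  qed
  ultimately show ?case by simp
qed

lemma subtopology_slice:
  assumes "d \<le> n"
  shows "subtopology (Euclidean_space d) (V \<inter> Rspace d) = subtopology (Euclidean_space n) (V \<inter> Rspace d)"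
proof -
  have "Rspace d \<subseteq> Rspace n" using assms by simp
  then have "{x :: vec. \<forall>i\<ge>n. x i = 0} \<inter> (V \<inter> Rspace d) = {x. \<forall>i\<ge>d. x i = 0} \<inter> (V \<inter> Rspace d)"
    unfolding topspace_Euclidean_space by blast
  then show ?thesis
    unfolding Euclidean_space_def[of n] Euclidean_space_def[of d] subtopology_subtopology by simp
qed

lemma openin_slice:
  assumes "d \<le> n" and "openin (Euclidean_space n) V"
  shows "openin (Euclidean_space d) (V \<inter> Rspace d)"
proof -
  have "Euclidean_space d = subtopology (Euclidean_space n) (Rspace d)"
    using subtopology_slice[OF assms(1), of "Rspace d"] by (simp add: subtopology_topspace)
  then show ?thesis using assms(2) openin_subtopology by metis
qed

text \<open>R^d is a subset of R^n and \<open>partial i\<close> does not mention the dimension, so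
  restriction merely drops directions and points. This carries transition maps and local extensions
  from R^n to slice charts.\<close>

lemma Ck_on_slice: "d \<le> n \<Longrightarrow> Ck_on n k V g \<Longrightarrow> Ck_on d k (V \<inter> Rspace d) g"
proof (induction k arbitrary: g)
  case 0
  then show ?case
    by (auto simp: subtopology_slice intro: continuous_map_from_subtopology_mono)
next
  case (Suc k)
  then show ?case
    by (auto simp: subtopology_slice intro: continuous_map_from_subtopology_mono)
qed

section \<open>Chain rule along curves and symmetry of second derivatives\<close>

lemma mean_value:
  fixes \<phi> :: "real \<Rightarrow> real"
  assumes "\<And>s. \<bar>s - a\<bar> \<le> \<bar>b - a\<bar> \<Longrightarrow> (\<phi> has_real_derivative \<phi>' s) (at s)"
  obtains s where "\<bar>s - a\<bar> \<le> \<bar>b - a\<bar>" and "\<phi> b - \<phi> a = (b - a) * \<phi>' s"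
proof (cases a b rule: linorder_cases)
  case less
  have "\<exists>z. a < z \<and> z < b \<and> \<phi> b - \<phi> a = (b - a) * \<phi>' z"
    by (rule MVT2[OF less]) (use assms in auto)
  then show thesis using that by force
next
  case greater
  have "\<exists>z. b < z \<and> z < a \<and> \<phi> a - \<phi> b = (a - b) * \<phi>' z"
    by (rule MVT2[OF greater]) (use assms in auto)
  then obtain z where "b < z" "z < a" "\<phi> a - \<phi> b = (a - b) * \<phi>' z" by blast
  then show thesis using that[of z] by (simp add: algebra_simps)
qed (use that in auto)

text \<open>The mean value theorem and the continuity of the partial derivatives control the
  increment of \<open>g\<close> in each coordinate direction, so the curve need only be
  differentiable at \<open>t0\<close>.\<close>

theorem chain_rule_curve:
  assumes V: "openin (Euclidean_space d) V" and g: "Ck_on d (Suc k) V g"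
    and c: "\<forall>\<^sub>F t in nhds t0. c t \<in> Rspace d" and t0: "c t0 \<in> V"
    and c': "\<And>i. i < d \<Longrightarrow> ((\<lambda>t. c t i) has_real_derivative c' i) (at t0)"
  shows "((\<lambda>t. g (c t)) has_real_derivative (\<Sum>i<d. partial i g (c t0) * c' i)) (at t0)"
proof -
  let ?x = "c t0"
  have x: "?x \<in> Rspace d" using V t0 openin_subset by blast
  \<comment> \<open>Move from \<open>c t0\<close> to \<open>c t\<close> one coordinate at a time.\<close>
  define hy where "hy m t = (\<lambda>i. if i < m then c t i else ?x i)" for m t
  have step: "((\<lambda>t. g (hy (Suc m) t) - g (hy m t)) has_real_derivative partial m g ?x * c' m) (at t0)"
    if m: "m < d" for m
  proof -
    \<comment> \<open>Difference quotient of \<open>g\<close> in coordinate \<open>m\<close>,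
      completed by its limit when the curve has not moved in this coordinate, which may happen for
      \<open>t\<close> arbitrarily close to \<open>t0\<close>.\<close>
    define q where "q t = (if c t m = ?x m then partial m g ?x
      else (g (hy (Suc m) t) - g (hy m t)) / (c t m - ?x m))" for t
    have hy_Suc: "hy (Suc m) t = (hy m t)(m := c t m)" for t
      by (auto simp: hy_def less_Suc_eq)
    have hy_m: "hy m t = (hy m t)(m := ?x m)" for t
      by (auto simp: hy_def)
    have q: "g (hy (Suc m) t) - g (hy m t) = q t * (c t m - ?x m)" for t
      unfolding q_def using hy_Suc[of t] hy_m[of t] by (auto simp del: fun_upd_apply)
    have "q \<midarrow>t0\<rightarrow> partial m g ?x"
    proof (rule tendstoI)
      fix \<eta> :: real assume "\<eta> > 0"
      have "continuous_map (subtopology (Euclidean_space d) V) euclideanreal (partial m g)"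
        using g m Ck_on_continuous by auto
      then obtain e where e: "e > 0"
          "\<And>y. y \<in> Rspace d \<Longrightarrow> (\<And>i. i < d \<Longrightarrow> \<bar>y i - ?x i\<bar> < e) \<Longrightarrow>
            y \<in> V \<and> \<bar>partial m g y - partial m g ?x\<bar> < \<eta>"
        using continuous_map_box[OF V t0 _ \<open>\<eta> > 0\<close>] by blast
      have "\<forall>\<^sub>F t in at t0. \<bar>c t i - ?x i\<bar> < e" if "i < d" for i
        using DERIV_isCont[OF c'[OF that]] e(1)
        unfolding isCont_def tendsto_iff dist_real_def by blast
      then have "\<forall>\<^sub>F t in at t0. \<forall>i\<in>{..<d}. \<bar>c t i - ?x i\<bar> < e"
        by (intro eventually_ball_finite) auto
      then show "\<forall>\<^sub>F t in at t0. dist (q t) (partial m g ?x) < \<eta>"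
      proof eventually_elim
        case (elim t)
        have box: "(hy m t)(m := s) \<in> V \<and> \<bar>partial m g ((hy m t)(m := s)) - partial m g ?x\<bar> < \<eta>"
          if "\<bar>s - ?x m\<bar> \<le> \<bar>c t m - ?x m\<bar>" for s
        proof (rule e(2))
          show "(hy m t)(m := s) \<in> Rspace d" using x m by (auto simp: Rspace_iff hy_def)
          show "\<bar>((hy m t)(m := s)) i - ?x i\<bar> < e" if "i < d" for i
            using elim that m \<open>\<bar>s - ?x m\<bar> \<le> \<bar>c t m - ?x m\<bar>\<close> e(1) by (force simp: hy_def)
        qed
        obtain s where s: "\<bar>s - ?x m\<bar> \<le> \<bar>c t m - ?x m\<bar>"
            "g ((hy m t)(m := c t m)) - g ((hy m t)(m := ?x m)) =
              (c t m - ?x m) * partial m g ((hy m t)(m := s))"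
        proof (rule mean_value)
          show "((\<lambda>s. g ((hy m t)(m := s))) has_real_derivative partial m g ((hy m t)(m := s))) (at s)"
            if "\<bar>s - ?x m\<bar> \<le> \<bar>c t m - ?x m\<bar>" for s
            using box[OF that] by (intro has_pd_line[OF g m]) blast
        qed
        then have "g (hy (Suc m) t) - g (hy m t) = (c t m - ?x m) * partial m g ((hy m t)(m := s))"
          using hy_Suc[of t] hy_m[of t] by metis
        then have "c t m \<noteq> ?x m \<Longrightarrow> q t = partial m g ((hy m t)(m := s))"
          by (simp add: q_def)
        moreover have "c t m = ?x m \<Longrightarrow> q t = partial m g ?x" by (simp add: q_def)
        ultimately show ?case using box[OF s(1)] \<open>\<eta> > 0\<close>
          by (cases "c t m = ?x m") (auto simp: dist_real_def)
      qed
    qed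
    moreover have "(\<lambda>t. (c t m - ?x m) / (t - t0)) \<midarrow>t0\<rightarrow> c' m"
      using c'[OF m] by (simp add: has_field_derivative_iff)
    ultimately have "(\<lambda>t. q t * ((c t m - ?x m) / (t - t0))) \<midarrow>t0\<rightarrow> partial m g ?x * c' m"
      by (rule tendsto_mult)
    then show ?thesis by (simp add: has_field_derivative_iff q)
  qed
  have "((\<lambda>t. g (hy m t)) has_real_derivative (\<Sum>i<m. partial i g ?x * c' i)) (at t0)"
    if "m \<le> d" for m
    using that
  proof (induction m)
    case (Suc m)
    then show ?case using DERIV_add[OF Suc.IH step[of m]] by simp
  qed (simp add: hy_def)
  then have "((\<lambda>t. g (hy d t)) has_real_derivative (\<Sum>i<d. partial i g ?x * c' i)) (at t0)"
    by simp
  \<comment> \<open>Below \<open>d\<close> the point \<open>hy d t\<close> agrees with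
    \<open>c t\<close> by definition, and from \<open>d\<close> on both vanish.\<close>
  moreover have "\<forall>\<^sub>F t in nhds t0. g (hy d t) = g (c t)"
    using c
  proof eventually_elim
    case (elim t)
    then have "hy d t = c t" using x by (auto simp: hy_def Rspace_iff)
    then show ?case by simp
  qed
  ultimately show ?thesis by (simp add: DERIV_cong_ev)
qed

lemma has_pd_compose:
  assumes "openin (Euclidean_space m) W" and "x \<in> W" and "i < m" and "G ` W \<subseteq> V"
    and "openin (Euclidean_space d) V" and "Ck_on d (Suc k) V h"
    and "\<And>j. j < d \<Longrightarrow> has_pd (\<lambda>y. G y j) i x (D j)"
  shows "has_pd (\<lambda>y. h (G y)) i x (\<Sum>j<d. partial j h (G x) * D j)"
proof -
  have "\<forall>\<^sub>F t in nhds (x i). G (x(i := t)) \<in> Rspace d"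
    using eventually_fun_upd[OF assms(1-3)]
    by eventually_elim (use assms(4) openin_subset[OF assms(5)] in blast)
  then show ?thesis
    using chain_rule_curve[OF assms(5,6), of "\<lambda>t. G (x(i := t))" "x i" D] assms(2,4,7)
    unfolding has_pd_def by auto
qed

text \<open>Both iterated derivatives are approximated by the same second difference over a square
  with side \<open>h\<close>, which is symmetric in the two directions. Continuity of the second
  derivatives brings the intermediate values close to the values at \<open>x\<close>.\<close>

theorem mixed_partials_commute:
  assumes V: "openin (Euclidean_space d) V" and g: "Ck_on d (Suc (Suc k)) V g"
    and x: "x \<in> V" and i: "i < d" and j: "j < d"
  shows "partial i (partial j g) x = partial j (partial i g) x"
proof (cases "i = j")
  case False
  have xR: "x \<in> Rspace d" using V x openin_subset by blast
  have box: "\<exists>e>0. \<forall>h. 0 < h \<and> h < e \<longrightarrow> (\<exists>D. \<bar>D - partial b (partial a g) x\<bar> < \<eta> \<and>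
      g (x(a := x a + h, b := x b + h)) - g (x(a := x a + h)) - g (x(b := x b + h)) + g x = h * h * D)"
    if ab: "a < d" "b < d" "a \<noteq> b" and "\<eta> > 0" for a b \<eta>
  proof -
    have ga: "Ck_on d (Suc k) V (partial a g)" using g ab by simp
    have "continuous_map (subtopology (Euclidean_space d) V) euclideanreal (partial b (partial a g))"
      using ga ab Ck_on_continuous by auto
    then obtain e where e: "e > 0" "\<And>y. y \<in> Rspace d \<Longrightarrow> (\<And>i. i < d \<Longrightarrow> \<bar>y i - x i\<bar> < e) \<Longrightarrow>
        y \<in> V \<and> \<bar>partial b (partial a g) y - partial b (partial a g) x\<bar> < \<eta>"
      using continuous_map_box[OF V x _ \<open>\<eta> > 0\<close>] by blast
    have near: "x(a := s, b := t) \<in> V \<and> \<bar>partial b (partial a g) (x(a := s, b := t)) - partial b (partial a g) x\<bar> < \<eta>"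
      if "\<bar>s - x a\<bar> < e" "\<bar>t - x b\<bar> < e" for s t
      using that ab xR e(1) by (intro e(2)) (auto simp: fun_upd_Rspace)
    have "\<exists>D. \<bar>D - partial b (partial a g) x\<bar> < \<eta> \<and>
        g (x(a := x a + h, b := x b + h)) - g (x(a := x a + h)) - g (x(b := x b + h)) + g x = h * h * D"
      if h: "0 < h" "h < e" for h
    proof -
      \<comment> \<open>\<open>F\<close> is the increment in direction \<open>b\<close> as a
        function of the coordinate \<open>a\<close>. The mean value theorem is used for
        \<open>F\<close> and then, in direction \<open>b\<close>, for
        \<open>partial a g\<close>.\<close>
      define F where "F s = g (x(b := x b + h, a := s)) - g (x(b := x b, a := s))" for s
      have F: "(F has_real_derivative
          partial a g (x(b := x b + h, a := s)) - partial a g (x(b := x b, a := s))) (at s)"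
        if "\<bar>s - x a\<bar> \<le> \<bar>x a + h - x a\<bar>" for s
        unfolding F_def
        using near[of s "x b + h"] near[of s "x b"] that h ab fun_upd_twist[OF ab(3), of x s]
        by (intro DERIV_diff has_pd_line[OF g]) auto
      obtain s where s: "\<bar>s - x a\<bar> \<le> \<bar>x a + h - x a\<bar>" and
        Fs: "F (x a + h) - F (x a) =
          (x a + h - x a) * (partial a g (x(b := x b + h, a := s)) - partial a g (x(b := x b, a := s)))"
        using mean_value[of "x a" "x a + h" F, OF F] by blast
      have G: "((\<lambda>t. partial a g (x(a := s, b := t))) has_real_derivative
          partial b (partial a g) (x(a := s, b := t))) (at t)"
        if "\<bar>t - x b\<bar> \<le> \<bar>x b + h - x b\<bar>" for t
        using near[of s t] that h s ab by (intro has_pd_line[OF ga]) auto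
      obtain t where t: "\<bar>t - x b\<bar> \<le> \<bar>x b + h - x b\<bar>" and
        Gt: "partial a g (x(a := s, b := x b + h)) - partial a g (x(a := s, b := x b)) =
          (x b + h - x b) * partial b (partial a g) (x(a := s, b := t))"
        using mean_value[of "x b" "x b + h" "\<lambda>t. partial a g (x(a := s, b := t))", OF G] by blast
      have "F (x a + h) - F (x a) = h * h * partial b (partial a g) (x(a := s, b := t))"
        using Fs Gt fun_upd_twist[OF ab(3), of x] by (simp add: algebra_simps)
      moreover have "F (x a + h) - F (x a) =
          g (x(a := x a + h, b := x b + h)) - g (x(a := x a + h)) - g (x(b := x b + h)) + g x"
      proof -
        have "x(b := x b + h, a := x a) = x(b := x b + h)" "x(b := x b, a := x a) = x"
          "x(b := x b, a := x a + h) = x(a := x a + h)"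
          using ab by (auto simp: fun_eq_iff)
        then show ?thesis
          using fun_upd_twist[OF ab(3), of x "x a + h" "x b + h"] by (simp add: F_def)
      qed
      ultimately show ?thesis using near[of s t] s t h by auto
    qed
    then show ?thesis using e(1) by blast
  qed
  show ?thesis
  proof (rule ccontr)
    assume ne: "\<not> ?thesis"
    \<comment> \<open>Half the supposed gap: \<open>D\<close> and \<open>D'\<close> turn out equal,
      but would lie within \<open>\<eta>\<close> of two numbers that are \<open>2 * \<eta>\<close>
      apart.\<close>
    define \<eta> where "\<eta> = \<bar>partial i (partial j g) x - partial j (partial i g) x\<bar> / 2"
    have "\<eta> > 0" using ne by (simp add: \<eta>_def)
    obtain e where e: "e > 0" "\<And>h. 0 < h \<Longrightarrow> h < e \<Longrightarrow> \<exists>D. \<bar>D - partial j (partial i g) x\<bar> < \<eta> \<and>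
      g (x(i := x i + h, j := x j + h)) - g (x(i := x i + h)) - g (x(j := x j + h)) + g x = h * h * D"
      using box[OF i j False \<open>\<eta> > 0\<close>] by blast
    obtain e' where e': "e' > 0" "\<And>h. 0 < h \<Longrightarrow> h < e' \<Longrightarrow> \<exists>D. \<bar>D - partial i (partial j g) x\<bar> < \<eta> \<and>
      g (x(j := x j + h, i := x i + h)) - g (x(j := x j + h)) - g (x(i := x i + h)) + g x = h * h * D"
      using box[OF j i False[symmetric] \<open>\<eta> > 0\<close>] by blast
    define h where "h = min e e' / 2"
    have h: "0 < h" "h < e" "h < e'" using e(1) e'(1) by (auto simp: h_def min_def)
    obtain D where D: "\<bar>D - partial j (partial i g) x\<bar> < \<eta>"
      "g (x(i := x i + h, j := x j + h)) - g (x(i := x i + h)) - g (x(j := x j + h)) + g x = h * h * D"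
      using e(2)[OF h(1,2)] by blast
    obtain D' where D': "\<bar>D' - partial i (partial j g) x\<bar> < \<eta>"
      "g (x(j := x j + h, i := x i + h)) - g (x(j := x j + h)) - g (x(i := x i + h)) + g x = h * h * D'"
      using e'(2)[OF h(1,3)] by blast
    have "h * h * D = h * h * D'"
      using D(2) D'(2) unfolding fun_upd_twist[OF False, of x "x i + h" "x j + h"] by linarith
    then have "D = D'" using h(1) by simp
    moreover have "2 * \<eta> \<le> \<bar>D - partial j (partial i g) x\<bar> + \<bar>D - partial i (partial j g) x\<bar>"
      using abs_triangle_ineq4[of "D - partial j (partial i g) x" "D - partial i (partial j g) x"]
      by (simp add: \<eta>_def)
    ultimately show False using D(1) D'(1) by simp
  qed
qed simp

section \<open>Jacobians and their composition\<close>

lemma jacobian_cong: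
  assumes "openin (Euclidean_space d) V" and "x \<in> V" and "\<And>y. y \<in> V \<Longrightarrow> G y = H y"
  shows "jacobian d G x v = jacobian d H x v"
  unfolding jacobian_def
  by (intro ext sum.cong refl) (simp add: partial_cong[OF assms(1,2), of _ "\<lambda>y. G y _" "\<lambda>y. H y _"] assms(3))

lemma jacobian_ident:
  assumes "v \<in> Rspace d"
  shows "jacobian d (\<lambda>x. x) x v = v"
proof
  fix j
  have "partial i (\<lambda>y. y j) x = (if i = j then 1 else 0)" for i
    using has_pd_coordinate by (rule has_pd_partial)
  then have "jacobian d (\<lambda>x. x) x v j = (\<Sum>i<d. if i = j then v i else 0)"
    unfolding jacobian_def by (intro sum.cong) auto
  then show "jacobian d (\<lambda>x. x) x v j = v j" using assms by (auto simp: Rspace_iff)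
qed

lemma partial_outside:
  assumes "openin (Euclidean_space m) V" and "x \<in> V" and "i < m" and "G ` V \<subseteq> Rspace d" and "d \<le> j"
  shows "partial i (\<lambda>y. G y j) x = 0"
proof -
  have "G y j = 0" if "y \<in> V" for y
    using assms(4,5) that by (auto simp: Rspace_iff)
  then show ?thesis
    using partial_cong[OF assms(1-3), of "\<lambda>y. G y j" "\<lambda>_. 0"] has_pd_partial[OF has_pd_const] by simp
qed

lemma jacobian_Rspace:
  assumes "openin (Euclidean_space m) V" and "x \<in> V" and "G ` V \<subseteq> Rspace d"
  shows "jacobian m G x v \<in> Rspace d"
  using partial_outside[OF assms(1,2) _ assms(3)] by (auto simp: Rspace_iff jacobian_def)

text \<open>The results are compared at all indices, including those from \<open>d\<close> on; hence
  \<open>H\<close> is C1 in every component, while the first \<open>d\<close> components of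
  \<open>G\<close> are those that enter the chain rule.\<close>

lemma jacobian_compose:
  assumes W: "openin (Euclidean_space d) W" and x: "x \<in> W" and GW: "G ` W \<subseteq> V"
    and V: "openin (Euclidean_space d) V"
    and G: "\<And>j. j < d \<Longrightarrow> Ck_on d (Suc k) W (\<lambda>y. G y j)"
    and H: "\<And>j. Ck_on d (Suc l) V (\<lambda>y. H y j)"
  shows "jacobian d (\<lambda>y. H (G y)) x v = jacobian d H (G x) (jacobian d G x v)"
proof
  fix j
  have "partial i (\<lambda>y. H (G y) j) x = (\<Sum>k<d. partial k (\<lambda>y. H y j) (G x) * partial i (\<lambda>y. G y k) x)"
    if "i < d" for i
    using Ck_on_has_pd[OF G that x]
    by (intro has_pd_partial has_pd_compose[OF W x that GW V H]) auto
  then have "jacobian d (\<lambda>y. H (G y)) x v j =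
      (\<Sum>i<d. \<Sum>k<d. partial k (\<lambda>y. H y j) (G x) * partial i (\<lambda>y. G y k) x * v i)"
    by (simp add: jacobian_def sum_distrib_right)
  also have "\<dots> = (\<Sum>k<d. \<Sum>i<d. partial k (\<lambda>y. H y j) (G x) * partial i (\<lambda>y. G y k) x * v i)"
    by (rule sum.swap)
  finally show "jacobian d (\<lambda>y. H (G y)) x v j = jacobian d H (G x) (jacobian d G x v) j"
    by (simp add: jacobian_def sum_distrib_left mult.assoc)
qed

section \<open>Homogeneous polynomials\<close>

definition monomial :: "nat \<Rightarrow> (nat \<Rightarrow> nat) \<Rightarrow> vec \<Rightarrow> real"
  where "monomial d m x = (\<Prod>i<d. x i ^ m i)"

lemma homogeneous_poly_monomial_iff:
  "homogeneous_poly d r q \<longleftrightarrow>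
    (\<exists>c. \<forall>x\<in>Rspace d. q x = (\<Sum>m\<in>multiindices d r. c m * monomial d m x))"
  by (simp add: homogeneous_poly_def monomial_def)

lemma finite_multiindices: "finite (multiindices d r)"
proof (rule finite_subset)
  show "multiindices d r \<subseteq> {m. \<forall>i. (i \<in> {..<d} \<longrightarrow> m i \<in> {..r}) \<and> (i \<notin> {..<d} \<longrightarrow> m i = 0)}"
    by (auto simp: multiindices_def intro: member_le_sum)
qed (rule finite_set_of_finite_funs; simp)

lemma homogeneous_poly_cong:
  "homogeneous_poly d r f \<Longrightarrow> (\<And>x. x \<in> Rspace d \<Longrightarrow> f x = g x) \<Longrightarrow> homogeneous_poly d r g"
  by (simp add: homogeneous_poly_def)

lemma homogeneous_poly_lincomb:
  assumes "homogeneous_poly d r f" and "homogeneous_poly d r g"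
  shows "homogeneous_poly d r (\<lambda>x. a * f x + b * g x)"
proof -
  obtain c c' where
    "\<And>x. x \<in> Rspace d \<Longrightarrow> f x = (\<Sum>m\<in>multiindices d r. c m * monomial d m x)"
    "\<And>x. x \<in> Rspace d \<Longrightarrow> g x = (\<Sum>m\<in>multiindices d r. c' m * monomial d m x)"
    using assms unfolding homogeneous_poly_monomial_iff by blast
  then have "\<forall>x\<in>Rspace d. a * f x + b * g x =
      (\<Sum>m\<in>multiindices d r. (a * c m + b * c' m) * monomial d m x)"
    by (simp add: algebra_simps sum.distrib sum_distrib_left)
  then show ?thesis
    unfolding homogeneous_poly_monomial_iff by (intro exI[of _ "\<lambda>m. a * c m + b * c' m"])
qed

lemma homogeneous_poly_zero: "homogeneous_poly d r (\<lambda>_. 0)"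
  unfolding homogeneous_poly_def by (rule exI[of _ "\<lambda>_. 0"]) simp

lemma homogeneous_poly_cmult: "homogeneous_poly d r f \<Longrightarrow> homogeneous_poly d r (\<lambda>x. a * f x)"
  using homogeneous_poly_lincomb[of d r f f a 0] by simp

lemma homogeneous_poly_sum:
  "finite S \<Longrightarrow> (\<And>s. s \<in> S \<Longrightarrow> homogeneous_poly d r (f s)) \<Longrightarrow>
    homogeneous_poly d r (\<lambda>x. \<Sum>s\<in>S. f s x)"
proof (induction S rule: finite_induct)
  case (insert s S)
  then show ?case
    using homogeneous_poly_lincomb[of d r "f s" "\<lambda>x. \<Sum>s\<in>S. f s x" 1 1] by simp
qed (simp add: homogeneous_poly_zero)

lemma homogeneous_poly_monomial:
  assumes "m \<in> multiindices d r"
  shows "homogeneous_poly d r (monomial d m)"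
  unfolding homogeneous_poly_monomial_iff
  using assms finite_multiindices
  by (intro exI[of _ "\<lambda>m'. if m' = m then 1 else 0"]) (simp add: if_distrib[of "\<lambda>c. c * _"] cong: if_cong)

lemma monomial_remove: "i < d \<Longrightarrow> monomial d m x = x i ^ m i * (\<Prod>j\<in>{..<d} - {i}. x j ^ m j)"
  unfolding monomial_def by (simp add: prod.remove)

text \<open>The equation \<open>r + a = m i + s\<close> expresses the change of total degree from
  \<open>r\<close> to \<open>s\<close> without natural subtraction.\<close>

lemma multiindices_upd:
  assumes "m \<in> multiindices d r" and "i < d" and "r + a = m i + s"
  shows "m(i := a) \<in> multiindices d s"
proof -
  have "(\<Sum>j<d. (m(i := a)) j) = a + (\<Sum>j\<in>{..<d} - {i}. m j)"
    using assms(2) by (subst sum.remove[of _ i]) auto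
  moreover have "(\<Sum>j<d. m j) = m i + (\<Sum>j\<in>{..<d} - {i}. m j)"
    using assms(2) by (subst sum.remove[of _ i]) auto
  ultimately show ?thesis using assms by (auto simp: multiindices_def)
qed

lemma homogeneous_poly_times_coordinate:
  assumes "homogeneous_poly d r q" and i: "i < d"
  shows "homogeneous_poly d (Suc r) (\<lambda>x. x i * q x)"
proof -
  obtain c where c: "\<And>x. x \<in> Rspace d \<Longrightarrow> q x = (\<Sum>m\<in>multiindices d r. c m * monomial d m x)"
    using assms(1) unfolding homogeneous_poly_monomial_iff by blast
  have "homogeneous_poly d (Suc r)
      (\<lambda>x. \<Sum>m\<in>multiindices d r. c m * monomial d (m(i := Suc (m i))) x)"
    by (intro homogeneous_poly_sum homogeneous_poly_cmult homogeneous_poly_monomial finite_multiindices)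
      (rule multiindices_upd[OF _ i], auto)
  moreover have "monomial d (m(i := Suc (m i))) x = x i * monomial d m x" for m x
    using i by (simp add: monomial_remove[OF i])
  ultimately show ?thesis
    using homogeneous_poly_cong[of d "Suc r" _ "\<lambda>x. x i * q x"] by (simp add: c sum_distrib_left mult_ac)
qed

text \<open>For \<open>m i = 0\<close> the natural subtraction leaves the multi-index unchanged, and
  the factor \<open>real (m i)\<close> makes the term vanish.\<close>

lemma has_pd_monomial:
  assumes i: "i < d"
  shows "has_pd (monomial d m) i x (real (m i) * monomial d (m(i := m i - 1)) x)"
proof -
  have "monomial d m (x(i := t)) = t ^ m i * (\<Prod>j\<in>{..<d} - {i}. x j ^ m j)" for t
    using i by (simp add: monomial_remove[OF i])
  moreover have "((\<lambda>t. t ^ m i * (\<Prod>j\<in>{..<d} - {i}. x j ^ m j)) has_real_derivative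
      (real (m i) * x i ^ (m i - 1)) * (\<Prod>j\<in>{..<d} - {i}. x j ^ m j)) (at (x i))"
    by (auto intro!: derivative_eq_intros)
  moreover have "monomial d (m(i := m i - 1)) x = x i ^ (m i - 1) * (\<Prod>j\<in>{..<d} - {i}. x j ^ m j)"
    using i by (simp add: monomial_remove[OF i])
  ultimately show ?thesis unfolding has_pd_def by (simp add: mult.assoc)
qed

text \<open>The last claim records that constants have derivative 0, which the natural number
  \<open>r - 1\<close> cannot express.\<close>

lemma homogeneous_poly_has_pd:
  assumes "homogeneous_poly d r q" and i: "i < d"
  obtains p where "homogeneous_poly d (r - 1) p" and "\<And>x. x \<in> Rspace d \<Longrightarrow> has_pd q i x (p x)"
    and "r = 0 \<Longrightarrow> p = (\<lambda>_. 0)"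
proof -
  obtain c where c: "\<And>x. x \<in> Rspace d \<Longrightarrow> q x = (\<Sum>m\<in>multiindices d r. c m * monomial d m x)"
    using assms(1) unfolding homogeneous_poly_monomial_iff by blast
  let ?p = "\<lambda>x. \<Sum>m\<in>multiindices d r. c m * (real (m i) * monomial d (m(i := m i - 1)) x)"
  show thesis
  proof
    have "homogeneous_poly d (r - 1) (\<lambda>x. c m * (real (m i) * monomial d (m(i := m i - 1)) x))"
      if "m \<in> multiindices d r" for m
    \<comment> \<open>For \<open>m i = 0\<close> the lowered multi-index would still have degree
      \<open>r\<close>, but its coefficient is 0.\<close>
    proof (cases "m i = 0")
      case False
      have "m i \<le> r" using that i by (auto simp: multiindices_def intro: member_le_sum)
      then have "m(i := m i - 1) \<in> multiindices d (r - 1)"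
        using False by (intro multiindices_upd[OF that i]) auto
      then show ?thesis by (intro homogeneous_poly_cmult homogeneous_poly_monomial)
    qed (simp add: homogeneous_poly_zero)
    then show "homogeneous_poly d (r - 1) ?p"
      by (intro homogeneous_poly_sum finite_multiindices)
    have "has_pd (\<lambda>x. \<Sum>m\<in>multiindices d r. c m * monomial d m x) i x (?p x)" for x
      by (intro has_pd_sum has_pd_cmult has_pd_monomial[OF i])
    then show "has_pd q i x (?p x)" if "x \<in> Rspace d" for x
      using has_pd_cong[OF openin_Rspace that i, of q "\<lambda>x. \<Sum>m\<in>multiindices d r. c m * monomial d m x"]
      by (simp add: c)
    show "?p = (\<lambda>_. 0)" if "r = 0"
      using that i by (auto simp: multiindices_def intro!: sum.neutral)
  qed
qed

lemma homogeneous_poly_partial: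
  assumes "homogeneous_poly d r q" and "i < d"
  shows "homogeneous_poly d (r - 1) (partial i q)"
    and "r = 0 \<Longrightarrow> x \<in> Rspace d \<Longrightarrow> partial i q x = 0"
proof -
  obtain p where p: "homogeneous_poly d (r - 1) p" "\<And>x. x \<in> Rspace d \<Longrightarrow> has_pd q i x (p x)"
    "r = 0 \<Longrightarrow> p = (\<lambda>_. 0)"
    by (rule homogeneous_poly_has_pd[OF assms]) blast
  show "homogeneous_poly d (r - 1) (partial i q)"
    using p(1) by (rule homogeneous_poly_cong) (simp add: has_pd_partial[OF p(2)])
  show "partial i q x = 0" if "r = 0" "x \<in> Rspace d"
    using has_pd_partial[OF p(2)[OF that(2)]] p(3)[OF that(1)] by simp
qed

lemma continuous_map_coordinate:
  "continuous_map (subtopology (Euclidean_space d) V) euclideanreal (\<lambda>x. x i)"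
  unfolding Euclidean_space_def
  by (intro continuous_map_from_subtopology continuous_map_product_projection) simp

text \<open>Partial derivatives are again homogeneous polynomials, so the induction on
  \<open>k\<close> lets \<open>q\<close> and \<open>r\<close> vary; continuity comes from the
  monomials.\<close>

lemma homogeneous_poly_Ck_on: "homogeneous_poly d r q \<Longrightarrow> Ck_on d k (Rspace d) q"
proof (induction k arbitrary: q r)
  case 0
  obtain c where c: "\<And>x. x \<in> Rspace d \<Longrightarrow> q x = (\<Sum>m\<in>multiindices d r. c m * monomial d m x)"
    using 0 unfolding homogeneous_poly_monomial_iff by blast
  have "continuous_map (subtopology (Euclidean_space d) (Rspace d)) euclideanreal
      (\<lambda>x. \<Sum>m\<in>multiindices d r. c m * monomial d m x)"
    unfolding monomial_def
    by (intro continuous_map_sum continuous_map_real_mult continuous_map_prod continuous_map_real_pow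
        continuous_map_coordinate finite_multiindices) auto
  then have "continuous_map (subtopology (Euclidean_space d) (Rspace d)) euclideanreal q"
    by (rule continuous_map_eq) (simp add: c)
  then show ?case by simp
next
  case (Suc k)
  have Ck: "Ck_on d k (Rspace d) q" using Suc by blast
  have "(\<lambda>t. q (x(i := t))) field_differentiable (at (x i))" if "i < d" "x \<in> Rspace d" for i x
  proof (rule homogeneous_poly_has_pd[OF Suc.prems that(1)])
    fix p assume "\<And>x. x \<in> Rspace d \<Longrightarrow> has_pd q i x (p x)"
    then show ?thesis using that(2) unfolding has_pd_def field_differentiable_def by blast
  qed
  moreover have "Ck_on d k (Rspace d) (partial i q)" if "i < d" for i
    using Suc.IH homogeneous_poly_partial(1)[OF Suc.prems that] .
  moreover from Ck have "continuous_map (subtopology (Euclidean_space d) (Rspace d)) euclideanreal q"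
    by (rule Ck_on_continuous)
  ultimately show ?case by simp
qed

lemma Ck_on_zero: "V \<subseteq> Rspace d \<Longrightarrow> Ck_on d k V (\<lambda>_. 0)"
  using homogeneous_poly_Ck_on[OF homogeneous_poly_zero] by (rule Ck_on_subset)

lemma homogeneous_poly_scale_arg:
  assumes "homogeneous_poly d r q" and "x \<in> Rspace d"
  shows "q (\<lambda>i. t * x i) = t ^ r * q x"
proof -
  obtain c where c: "\<And>x. x \<in> Rspace d \<Longrightarrow> q x = (\<Sum>m\<in>multiindices d r. c m * monomial d m x)"
    using assms(1) unfolding homogeneous_poly_monomial_iff by blast
  have "monomial d m (\<lambda>i. t * x i) = t ^ r * monomial d m x" if "m \<in> multiindices d r" for m
    using that by (auto simp: monomial_def power_mult_distrib prod.distrib multiindices_def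
        simp flip: power_sum)
  moreover have "(\<lambda>i. t * x i) \<in> Rspace d" using assms(2) by (simp add: Rspace_iff)
  ultimately show ?thesis
    using assms(2) by (simp add: c sum_distrib_left mult.left_commute)
qed

text \<open>Both sides are the derivative at t = 1 of q(t x) = t^r q(x), by the chain rule and by
  the power rule.\<close>

lemma homogeneous_poly_Euler:
  assumes q: "homogeneous_poly d r q" and x: "x \<in> Rspace d"
  shows "(\<Sum>i<d. partial i q x * x i) = real r * q x"
proof (rule DERIV_unique)
  have "((\<lambda>t. q (\<lambda>i. t * x i)) has_real_derivative (\<Sum>i<d. partial i q (\<lambda>i. 1 * x i) * x i)) (at 1)"
  proof (rule chain_rule_curve[OF openin_Rspace homogeneous_poly_Ck_on[OF q]])
    show "\<forall>\<^sub>F t in nhds 1. (\<lambda>i. t * x i) \<in> Rspace d" using x by (simp add: Rspace_iff)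
    show "(\<lambda>i. 1 * x i) \<in> Rspace d" using x by simp
    show "((\<lambda>t. t * x i) has_real_derivative x i) (at 1)" for i
      by (auto intro!: derivative_eq_intros)
  qed
  then show "((\<lambda>t. t ^ r * q x) has_real_derivative (\<Sum>i<d. partial i q x * x i)) (at 1)"
    by (simp add: homogeneous_poly_scale_arg[OF q x])
  show "((\<lambda>t. t ^ r * q x) has_real_derivative real r * q x) (at 1)"
    by (auto intro!: derivative_eq_intros)
qed


section \<open>Exterior calculus on coordinate space\<close>

text \<open>Common domain of linearity for \<open>ext_d\<close>: sums of different polynomial
  degrees leave each space of homogeneous forms but stay C1.\<close>

definition C1_form :: "nat \<Rightarrow> nat \<Rightarrow> (vec, vec) form \<Rightarrow> bool"
  where "C1_form d l \<alpha> \<longleftrightarrow>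
    form_on_Rspace d l \<alpha> \<and> (\<forall>vs. Ck_on d (Suc 0) (Rspace d) (\<lambda>x. \<alpha> x vs))"

text \<open>Here degrees are natural numbers and the condition concerns all argument lists. For
  \<open>l > d\<close> alternation leaves only the zero form, so the bound on \<open>l\<close> in
  \<open>hom_forms\<close> reappears by itself.\<close>

definition homogeneous_forms :: "nat \<Rightarrow> nat \<Rightarrow> nat \<Rightarrow> (vec, vec) form set"
  where "homogeneous_forms d r l =
    {\<alpha>. form_on_Rspace d l \<alpha> \<and> (\<forall>vs. homogeneous_poly d r (\<lambda>x. \<alpha> x vs))}"

text \<open>The list \<open>us\<close> is held fixed. The argument order, direction before remaining
  list, is the one \<open>altsum\<close> expects, which makes d an alternating sum of this
  function.\<close>

definition dir_deriv :: "nat \<Rightarrow> (vec, vec) form \<Rightarrow> vec \<Rightarrow> vec \<Rightarrow> vec list \<Rightarrow> real"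
  where "dir_deriv d \<alpha> x v us = (\<Sum>j<d. partial j (\<lambda>y. \<alpha> y us) x * v j)"

text \<open>
  \<^const>\<open>ext_deriv_Rspace\<close> does not vanish on vectors outside \<open>R^d\<close>, so it has to be cut off
  to yield an extensional form.
\<close>

definition ext_d :: "nat \<Rightarrow> (vec, vec) form \<Rightarrow> (vec, vec) form"
  where "ext_d d \<alpha> = (\<lambda>x vs. if set vs \<subseteq> Rspace d then ext_deriv_Rspace d \<alpha> x vs else 0)"

abbreviation euler_contraction :: "(vec, vec) form \<Rightarrow> (vec, vec) form"
  where "euler_contraction \<equiv> interior_product (\<lambda>x. x)"

lemma form_on_Rspace_alternating:
  "form_on_Rspace d l \<alpha> \<Longrightarrow> alternating_form l (Rspace d) (\<alpha> x)"
  by (cases "x \<in> Rspace d") (auto simp: form_on_Rspace_def alternating_form_def)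

lemmas form_on_Rspace_skew = alternating_form_skew[OF form_on_Rspace_alternating]

lemma form_on_Rspace_outside:
  "form_on_Rspace d l \<alpha> \<Longrightarrow> x \<notin> Rspace d \<or> length vs \<noteq> l \<or> \<not> set vs \<subseteq> Rspace d \<Longrightarrow> \<alpha> x vs = 0"
  using alternating_form_outside[OF form_on_Rspace_alternating, of d l \<alpha> vs x]
  unfolding form_on_Rspace_def by (cases "x \<in> Rspace d") auto

lemma form_on_RspaceI:
  assumes "\<And>x. x \<in> Rspace d \<Longrightarrow> skew d (\<alpha> x)"
    and "\<And>x vs. x \<notin> Rspace d \<or> length vs \<noteq> l \<or> \<not> set vs \<subseteq> Rspace d \<Longrightarrow> \<alpha> x vs = 0"
  shows "form_on_Rspace d l \<alpha>"
  unfolding form_on_Rspace_def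
proof (intro conjI ballI allI impI)
  fix x assume "x \<in> Rspace d"
  then show "alternating_form l (Rspace d) (\<alpha> x)"
    using assms by (intro skew_alternating_form) blast+
qed (use assms(2) in blast)

lemma form_on_Rspace_lincomb:
  assumes "form_on_Rspace d l \<alpha>" and "form_on_Rspace d l \<beta>"
  shows "form_on_Rspace d l (form_add (form_scale a \<alpha>) (form_scale b \<beta>))"
proof (rule form_on_RspaceI)
  fix x
  have "skew d (\<alpha> x)" "skew d (\<beta> x)" using assms form_on_Rspace_skew by blast+
  note lin = this[THEN skew_lincomb] and swap = this[THEN skew_swap]
  show "skew d (form_add (form_scale a \<alpha>) (form_scale b \<beta>) x)"
    unfolding skew_def form_add_def form_scale_def
  proof (intro conjI allI impI)
    fix us ws u v
    show "a * \<alpha> x (us @ u # v # ws) + b * \<beta> x (us @ u # v # ws) =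
        - (a * \<alpha> x (us @ v # u # ws) + b * \<beta> x (us @ v # u # ws))"
      using swap(1)[of us u v ws] swap(2)[of us u v ws] by simp
  qed (simp add: lin algebra_simps)
qed (simp add: form_add_def form_scale_def form_on_Rspace_outside[OF assms(1)] form_on_Rspace_outside[OF assms(2)])

lemma form_on_Rspace_zero: "form_on_Rspace d l zero_form"
  by (rule form_on_RspaceI) (simp_all add: zero_form_def skew_def)

text \<open>There is no strictly increasing list of \<open>l > d\<close> indices below
  \<open>d\<close>, so all coefficients vanish.\<close>

lemma form_on_Rspace_top:
  assumes "form_on_Rspace d l \<alpha>" and "d < l"
  shows "\<alpha> = zero_form"
proof -
  have "\<alpha> x vs = 0" for x vs
  proof (rule coefficients_induct[where P = "\<lambda>f. f x = 0", OF form_on_Rspace_alternating[OF assms(1)]])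
    fix js :: "nat list" assume js: "length js = l" "sorted_wrt (<) js" "set js \<subseteq> {..<d}"
    then have "card (set js) = l" by (simp add: strict_sorted_iff distinct_card)
    then show "\<alpha> x (map unit_vec js) = 0" using card_mono[OF _ js(3)] assms(2) by simp
  qed auto
  then show ?thesis by (simp add: zero_form_def fun_eq_iff)
qed

lemma hom_forms_eq:
  "hom_forms d r l = (if r < 0 \<or> l < 0 then {zero_form} else homogeneous_forms d (nat r) (nat l))"
proof (cases "r < 0 \<or> l < 0 \<or> l > int d")
  case True
  have "homogeneous_forms d (nat r) (nat l) = {zero_form}" if "l > int d"
  proof
    show "homogeneous_forms d (nat r) (nat l) \<subseteq> {zero_form}"
      using form_on_Rspace_top that by (force simp: homogeneous_forms_def)
    show "{zero_form} \<subseteq> homogeneous_forms d (nat r) (nat l)"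
      using form_on_Rspace_zero homogeneous_poly_zero by (auto simp: homogeneous_forms_def zero_form_def)
  qed
  then show ?thesis using True by (auto simp: hom_forms_def)
next
  case False
  have "homogeneous_poly d (nat r) (\<lambda>x. \<alpha> x vs)"
    if "form_on_Rspace d (nat l) \<alpha>"
      and js: "\<forall>js. length js = nat l \<and> sorted_wrt (<) js \<and> set js \<subseteq> {..<d} \<longrightarrow>
        homogeneous_poly d (nat r) (\<lambda>x. \<alpha> x (map unit_vec js))" for \<alpha> vs
    by (rule coefficients_induct[OF form_on_Rspace_alternating[OF that(1)]])
      (use js in \<open>auto intro: homogeneous_poly_zero homogeneous_poly_lincomb\<close>)
  then show ?thesis using False by (auto simp: hom_forms_def homogeneous_forms_def)
qed

lemma form_subspaceI:
  assumes "zero_form \<in> V"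
    and lin: "\<And>\<alpha> \<beta> a b. \<alpha> \<in> V \<Longrightarrow> \<beta> \<in> V \<Longrightarrow> form_add (form_scale a \<alpha>) (form_scale b \<beta>) \<in> V"
  shows "form_subspace V"
  unfolding form_subspace_def
proof (intro conjI ballI allI)
  show "form_add \<alpha> \<beta> \<in> V" if "\<alpha> \<in> V" "\<beta> \<in> V" for \<alpha> \<beta>
    using lin[OF that, of 1 1] by (simp add: form_add_def form_scale_def)
  show "form_scale a \<alpha> \<in> V" if "\<alpha> \<in> V" for a \<alpha>
    using lin[OF that that, of a 0] by (simp add: form_add_def form_scale_def)
qed (rule assms(1))

lemma homogeneous_forms_C1: "\<alpha> \<in> homogeneous_forms d r l \<Longrightarrow> C1_form d l \<alpha>"
  by (auto simp: homogeneous_forms_def C1_form_def intro: homogeneous_poly_Ck_on simp del: Ck_on.simps)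

lemma form_subspace_homogeneous: "form_subspace (homogeneous_forms d r l)"
proof (rule form_subspaceI)
  show "zero_form \<in> homogeneous_forms d r l"
    using form_on_Rspace_zero homogeneous_poly_zero by (auto simp: homogeneous_forms_def zero_form_def)
  show "form_add (form_scale a \<alpha>) (form_scale b \<beta>) \<in> homogeneous_forms d r l"
    if "\<alpha> \<in> homogeneous_forms d r l" "\<beta> \<in> homogeneous_forms d r l" for \<alpha> \<beta> a b
    using that form_on_Rspace_lincomb[of d l \<alpha> \<beta> a b] homogeneous_poly_lincomb
    by (auto simp: homogeneous_forms_def form_add_def form_scale_def)
qed

lemma form_subspace_C1: "form_subspace {\<alpha>. C1_form d l \<alpha>}"
proof (rule form_subspaceI)
  have "zero_form \<in> homogeneous_forms d 0 l"
    using form_subspace_homogeneous by (auto simp: form_subspace_def)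
  then show "zero_form \<in> {\<alpha>. C1_form d l \<alpha>}" using homogeneous_forms_C1 by blast
  show "form_add (form_scale a \<alpha>) (form_scale b \<beta>) \<in> {\<alpha>. C1_form d l \<alpha>}"
    if "\<alpha> \<in> {\<alpha>. C1_form d l \<alpha>}" "\<beta> \<in> {\<alpha>. C1_form d l \<alpha>}" for \<alpha> \<beta> a b
    using that form_on_Rspace_lincomb[of d l \<alpha> \<beta> a b] Ck_on_lincomb[OF openin_Rspace]
    by (auto simp: C1_form_def form_add_def form_scale_def simp del: Ck_on.simps)
qed

text \<open>Off R^d the form is 0 along the whole coordinate line, because changing an entry below
  \<open>d\<close> cannot lead into R^d. The derivative thus exists at every
  \<open>x\<close>.\<close>

lemma C1_form_has_pd:
  assumes \<alpha>: "C1_form d l \<alpha>" and j: "j < d"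
  shows "has_pd (\<lambda>y. \<alpha> y us) j x (partial j (\<lambda>y. \<alpha> y us) x)"
proof (cases "x \<in> Rspace d")
  case True
  then show ?thesis using \<alpha> j by (auto simp: C1_form_def intro: Ck_on_has_pd simp del: Ck_on.simps)
next
  case False
  then have "\<alpha> (x(j := t)) us = 0" for t
    using \<alpha> fun_upd_Rspace_iff[OF j] by (auto simp: C1_form_def intro: form_on_Rspace_outside)
  then have "has_pd (\<lambda>y. \<alpha> y us) j x 0" by (simp add: has_pd_def)
  then show ?thesis using has_pd_partial by metis
qed

lemma partial_form_outside:
  assumes \<alpha>: "form_on_Rspace d l \<alpha>" and j: "j < d"
    and "x \<notin> Rspace d \<or> length us \<noteq> l \<or> \<not> set us \<subseteq> Rspace d"
  shows "partial j (\<lambda>y. \<alpha> y us) x = 0"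
proof -
  have "\<alpha> (x(j := t)) us = 0" for t
    using assms(3) fun_upd_Rspace_iff[OF j] by (intro form_on_Rspace_outside[OF \<alpha>]) auto
  then have "has_pd (\<lambda>y. \<alpha> y us) j x 0" by (simp add: has_pd_def)
  then show ?thesis by (rule has_pd_partial)
qed

lemma dir_deriv_outside:
  "form_on_Rspace d l \<alpha> \<Longrightarrow> x \<notin> Rspace d \<or> length us \<noteq> l \<or> \<not> set us \<subseteq> Rspace d \<Longrightarrow>
    dir_deriv d \<alpha> x v us = 0"
  unfolding dir_deriv_def by (intro sum.neutral) (simp add: partial_form_outside)

lemma ext_deriv_Rspace_altsum: "ext_deriv_Rspace d \<alpha> x vs = altsum vs (dir_deriv d \<alpha> x)"
  by (simp add: ext_deriv_Rspace_def altsum_eq_sum dir_deriv_def)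

lemma skew_partial:
  assumes \<alpha>: "C1_form d l \<alpha>" and j: "j < d"
  shows "skew d (\<lambda>us. partial j (\<lambda>y. \<alpha> y us) x)"
proof -
  have sk: "skew d (\<alpha> y)" for y using \<alpha> form_on_Rspace_skew by (auto simp: C1_form_def)
  note pd = C1_form_has_pd[OF \<alpha> j]
  show ?thesis
    unfolding skew_def
  proof (intro conjI allI impI)
    fix us ws u v and a b :: real
    assume uv: "u \<in> Rspace d" "v \<in> Rspace d"
    show "partial j (\<lambda>y. \<alpha> y (us @ lincomb a u b v # ws)) x =
        a * partial j (\<lambda>y. \<alpha> y (us @ u # ws)) x + b * partial j (\<lambda>y. \<alpha> y (us @ v # ws)) x"
      unfolding skew_lincomb[OF sk uv]
      by (intro has_pd_partial has_pd_add has_pd_cmult pd)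
  next
    fix us ws u v
    show "partial j (\<lambda>y. \<alpha> y (us @ u # v # ws)) x = - partial j (\<lambda>y. \<alpha> y (us @ v # u # ws)) x"
      unfolding skew_swap[OF sk, of _ us u v ws]
      by (intro has_pd_partial has_pd_minus pd)
  qed
qed

lemma skew_dir_deriv:
  assumes \<alpha>: "C1_form d l \<alpha>"
  shows "skew d (dir_deriv d \<alpha> x v)"
  unfolding skew_def
proof (intro conjI allI impI)
  fix us ws u w and a b :: real
  assume uw: "u \<in> Rspace d" "w \<in> Rspace d"
  show "dir_deriv d \<alpha> x v (us @ lincomb a u b w # ws) =
      a * dir_deriv d \<alpha> x v (us @ u # ws) + b * dir_deriv d \<alpha> x v (us @ w # ws)"
    by (simp add: dir_deriv_def skew_lincomb[OF skew_partial[OF \<alpha>] uw] sum_distrib_left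
        sum.distrib algebra_simps)
next
  fix us ws u w
  show "dir_deriv d \<alpha> x v (us @ u # w # ws) = - dir_deriv d \<alpha> x v (us @ w # u # ws)"
    unfolding dir_deriv_def sum_negf[symmetric]
  proof (rule sum.cong)
    fix j assume "j \<in> {..<d}"
    then show "partial j (\<lambda>y. \<alpha> y (us @ u # w # ws)) x * v j = - (partial j (\<lambda>y. \<alpha> y (us @ w # u # ws)) x * v j)"
      using skew_swap[OF skew_partial[OF \<alpha>, of j x], of us u w ws] by simp
  qed simp
qed

lemma form_on_Rspace_ext_d:
  assumes \<alpha>: "C1_form d l \<alpha>"
  shows "form_on_Rspace d (Suc l) (ext_d d \<alpha>)"
proof (rule form_on_RspaceI)
  fix x
  have sk: "skew d (\<lambda>vs. altsum vs (dir_deriv d \<alpha> x))"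
  proof (rule skew_altsum)
    show "dir_deriv d \<alpha> x (lincomb a u b v) us = a * dir_deriv d \<alpha> x u us + b * dir_deriv d \<alpha> x v us"
      for u v a b us
      by (simp add: dir_deriv_def lincomb_def sum_distrib_left sum.distrib algebra_simps)
  qed (rule skew_dir_deriv[OF \<alpha>])
  show "skew d (ext_d d \<alpha> x)"
    unfolding skew_def
  proof (intro conjI allI impI)
    fix us ws u v and a b :: real
    assume "u \<in> Rspace d" "v \<in> Rspace d"
    then show "ext_d d \<alpha> x (us @ lincomb a u b v # ws) =
        a * ext_d d \<alpha> x (us @ u # ws) + b * ext_d d \<alpha> x (us @ v # ws)"
      by (simp add: ext_d_def ext_deriv_Rspace_altsum skew_lincomb[OF sk] lincomb_Rspace)
  next
    fix us ws u v
    show "ext_d d \<alpha> x (us @ u # v # ws) = - ext_d d \<alpha> x (us @ v # u # ws)"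
      using skew_swap[OF sk, of us u v ws] by (auto simp: ext_d_def ext_deriv_Rspace_altsum)
  qed
next
  fix x vs
  assume *: "x \<notin> Rspace d \<or> length vs \<noteq> Suc l \<or> \<not> set vs \<subseteq> Rspace d"
  have "altsum vs (dir_deriv d \<alpha> x) = altsum vs (\<lambda>_ _. 0)" if "set vs \<subseteq> Rspace d"
    using \<alpha> * that by (intro altsum_cong dir_deriv_outside) (auto simp: C1_form_def)
  then show "ext_d d \<alpha> x vs = 0"
    by (simp add: ext_d_def ext_deriv_Rspace_altsum altsum_zero)
qed

lemma form_linear_on_ext_d: "form_linear_on {\<alpha>. C1_form d l \<alpha>} (ext_d d)"
proof -
  have 1: "dir_deriv d (form_add \<alpha> \<beta>) x v us = dir_deriv d \<alpha> x v us + dir_deriv d \<beta> x v us"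
    if "C1_form d l \<alpha>" "C1_form d l \<beta>" for \<alpha> \<beta> x v us
  proof -
    have "partial j (\<lambda>y. \<alpha> y us + \<beta> y us) x = partial j (\<lambda>y. \<alpha> y us) x + partial j (\<lambda>y. \<beta> y us) x"
      if "j < d" for j
      using C1_form_has_pd \<open>C1_form d l \<alpha>\<close> \<open>C1_form d l \<beta>\<close> that by (intro has_pd_partial has_pd_add)
    then show ?thesis by (simp add: dir_deriv_def form_add_def sum.distrib algebra_simps)
  qed
  have 2: "dir_deriv d (form_scale a \<alpha>) x v us = a * dir_deriv d \<alpha> x v us"
    if "C1_form d l \<alpha>" for \<alpha> a x v us
  proof -
    have "partial j (\<lambda>y. a * \<alpha> y us) x = a * partial j (\<lambda>y. \<alpha> y us) x" if "j < d" for j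
      using C1_form_has_pd \<open>C1_form d l \<alpha>\<close> that by (intro has_pd_partial has_pd_cmult)
    then show ?thesis by (simp add: dir_deriv_def form_scale_def sum_distrib_left mult.assoc)
  qed
  have "ext_d d (form_add \<alpha> \<beta>) = form_add (ext_d d \<alpha>) (ext_d d \<beta>)"
    if "C1_form d l \<alpha>" "C1_form d l \<beta>" for \<alpha> \<beta>
  proof -
    have "dir_deriv d (form_add \<alpha> \<beta>) x = (\<lambda>v us. dir_deriv d \<alpha> x v us + dir_deriv d \<beta> x v us)" for x
      using 1[OF that] by blast
    then have "ext_d d (form_add \<alpha> \<beta>) x vs = ext_d d \<alpha> x vs + ext_d d \<beta> x vs" for x vs
      by (simp add: ext_d_def ext_deriv_Rspace_altsum altsum_add)
    then show ?thesis by (simp add: form_add_def[of "ext_d d \<alpha>"] fun_eq_iff)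
  qed
  moreover have "ext_d d (form_scale a \<alpha>) = form_scale a (ext_d d \<alpha>)" if "C1_form d l \<alpha>" for \<alpha> a
  proof -
    have "dir_deriv d (form_scale a \<alpha>) x = (\<lambda>v us. a * dir_deriv d \<alpha> x v us)" for x
      using 2[OF that] by blast
    then have "ext_d d (form_scale a \<alpha>) x vs = a * ext_d d \<alpha> x vs" for x vs
      by (simp add: ext_d_def ext_deriv_Rspace_altsum altsum_scale)
    then show ?thesis by (simp add: form_scale_def[of a "ext_d d \<alpha>"] fun_eq_iff)
  qed
  ultimately show ?thesis unfolding form_linear_on_def by blast
qed

lemma homogeneous_poly_altsum:
  "(\<And>v us. homogeneous_poly d r (\<lambda>x. F x v us)) \<Longrightarrow> homogeneous_poly d r (\<lambda>x. altsum vs (F x))"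
proof (induction vs arbitrary: F)
  case (Cons v vs)
  have "homogeneous_poly d r (\<lambda>x. altsum vs (\<lambda>w us. F x w (v # us)))"
    using Cons.prems by (intro Cons.IH)
  then show ?case using homogeneous_poly_lincomb[of d r "\<lambda>x. F x v vs" _ 1 "-1"] Cons.prems by simp
qed (simp add: homogeneous_poly_zero)

text \<open>For \<open>r = 0\<close> the natural subtraction yields degree 0 where -1 is meant; the
  second claim supplies the missing vanishing.\<close>

lemma ext_d_homogeneous:
  assumes \<alpha>: "\<alpha> \<in> homogeneous_forms d r l"
  shows "ext_d d \<alpha> \<in> homogeneous_forms d (r - 1) (Suc l)" and "r = 0 \<Longrightarrow> ext_d d \<alpha> = zero_form"
proof -
  have C1: "C1_form d l \<alpha>" using \<alpha> by (rule homogeneous_forms_C1)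
  have hom: "homogeneous_poly d r (\<lambda>y. \<alpha> y us)" for us using \<alpha> by (simp add: homogeneous_forms_def)
  have "homogeneous_poly d (r - 1) (\<lambda>x. dir_deriv d \<alpha> x v us)" for v us
    unfolding dir_deriv_def mult.commute[of "partial _ _ _"]
    by (intro homogeneous_poly_sum homogeneous_poly_cmult homogeneous_poly_partial(1)[OF hom]) auto
  then have "homogeneous_poly d (r - 1) (\<lambda>x. ext_d d \<alpha> x vs)" for vs
    by (cases "set vs \<subseteq> Rspace d")
      (simp_all add: ext_d_def ext_deriv_Rspace_altsum homogeneous_poly_altsum homogeneous_poly_zero)
  then show "ext_d d \<alpha> \<in> homogeneous_forms d (r - 1) (Suc l)"
    using form_on_Rspace_ext_d[OF C1] by (simp add: homogeneous_forms_def)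
  assume "r = 0"
  then have "partial j (\<lambda>y. \<alpha> y us) x = 0" if "j < d" for j us x
    using homogeneous_poly_partial(2)[OF hom that] partial_form_outside[OF _ that] \<alpha>
    by (cases "x \<in> Rspace d") (auto simp: homogeneous_forms_def)
  then have "altsum vs (dir_deriv d \<alpha> x) = altsum vs (\<lambda>_ _. 0)" for x vs
    by (intro altsum_cong) (simp add: dir_deriv_def)
  then show "ext_d d \<alpha> = zero_form"
    by (simp add: ext_d_def ext_deriv_Rspace_altsum zero_form_def altsum_zero fun_eq_iff)
qed

lemma euler_contraction_homogeneous:
  assumes \<alpha>: "\<alpha> \<in> homogeneous_forms d r l"
  shows "euler_contraction \<alpha> \<in> homogeneous_forms d (Suc r) (l - 1)"
    and "l = 0 \<Longrightarrow> euler_contraction \<alpha> = zero_form"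
proof -
  have f: "form_on_Rspace d l \<alpha>" using \<alpha> by (simp add: homogeneous_forms_def)
  show zero: "euler_contraction \<alpha> = zero_form" if "l = 0"
    using that form_on_Rspace_outside[OF f] by (simp add: interior_product_def zero_form_def)
  show "euler_contraction \<alpha> \<in> homogeneous_forms d (Suc r) (l - 1)"
  proof (cases "l = 0")
    case True
    then show ?thesis using zero form_subspace_homogeneous by (simp add: form_subspace_def)
  next
    case False
    have "form_on_Rspace d (l - 1) (euler_contraction \<alpha>)"
      using False skew_Cons[OF form_on_Rspace_skew[OF f]] form_on_Rspace_outside[OF f]
      by (intro form_on_RspaceI) (auto simp: interior_product_def)
    moreover have "homogeneous_poly d (Suc r) (\<lambda>x. \<alpha> x (x # us))" for us
    proof (rule homogeneous_poly_cong)
      \<comment> \<open>Expanding the first argument in unit vectors exposes the linear factors that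
        raise the degree.\<close>
      show "homogeneous_poly d (Suc r) (\<lambda>x. \<Sum>j<d. x j * \<alpha> x (unit_vec j # us))"
        using \<alpha> by (intro homogeneous_poly_sum homogeneous_poly_times_coordinate)
          (auto simp: homogeneous_forms_def)
      show "(\<Sum>j<d. x j * \<alpha> x (unit_vec j # us)) = \<alpha> x (x # us)" if "x \<in> Rspace d" for x
        using skew_expand[OF form_on_Rspace_skew[OF f] that, of x "[]" us] by simp
    qed
    ultimately show ?thesis by (simp add: homogeneous_forms_def interior_product_def)
  qed
qed

lemma euler_contraction_twice:
  assumes "form_on_Rspace d l \<alpha>"
  shows "euler_contraction (euler_contraction \<alpha>) = zero_form"
  using skew_repeat[OF form_on_Rspace_skew[OF assms], of _ "[]" _ "[]"]
  by (simp add: interior_product_def zero_form_def)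

lemma has_pd_altsum:
  "(\<And>v us. has_pd (\<lambda>y. F y v us) i x (D v us)) \<Longrightarrow> has_pd (\<lambda>y. altsum vs (F y)) i x (altsum vs D)"
proof (induction vs arbitrary: F D)
  case (Cons v vs)
  have "has_pd (\<lambda>y. altsum vs (\<lambda>w us. F y w (v # us))) i x (altsum vs (\<lambda>w us. D w (v # us)))"
    using Cons.prems by (intro Cons.IH)
  then show ?case
    using has_pd_add[OF Cons.prems[of v vs] has_pd_minus] by simp
qed (simp add: has_pd_const)

lemma ext_d_twice:
  assumes \<alpha>: "\<alpha> \<in> homogeneous_forms d r l"
  shows "ext_d d (ext_d d \<alpha>) = zero_form"
proof -
  have "ext_d d (ext_d d \<alpha>) x vs = 0" for x vs
  proof (cases "x \<in> Rspace d \<and> set vs \<subseteq> Rspace d")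
    case False
    have "C1_form d (Suc l) (ext_d d \<alpha>)" using ext_d_homogeneous(1)[OF \<alpha>] by (rule homogeneous_forms_C1)
    then show ?thesis using form_on_Rspace_outside[OF form_on_Rspace_ext_d] False by blast
  next
    case True
    \<comment> \<open>\<open>\<Psi> v w ts\<close> is the second derivative of the coefficient along
      \<open>ts\<close> in the directions \<open>v\<close> and \<open>w\<close>; its symmetry makes
      the double alternating sum vanish.\<close>
    define \<Psi> where "\<Psi> v w ts = (\<Sum>j<d. \<Sum>k<d. v j * (w k * partial j (partial k (\<lambda>y. \<alpha> y ts)) x))"
      for v w ts
    have Ck: "Ck_on d (Suc (Suc 0)) (Rspace d) (\<lambda>y. \<alpha> y ts)" for ts
      using \<alpha> homogeneous_poly_Ck_on unfolding homogeneous_forms_def by blast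
    have pd: "has_pd (\<lambda>y. dir_deriv d \<alpha> y w ts) j x (\<Sum>k<d. w k * partial j (partial k (\<lambda>y. \<alpha> y ts)) x)"
      if j: "j < d" for j w ts
      unfolding dir_deriv_def mult.commute[of "partial _ _ _"]
    proof (intro has_pd_sum has_pd_cmult)
      fix k assume "k \<in> {..<d}"
      then have "Ck_on d (Suc 0) (Rspace d) (partial k (\<lambda>y. \<alpha> y ts))" using Ck[of ts] by simp
      then show "has_pd (partial k (\<lambda>y. \<alpha> y ts)) j x (partial j (partial k (\<lambda>y. \<alpha> y ts)) x)"
        by (rule Ck_on_has_pd) (use j True in auto)
    qed
    have "dir_deriv d (ext_d d \<alpha>) x v us = altsum us (\<Psi> v)" if "set us \<subseteq> Rspace d" for v us
    proof -
      have "partial j (\<lambda>y. ext_d d \<alpha> y us) x =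
          altsum us (\<lambda>w ts. \<Sum>k<d. w k * partial j (partial k (\<lambda>y. \<alpha> y ts)) x)" if "j < d" for j
        using \<open>set us \<subseteq> Rspace d\<close> has_pd_partial[OF has_pd_altsum[OF pd[OF that]]]
        by (simp add: ext_d_def ext_deriv_Rspace_altsum)
      then have "dir_deriv d (ext_d d \<alpha>) x v us =
          (\<Sum>j<d. altsum us (\<lambda>w ts. v j * (\<Sum>k<d. w k * partial j (partial k (\<lambda>y. \<alpha> y ts)) x)))"
        by (simp add: dir_deriv_def altsum_scale mult.commute)
      then show ?thesis by (simp add: altsum_sum[symmetric] \<Psi>_def[abs_def] sum_distrib_left)
    qed
    then have "altsum vs (dir_deriv d (ext_d d \<alpha>) x) = altsum vs (\<lambda>v us. altsum us (\<Psi> v))"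
      using True by (intro altsum_cong) auto
    moreover have "\<Psi> v w ts = \<Psi> w v ts" for v w ts
    proof -
      have "\<Psi> v w ts = (\<Sum>k<d. \<Sum>j<d. v j * (w k * partial j (partial k (\<lambda>y. \<alpha> y ts)) x))"
        unfolding \<Psi>_def by (rule sum.swap)
      also have "\<dots> = (\<Sum>k<d. \<Sum>j<d. w k * (v j * partial k (partial j (\<lambda>y. \<alpha> y ts)) x))"
        using True mixed_partials_commute[OF openin_Rspace Ck] by (intro sum.cong) auto
      finally show ?thesis by (simp add: \<Psi>_def)
    qed
    ultimately show ?thesis
      using altsum_altsum_symmetric[of UNIV \<Psi> vs] by (simp add: ext_d_def ext_deriv_Rspace_altsum)
  qed
  then show ?thesis by (simp add: zero_form_def fun_eq_iff)
qed

text \<open>In the contraction the variable occurs as base point and as first argument.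
  Differentiating that argument, the identity field, in direction \<open>v\<close> gives
  \<open>v\<close>; this is the source of the term \<open>\<alpha> x (v # us)\<close>.\<close>

lemma dir_deriv_euler_contraction:
  assumes \<alpha>: "C1_form d l \<alpha>" and x: "x \<in> Rspace d" and v: "v \<in> Rspace d"
  shows "dir_deriv d (euler_contraction \<alpha>) x v us = \<alpha> x (v # us) + dir_deriv d \<alpha> x v (x # us)"
proof -
  have sk: "skew d (\<alpha> y)" for y using \<alpha> form_on_Rspace_skew by (auto simp: C1_form_def)
  have "partial j (\<lambda>y. \<alpha> y (y # us)) x = \<alpha> x (unit_vec j # us) + partial j (\<lambda>y. \<alpha> y (x # us)) x"
    if j: "j < d" for j
  proof (rule has_pd_partial)
    \<comment> \<open>\<open>C1_form\<close> controls coefficients along fixed lists, so the moving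
      argument is written in coordinates with fixed unit vectors.\<close>
    have "has_pd (\<lambda>y. \<Sum>k<d. y k * \<alpha> y (unit_vec k # us)) j x
        (\<Sum>k<d. (if j = k then 1 else 0) * \<alpha> x (unit_vec k # us) +
          x k * partial j (\<lambda>y. \<alpha> y (unit_vec k # us)) x)"
      by (intro has_pd_sum has_pd_mult has_pd_coordinate C1_form_has_pd[OF \<alpha> j])
    moreover have "(\<Sum>k<d. x k * partial j (\<lambda>y. \<alpha> y (unit_vec k # us)) x) = partial j (\<lambda>y. \<alpha> y (x # us)) x"
      using skew_expand[OF skew_partial[OF \<alpha> j] x, of "[]" us x] by simp
    ultimately have "has_pd (\<lambda>y. \<Sum>k<d. y k * \<alpha> y (unit_vec k # us)) j x
        (\<alpha> x (unit_vec j # us) + partial j (\<lambda>y. \<alpha> y (x # us)) x)"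
      using j by (simp add: sum.distrib if_distrib[of "\<lambda>c. c * _"] cong: if_cong)
    moreover have "(\<Sum>k<d. y k * \<alpha> y (unit_vec k # us)) = \<alpha> y (y # us)" if "y \<in> Rspace d" for y
      using skew_expand[OF sk that, of y "[]" us] by simp
    ultimately show "has_pd (\<lambda>y. \<alpha> y (y # us)) j x
        (\<alpha> x (unit_vec j # us) + partial j (\<lambda>y. \<alpha> y (x # us)) x)"
      using has_pd_cong[OF openin_Rspace x j, of "\<lambda>y. \<Sum>k<d. y k * \<alpha> y (unit_vec k # us)"] by simp
  qed
  then have "dir_deriv d (euler_contraction \<alpha>) x v us =
      (\<Sum>j<d. v j * \<alpha> x (unit_vec j # us)) + dir_deriv d \<alpha> x v (x # us)"
    by (simp add: dir_deriv_def interior_product_def sum.distrib algebra_simps)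
  then show ?thesis using skew_expand[OF sk v, of x "[]" us] by simp
qed

text \<open>The derivative of the contraction consists of terms \<open>\<alpha> x (v # us)\<close>,
  which add up to \<open>l\<close> times the form, and of directional derivatives with
  \<open>x\<close> inserted. The latter cancel against all but the first term of the contracted
  derivative; that term is the derivative along \<open>x\<close> itself, given by Euler's
  identity.\<close>

theorem cartan_homotopy_formula:
  assumes \<alpha>: "\<alpha> \<in> homogeneous_forms d r l"
  shows "form_add (ext_d d (euler_contraction \<alpha>)) (euler_contraction (ext_d d \<alpha>)) =
    form_scale (real r + real l) \<alpha>"
proof -
  have C1: "C1_form d l \<alpha>" using \<alpha> by (rule homogeneous_forms_C1)
  have f: "form_on_Rspace d l \<alpha>" using \<alpha> by (simp add: homogeneous_forms_def)
  have "ext_d d (euler_contraction \<alpha>) x vs + ext_d d \<alpha> x (x # vs) = (real r + real l) * \<alpha> x vs" for x vs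
  proof (cases "x \<in> Rspace d \<and> set vs \<subseteq> Rspace d")
    case False
    have "C1_form d (l - 1) (euler_contraction \<alpha>)"
      using euler_contraction_homogeneous(1)[OF \<alpha>] by (rule homogeneous_forms_C1)
    then have "ext_d d (euler_contraction \<alpha>) x vs = 0"
      using form_on_Rspace_outside[OF form_on_Rspace_ext_d] False by blast
    then show ?thesis
      using False form_on_Rspace_outside[OF f, of x vs] by (auto simp: ext_d_def)
  next
    case True
    have "altsum vs (dir_deriv d (euler_contraction \<alpha>) x) =
        altsum vs (\<lambda>v us. \<alpha> x (v # us) + dir_deriv d \<alpha> x v (x # us))"
      using True by (intro altsum_cong dir_deriv_euler_contraction[OF C1]) auto
    moreover have "dir_deriv d \<alpha> x x vs = real r * \<alpha> x vs"
      unfolding dir_deriv_def using \<alpha> True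
      by (intro homogeneous_poly_Euler) (auto simp: homogeneous_forms_def)
    ultimately have "ext_d d (euler_contraction \<alpha>) x vs + ext_d d \<alpha> x (x # vs) =
        (real r + real (length vs)) * \<alpha> x vs"
      using True altsum_skew[OF form_on_Rspace_skew[OF f]]
      by (simp add: ext_d_def ext_deriv_Rspace_altsum altsum_add algebra_simps)
    \<comment> \<open>The factor so far contains the length of \<open>vs\<close>; for any length
      other than \<open>l\<close> the form vanishes.\<close>
    then show ?thesis using form_on_Rspace_outside[OF f, of x vs] by (cases "length vs = l") auto
  qed
  then show ?thesis by (simp add: form_add_def form_scale_def interior_product_def fun_eq_iff)
qed

section \<open>Pullbacks commute with the exterior derivative\<close>

text \<open>A moving argument is expanded in unit vectors, which then join the fixed list
  \<open>us\<close>, so that scalar factors and fixed arguments are all that is differentiated.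
  Moving \<open>W' v\<close> to the front costs one sign per entry of \<open>us\<close> and per
  preceding argument; \<open>altsum\<close> counts the latter.\<close>

lemma form_along_curve:
  assumes \<alpha>: "C1_form d l \<alpha>"
    and c: "\<forall>\<^sub>F t in nhds t0. c t \<in> Rspace d" "c t0 \<in> Rspace d"
      "\<And>j. j < d \<Longrightarrow> ((\<lambda>t. c t j) has_real_derivative c' j) (at t0)"
    and W: "\<And>v. v \<in> set vs \<Longrightarrow> \<forall>\<^sub>F t in nhds t0. W v t \<in> Rspace d"
      "\<And>v. v \<in> set vs \<Longrightarrow> W v t0 \<in> Rspace d" "\<And>v. v \<in> set vs \<Longrightarrow> W' v \<in> Rspace d"
      "\<And>v j. v \<in> set vs \<Longrightarrow> j < d \<Longrightarrow> ((\<lambda>t. W v t j) has_real_derivative W' v j) (at t0)"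
  shows "((\<lambda>t. \<alpha> (c t) (us @ map (\<lambda>v. W v t) vs)) has_real_derivative
    dir_deriv d \<alpha> (c t0) c' (us @ map (\<lambda>v. W v t0) vs) +
    (-1) ^ length us * altsum vs (\<lambda>v ts. \<alpha> (c t0) (W' v # us @ map (\<lambda>w. W w t0) ts))) (at t0)"
  using W
proof (induction vs arbitrary: us)
  case Nil
  have "Ck_on d (Suc 0) (Rspace d) (\<lambda>x. \<alpha> x us)" using \<alpha> unfolding C1_form_def by blast
  from chain_rule_curve[OF openin_Rspace this c] show ?case by (simp add: dir_deriv_def)
next
  case (Cons w vs)
  have sk: "skew d (\<alpha> y)" for y using \<alpha> form_on_Rspace_skew by (auto simp: C1_form_def)
  let ?vs = "\<lambda>t. map (\<lambda>v. W v t) vs"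
  let ?A = "\<lambda>u. altsum vs (\<lambda>v ts. \<alpha> (c t0) (W' v # us @ u # map (\<lambda>w. W w t0) ts))"
  have w: "w \<in> set (w # vs)" by simp
  \<comment> \<open>The fixed list is now longer by one unit vector, which turns the sign in front
    of the alternating sum.\<close>
  have IH: "((\<lambda>t. \<alpha> (c t) (us @ unit_vec j # ?vs t)) has_real_derivative
      dir_deriv d \<alpha> (c t0) c' (us @ unit_vec j # ?vs t0) - (-1) ^ length us * ?A (unit_vec j)) (at t0)" for j
    using Cons.IH[of "us @ [unit_vec j]"] Cons.prems by simp
  have "((\<lambda>t. \<Sum>j<d. W w t j * \<alpha> (c t) (us @ unit_vec j # ?vs t)) has_real_derivative
      (\<Sum>j<d. W' w j * \<alpha> (c t0) (us @ unit_vec j # ?vs t0) +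
        (dir_deriv d \<alpha> (c t0) c' (us @ unit_vec j # ?vs t0) - (-1) ^ length us * ?A (unit_vec j)) * W w t0 j)) (at t0)"
    by (intro DERIV_sum DERIV_mult Cons.prems(4) IH) auto
  moreover have ev: "\<forall>\<^sub>F t in nhds t0. (\<Sum>j<d. W w t j * \<alpha> (c t) (us @ unit_vec j # ?vs t)) =
      \<alpha> (c t) (us @ W w t # ?vs t)"
    using Cons.prems(1)[OF w] by eventually_elim (simp add: skew_expand[OF sk, of _ _ us])
  moreover have "(\<Sum>j<d. W' w j * \<alpha> (c t0) (us @ unit_vec j # ?vs t0)) =
      (-1) ^ length us * \<alpha> (c t0) (W' w # us @ ?vs t0)"
    using skew_expand[OF sk Cons.prems(3)[OF w], of "c t0" us "?vs t0"]
      skew_move[OF sk, of "c t0" "[]" us "W' w" "?vs t0"] by simp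
  moreover have "(\<Sum>j<d. W w t0 j * dir_deriv d \<alpha> (c t0) c' (us @ unit_vec j # ?vs t0)) =
      dir_deriv d \<alpha> (c t0) c' (us @ W w t0 # ?vs t0)"
    using skew_expand[OF skew_dir_deriv[OF \<alpha>] Cons.prems(2)[OF w], of "c t0" c' us "?vs t0"] by simp
  moreover have "(\<Sum>j<d. W w t0 j * ((-1) ^ length us * ?A (unit_vec j))) = (-1) ^ length us * ?A (W w t0)"
  proof -
    have "\<alpha> (c t0) (W' v # us @ W w t0 # map (\<lambda>w. W w t0) ts) =
        (\<Sum>j<d. W w t0 j * \<alpha> (c t0) (W' v # us @ unit_vec j # map (\<lambda>w. W w t0) ts))" for v ts
      using skew_expand[OF sk Cons.prems(2)[OF w], of "c t0" "W' v # us"] by simp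
    then show ?thesis by (simp add: altsum_sum altsum_scale sum_distrib_left mult.left_commute)
  qed
  ultimately show ?case
    unfolding DERIV_cong_ev[OF refl ev refl]
    by (simp add: sum.distrib sum_subtractf algebra_simps)
qed

text \<open>Differentiating a pulled back coefficient gives a part in which \<open>\<alpha>\<close>
  is differentiated, yielding its exterior derivative, and a part in which the Jacobian in each
  argument is differentiated. The latter contains the second differential of \<open>K\<close>, which
  is symmetric, so its double alternating sum vanishes.\<close>

theorem ext_deriv_pullback_Rspace:
  assumes \<alpha>: "C1_form d l \<alpha>" and V: "openin (Euclidean_space d) V" and x: "x \<in> V"
    and KV: "K ` V \<subseteq> Rspace d" and K: "\<And>j. Ck_on d (Suc (Suc 0)) V (\<lambda>y. K y j)"
    and \<beta>: "\<And>y us. y \<in> V \<Longrightarrow> set us \<subseteq> Rspace d \<Longrightarrow> \<beta> y us = \<alpha> (K y) (map (jacobian d K y) us)"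
    and vs: "set vs \<subseteq> Rspace d"
  shows "ext_deriv_Rspace d \<beta> x vs = ext_deriv_Rspace d \<alpha> (K x) (map (jacobian d K x) vs)"
proof -
  let ?J = "jacobian d K"
  \<comment> \<open>\<open>D i v\<close> is the \<open>i\<close>-th partial derivative of the
    Jacobian applied to \<open>v\<close>, and \<open>B\<close> is the second differential of
    \<open>K\<close> at \<open>x\<close>.\<close>
  define D where "D i v = (\<lambda>k. \<Sum>j<d. v j * partial i (partial j (\<lambda>y. K y k)) x)" for i v
  define B where "B v w = (\<lambda>k. \<Sum>i<d. v i * D i w k)" for v w
  have sk: "skew d (\<alpha> y)" for y using \<alpha> form_on_Rspace_skew by (auto simp: C1_form_def)
  have pK: "Ck_on d (Suc 0) V (partial j (\<lambda>y. K y k))" if "j < d" for j k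
    using K[of k] that by simp
  have J: "?J y v \<in> Rspace d" if "y \<in> V" for y v
    using jacobian_Rspace[OF V that KV] .
  have D: "D i v \<in> Rspace d" if i: "i < d" for i v
    unfolding Rspace_iff
  proof (intro allI impI)
    fix k assume k: "d \<le> k"
    have "partial i (partial j (\<lambda>y. K y k)) x = 0" if "j < d" for j
      using partial_cong[OF V x i, of "partial j (\<lambda>y. K y k)" "\<lambda>_. 0"]
        partial_outside[OF V _ that KV k] has_pd_partial[OF has_pd_const] by simp
    then show "D i v k = 0" by (simp add: D_def)
  qed
  have B_sym: "B v w = B w v" for v w
  proof
    fix k
    have "B v w k = (\<Sum>i<d. \<Sum>j<d. v i * (w j * partial i (partial j (\<lambda>y. K y k)) x))"
      by (simp add: B_def D_def sum_distrib_left)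
    also have "\<dots> = (\<Sum>j<d. \<Sum>i<d. v i * (w j * partial i (partial j (\<lambda>y. K y k)) x))"
      by (rule sum.swap)
    also have "\<dots> = (\<Sum>j<d. \<Sum>i<d. w j * (v i * partial j (partial i (\<lambda>y. K y k)) x))"
      using mixed_partials_commute[OF V K x] by (intro sum.cong) auto
    finally show "B v w k = B w v k" by (simp add: B_def D_def sum_distrib_left)
  qed
  have dd: "dir_deriv d \<beta> x v us = dir_deriv d \<alpha> (K x) (?J x v) (map (?J x) us) +
      altsum us (\<lambda>w ts. \<alpha> (K x) (B v w # map (?J x) ts))" if us: "set us \<subseteq> Rspace d" and v: "v \<in> Rspace d" for v us
  proof -
    \<comment> \<open>Along the \<open>i\<close>-th coordinate line the base point and all arguments
      of \<open>\<alpha>\<close> move; the list of fixed arguments is empty.\<close>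
    have p: "partial i (\<lambda>y. \<beta> y us) x =
        dir_deriv d \<alpha> (K x) (\<lambda>k. partial i (\<lambda>y. K y k) x) (map (?J x) us) +
        altsum us (\<lambda>w ts. \<alpha> (K x) (D i w # map (?J x) ts))" if i: "i < d" for i
    proof -
      have ev: "\<forall>\<^sub>F t in nhds (x i). x(i := t) \<in> V" using eventually_fun_upd[OF V x i] .
      have "((\<lambda>t. \<alpha> (K (x(i := t))) ([] @ map (\<lambda>v. ?J (x(i := t)) v) us)) has_real_derivative
          dir_deriv d \<alpha> (K (x(i := x i))) (\<lambda>k. partial i (\<lambda>y. K y k) x)
            ([] @ map (\<lambda>v. ?J (x(i := x i)) v) us) +
          (-1) ^ length ([] :: vec list) *
          altsum us (\<lambda>v ts. \<alpha> (K (x(i := x i))) (D i v # [] @ map (\<lambda>w. ?J (x(i := x i)) w) ts))) (at (x i))"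
      proof (rule form_along_curve[OF \<alpha>])
        show "\<forall>\<^sub>F t in nhds (x i). K (x(i := t)) \<in> Rspace d"
          using ev by eventually_elim (use KV in blast)
        show "K (x(i := x i)) \<in> Rspace d" using KV x by auto
        show "((\<lambda>t. K (x(i := t)) j) has_real_derivative partial i (\<lambda>y. K y j) x) (at (x i))" for j
          using Ck_on_has_pd[OF K i x] by (simp add: has_pd_def)
        show "\<forall>\<^sub>F t in nhds (x i). ?J (x(i := t)) v \<in> Rspace d" for v
          using ev by eventually_elim (rule J)
        show "?J (x(i := x i)) v \<in> Rspace d" for v using J[OF x] by simp
        show "D i v \<in> Rspace d" for v using D[OF i] .
        have "has_pd (\<lambda>y. \<Sum>j<d. v j * partial j (\<lambda>y. K y k) y) i x (D i v k)" for v k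
          unfolding D_def
          using Ck_on_has_pd[OF pK i x] by (intro has_pd_sum has_pd_cmult) auto
        then show "((\<lambda>t. ?J (x(i := t)) v k) has_real_derivative D i v k) (at (x i))" for v k
          by (simp add: has_pd_def jacobian_def mult.commute)
      qed
      then have "has_pd (\<lambda>y. \<alpha> (K y) (map (?J y) us)) i x
          (dir_deriv d \<alpha> (K x) (\<lambda>k. partial i (\<lambda>y. K y k) x) (map (?J x) us) +
           altsum us (\<lambda>w ts. \<alpha> (K x) (D i w # map (?J x) ts)))"
        by (simp add: has_pd_def)
      then have "partial i (\<lambda>y. \<alpha> (K y) (map (?J y) us)) x =
          dir_deriv d \<alpha> (K x) (\<lambda>k. partial i (\<lambda>y. K y k) x) (map (?J x) us) +
           altsum us (\<lambda>w ts. \<alpha> (K x) (D i w # map (?J x) ts))"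
        by (rule has_pd_partial)
      then show ?thesis using partial_cong[OF V x i, of "\<lambda>y. \<beta> y us"] \<beta> us by simp
    qed
    have "(\<Sum>i<d. v i * dir_deriv d \<alpha> (K x) (\<lambda>k. partial i (\<lambda>y. K y k) x) (map (?J x) us)) =
        dir_deriv d \<alpha> (K x) (?J x v) (map (?J x) us)"
    proof -
      have "(\<Sum>i<d. v i * dir_deriv d \<alpha> (K x) (\<lambda>k. partial i (\<lambda>y. K y k) x) (map (?J x) us)) =
        (\<Sum>i<d. \<Sum>k<d. v i * (partial k (\<lambda>y. \<alpha> y (map (?J x) us)) (K x) * partial i (\<lambda>y. K y k) x))"
        by (simp add: dir_deriv_def sum_distrib_left)
      also have "\<dots> = (\<Sum>k<d. \<Sum>i<d. v i * (partial k (\<lambda>y. \<alpha> y (map (?J x) us)) (K x) * partial i (\<lambda>y. K y k) x))"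
        by (rule sum.swap)
      finally show ?thesis by (simp add: dir_deriv_def jacobian_def sum_distrib_left mult_ac)
    qed
    moreover have "(\<Sum>i<d. v i * altsum us (\<lambda>w ts. \<alpha> (K x) (D i w # map (?J x) ts))) =
        altsum us (\<lambda>w ts. \<alpha> (K x) (B v w # map (?J x) ts))"
    proof -
      \<comment> \<open>The sum is built from the rule for two summands. Membership of the partial
        sums in R^d is carried along because that rule asks for it.\<close>
      have lin: "(\<Sum>i<m. v i * \<alpha> (K x) (D i w # ts)) = \<alpha> (K x) ((\<lambda>k. \<Sum>i<m. v i * D i w k) # ts)
        \<and> (\<lambda>k. \<Sum>i<m. v i * D i w k) \<in> Rspace d"
        if "m \<le> d" for m w ts
        using that
      proof (induction m)
        case 0
        have "\<alpha> (K x) (lincomb 0 (\<lambda>_. 0) 0 (\<lambda>_. 0) # ts) = 0"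
          using skew_lincomb[OF sk, of "\<lambda>_. 0" "\<lambda>_. 0" "K x" "[]" 0 0 ts] by (simp add: Rspace_iff)
        then show ?case by (simp add: lincomb_def Rspace_iff)
      next
        case (Suc m)
        have "lincomb 1 (\<lambda>k. \<Sum>i<m. v i * D i w k) (v m) (D m w) = (\<lambda>k. \<Sum>i<Suc m. v i * D i w k)"
          by (simp add: lincomb_def)
        then show ?case
          using Suc skew_lincomb[OF sk, of "\<lambda>k. \<Sum>i<m. v i * D i w k" "D m w" "K x" "[]" 1 "v m" ts] D[of m w]
            lincomb_Rspace[of "\<lambda>k. \<Sum>i<m. v i * D i w k" d "D m w" 1 "v m"] by simp
      qed
      have "(\<Sum>i<d. v i * altsum us (\<lambda>w ts. \<alpha> (K x) (D i w # map (?J x) ts))) =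
          altsum us (\<lambda>w ts. \<Sum>i<d. v i * \<alpha> (K x) (D i w # map (?J x) ts))"
        by (simp add: altsum_sum altsum_scale)
      then show ?thesis using lin[of d] by (simp add: B_def)
    qed
    ultimately show ?thesis
      by (simp add: dir_deriv_def[of d \<beta>] p distrib_left sum.distrib mult.commute[of _ "v _"])
  qed
  have "altsum vs (dir_deriv d \<beta> x) =
      altsum vs (\<lambda>v us. dir_deriv d \<alpha> (K x) (?J x v) (map (?J x) us) +
        altsum us (\<lambda>w ts. \<alpha> (K x) (B v w # map (?J x) ts)))"
    using vs by (intro altsum_cong dd) auto
  also have "\<dots> = altsum (map (?J x) vs) (dir_deriv d \<alpha> (K x))"
    using altsum_altsum_symmetric[of UNIV "\<lambda>v w ts. \<alpha> (K x) (B v w # map (?J x) ts)" vs] B_sym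
    by (simp add: altsum_add altsum_map)
  finally show ?thesis by (simp add: ext_deriv_Rspace_altsum)
qed

section \<open>Forms with nonzero exterior derivative\<close>

text \<open>As \<open>\<omega>\<close> has constant coefficients, the derivative is s x_k^(s-1) dx_k
  wedge omega. The list \<open>E\<close> runs through the unit vectors downwards, so that
  \<open>unit_vec k # E\<close> is the corresponding list for \<open>k + 1\<close>.\<close>

lemma form_on_Rspace_times_power:
  assumes \<omega>: "\<omega> \<in> homogeneous_forms d 0 k" and k: "k < d"
  defines "\<alpha> \<equiv> \<lambda>s (x :: vec) vs. x k ^ s * \<omega> x vs"
    and "E \<equiv> map unit_vec (rev [0..<k])"
  shows "\<alpha> s \<in> homogeneous_forms d s k"
    and "x \<in> Rspace d \<Longrightarrow> ext_d d (\<alpha> s) x (unit_vec k # E) = real s * x k ^ (s - 1) * \<omega> x E"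
proof -
  have f: "form_on_Rspace d k \<omega>" using \<omega> by (simp add: homogeneous_forms_def)
  have "form_on_Rspace d k (\<alpha> s)"
  proof (rule form_on_RspaceI)
    fix x
    have sk: "skew d (\<omega> x)" using form_on_Rspace_skew[OF f] .
    show "skew d (\<alpha> s x)"
      unfolding skew_def \<alpha>_def
    proof (intro conjI allI impI)
      fix us ws u v
      show "x k ^ s * \<omega> x (us @ u # v # ws) = - (x k ^ s * \<omega> x (us @ v # u # ws))"
        using skew_swap[OF sk, of us u v ws] by simp
    qed (simp add: skew_lincomb[OF sk] algebra_simps)
  qed (simp add: \<alpha>_def form_on_Rspace_outside[OF f])
  moreover have "homogeneous_poly d s (\<lambda>x. \<alpha> s x vs)" for vs
  proof (induction s)
    case 0
    then show ?case using \<omega> by (simp add: \<alpha>_def homogeneous_forms_def)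
  next
    case (Suc s)
    then show ?case
      using homogeneous_poly_times_coordinate[OF Suc k] by (simp add: \<alpha>_def mult.assoc)
  qed
  ultimately show "\<alpha> s \<in> homogeneous_forms d s k" by (simp add: homogeneous_forms_def)
  assume x: "x \<in> Rspace d"
  have dd: "dir_deriv d (\<alpha> s) x v us = v k * (real s * x k ^ (s - 1) * \<omega> x us)" for v us
  proof -
    have "has_pd (\<lambda>y. \<omega> y us) j x 0" if j: "j < d" for j
    proof -
      have "partial j (\<lambda>y. \<omega> y us) x = 0"
        using homogeneous_poly_partial(2)[OF _ j _ x] \<omega> by (auto simp: homogeneous_forms_def)
      then show ?thesis using C1_form_has_pd[OF homogeneous_forms_C1[OF \<omega>] j, of us x] by simp
    qed
    moreover have "has_pd (\<lambda>y. y k ^ s) j x (if j = k then real s * x k ^ (s - 1) else 0)" for j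
      by (auto simp: has_pd_def intro!: derivative_eq_intros)
    ultimately have "has_pd (\<lambda>y. \<alpha> s y us) j x
        ((if j = k then real s * x k ^ (s - 1) else 0) * \<omega> x us + x k ^ s * 0)" if "j < d" for j
      unfolding \<alpha>_def using that by (intro has_pd_mult)
    then have "partial j (\<lambda>y. \<alpha> s y us) x = (if j = k then real s * x k ^ (s - 1) * \<omega> x us else 0)"
      if "j < d" for j
      using has_pd_partial that by fastforce
    then show ?thesis using k by (simp add: dir_deriv_def if_distrib[of "\<lambda>c. c * _"] cong: if_cong)
  qed
  \<comment> \<open>All terms except the one omitting \<open>unit_vec k\<close> differentiate in a
    direction from \<open>E\<close>, whose \<open>k\<close>-th coordinate is 0.\<close>
  have "altsum E (\<lambda>w us. dir_deriv d (\<alpha> s) x w (unit_vec k # us)) = altsum E (\<lambda>_ _. 0)"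
    by (intro altsum_cong) (auto simp: dd E_def unit_vec_def)
  moreover have "set (unit_vec k # E) \<subseteq> Rspace d"
    using k by (auto simp: E_def intro: unit_vec_Rspace)
  ultimately show "ext_d d (\<alpha> s) x (unit_vec k # E) = real s * x k ^ (s - 1) * \<omega> x E"
    by (simp add: ext_d_def ext_deriv_Rspace_altsum altsum_zero dd) (simp add: unit_vec_def)
qed

text \<open>The form is dx_(k-1) wedge ... wedge dx_0. Each further factor arises from the case
  \<open>s = 1\<close> of the preceding lemma, so wedge products never have to be formed.\<close>

lemma exists_constant_form:
  "k \<le> d \<Longrightarrow> \<exists>\<omega>\<in>homogeneous_forms d 0 k. \<forall>x\<in>Rspace d. \<omega> x (map unit_vec (rev [0..<k])) = 1"
proof (induction k)
  case 0
  let ?\<omega> = "\<lambda>(x :: vec) (vs :: vec list). if x \<in> Rspace d \<and> vs = [] then 1 else 0 :: real"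
  have "form_on_Rspace d 0 ?\<omega>"
    by (rule form_on_RspaceI) (auto simp: skew_def)
  moreover have "homogeneous_poly d 0 (\<lambda>x. ?\<omega> x vs)" for vs
  proof (cases "vs = []")
    case True
    have "homogeneous_poly d 0 (monomial d (\<lambda>_. 0))"
      by (rule homogeneous_poly_monomial) (simp add: multiindices_def)
    then show ?thesis by (rule homogeneous_poly_cong) (simp add: monomial_def True)
  qed (simp add: homogeneous_poly_zero)
  ultimately have "?\<omega> \<in> homogeneous_forms d 0 0" by (simp add: homogeneous_forms_def)
  then show ?case by (rule bexI[rotated]) simp
next
  case (Suc k)
  then obtain \<omega> where \<omega>: "\<omega> \<in> homogeneous_forms d 0 k"
    "\<And>x. x \<in> Rspace d \<Longrightarrow> \<omega> x (map unit_vec (rev [0..<k])) = 1" by auto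
  let ?\<alpha> = "\<lambda>(x :: vec) vs. x k ^ 1 * \<omega> x vs"
  have k: "k < d" using Suc.prems by simp
  have "ext_d d ?\<alpha> \<in> homogeneous_forms d 0 (Suc k)"
    using ext_d_homogeneous(1)[OF form_on_Rspace_times_power(1)[OF \<omega>(1) k, of 1]] by simp
  moreover have "ext_d d ?\<alpha> x (map unit_vec (rev [0..<Suc k])) = 1" if "x \<in> Rspace d" for x
    using form_on_Rspace_times_power(2)[OF \<omega>(1) k that, of 1] \<omega>(2)[OF that] by simp
  ultimately show ?case by blast
qed


section \<open>Graded spaces of forms\<close>

lemma form_sum_empty: "form_sum h {} = zero_form"
  by (simp add: form_sum_def zero_form_def)

lemma form_sum_insert:
  "finite S \<Longrightarrow> s \<notin> S \<Longrightarrow> form_sum h (insert s S) = form_add (h s) (form_sum h S)"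
  by (simp add: form_sum_def form_add_def)

lemma form_linear_on_zero:
  assumes "form_subspace V" and "form_linear_on V T"
  shows "T zero_form = zero_form"
proof -
  have "T (form_scale 0 zero_form) = form_scale 0 (T zero_form)"
    using assms by (simp add: form_subspace_def form_linear_on_def)
  then show ?thesis by (simp add: form_scale_def zero_form_def)
qed

lemma form_subspace_sum:
  assumes V: "form_subspace V" and "finite S" and "\<And>s. s \<in> S \<Longrightarrow> h s \<in> V"
  shows "form_sum h S \<in> V"
  using assms(2,3)
  by (induction S rule: finite_induct)
    (use V in \<open>auto simp: form_sum_empty form_sum_insert form_subspace_def\<close>)

lemma form_linear_on_sum:
  assumes V: "form_subspace V" and T: "form_linear_on V T"
  shows "finite S \<Longrightarrow> (\<And>s. s \<in> S \<Longrightarrow> h s \<in> V) \<Longrightarrow> T (form_sum h S) = form_sum (\<lambda>s. T (h s)) S"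
proof (induction S rule: finite_induct)
  case (insert s S)
  then have "form_sum h S \<in> V" by (intro form_subspace_sum[OF V]) auto
  then show ?case using T insert by (simp add: form_sum_insert form_linear_on_def)
qed (simp add: form_sum_empty form_linear_on_zero[OF V T])

lemma form_linear_on_subset: "form_linear_on V T \<Longrightarrow> W \<subseteq> V \<Longrightarrow> form_linear_on W T"
  unfolding form_linear_on_def by blast

text \<open>This is \<open>cell_poly_forms\<close> for an arbitrary graded family. The integers up
  to \<open>r\<close> form an infinite set, hence the explicit finiteness of
  \<open>S\<close>.\<close>

definition sum_space :: "(int \<Rightarrow> ('p, 'v) form set) \<Rightarrow> int \<Rightarrow> ('p, 'v) form set"
  where "sum_space H r = {form_sum h S | h S. finite S \<and> S \<subseteq> {..r} \<and> (\<forall>s\<in>S. h s \<in> H s)}"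

lemma form_subspace_sum_space:
  assumes "\<And>s. form_subspace (H s)"
  shows "form_subspace (sum_space H r)"
proof (rule form_subspaceI)
  show "zero_form \<in> sum_space H r"
    unfolding sum_space_def using form_sum_empty[symmetric] by (intro CollectI exI[of _ "{}"] exI) auto
  fix \<alpha> \<beta> and a b :: real
  assume "\<alpha> \<in> sum_space H r" "\<beta> \<in> sum_space H r"
  then obtain h S h' S' where
    h: "\<alpha> = form_sum h S" "finite S" "S \<subseteq> {..r}" "\<And>s. s \<in> S \<Longrightarrow> h s \<in> H s" and
    h': "\<beta> = form_sum h' S'" "finite S'" "S' \<subseteq> {..r}" "\<And>s. s \<in> S' \<Longrightarrow> h' s \<in> H s"
    unfolding sum_space_def by blast
  \<comment> \<open>Both families are continued by zero to the union of their index sets, where they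
    can be added termwise.\<close>
  define k where "k s = (if s \<in> S then h s else zero_form)" for s
  define k' where "k' s = (if s \<in> S' then h' s else zero_form)" for s
  have "(\<Sum>s\<in>S. h s p vs) = (\<Sum>s\<in>S \<union> S'. k s p vs)" for p vs
    using h(2) h'(2) by (intro sum.mono_neutral_cong_left) (auto simp: k_def zero_form_def)
  moreover have "(\<Sum>s\<in>S'. h' s p vs) = (\<Sum>s\<in>S \<union> S'. k' s p vs)" for p vs
    using h(2) h'(2) by (intro sum.mono_neutral_cong_left) (auto simp: k'_def zero_form_def)
  ultimately have "form_add (form_scale a \<alpha>) (form_scale b \<beta>) =
      form_sum (\<lambda>s. form_add (form_scale a (k s)) (form_scale b (k' s))) (S \<union> S')"
    by (simp add: h(1) h'(1) form_sum_def form_add_def form_scale_def sum.distrib sum_distrib_left)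
  moreover have "form_add (form_scale a (k s)) (form_scale b (k' s)) \<in> H s" for s
  proof -
    have "k s \<in> H s" "k' s \<in> H s"
      using h(4) h'(4) assms by (auto simp: k_def k'_def form_subspace_def)
    then show ?thesis using assms by (simp add: form_subspace_def)
  qed
  moreover have "finite (S \<union> S')" "S \<union> S' \<subseteq> {..r}" using h h' by auto
  ultimately show "form_add (form_scale a \<alpha>) (form_scale b \<beta>) \<in> sum_space H r"
    unfolding sum_space_def by blast
qed

text \<open>Linearity of \<open>T\<close> is given on \<open>V l\<close>, which contains the
  summands of all polynomial degrees and their sums; a single \<open>H s l\<close> would not contain
  these sums.\<close>

lemma is_complex_sum_space:
  assumes H: "\<And>s l. form_subspace (H s l)" and V: "\<And>l. form_subspace (V l)"
    and HV: "\<And>s l. H s l \<subseteq> V l" and T: "\<And>l. form_linear_on (V l) T"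
    and TH: "\<And>s l p. p \<in> H s l \<Longrightarrow> T p \<in> H (s + \<rho>) (l + \<sigma>)"
    and TT: "\<And>s l p. p \<in> H s l \<Longrightarrow> T (T p) = zero_form"
  shows "is_complex (\<lambda>r l. sum_space (\<lambda>s. H s l) r) \<rho> \<sigma> T"
proof -
  have sub: "sum_space (\<lambda>s. H s l) r \<subseteq> V l" for r l
  proof
    fix p assume "p \<in> sum_space (\<lambda>s. H s l) r"
    then obtain h S where "p = form_sum h S" "finite S" "\<And>s. s \<in> S \<Longrightarrow> h s \<in> H s l"
      unfolding sum_space_def by blast
    then show "p \<in> V l" using HV[of _ l] by (auto intro!: form_subspace_sum[OF V])
  qed
  have T_sum: "T (form_sum h S) = form_sum (\<lambda>s. T (h s)) S" if "finite S" "\<And>s. s \<in> S \<Longrightarrow> h s \<in> H s l" for h S l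
    using that HV by (intro form_linear_on_sum[OF V T]) blast+
  show ?thesis
    unfolding is_complex_def
  proof (intro allI conjI ballI)
    fix r l
    show "form_subspace (sum_space (\<lambda>s. H s l) r)" using H by (rule form_subspace_sum_space)
    show "form_linear_on (sum_space (\<lambda>s. H s l) r) T" using T sub by (rule form_linear_on_subset)
    show "T ` sum_space (\<lambda>s. H s l) r \<subseteq> sum_space (\<lambda>s. H s (l + \<sigma>)) (r + \<rho>)"
    proof
      fix q assume "q \<in> T ` sum_space (\<lambda>s. H s l) r"
      then obtain h S where h: "q = T (form_sum h S)" "finite S" "S \<subseteq> {..r}" "\<And>s. s \<in> S \<Longrightarrow> h s \<in> H s l"
        unfolding sum_space_def by blast
      \<comment> \<open>\<open>T\<close> shifts the degree by \<open>\<rho>\<close>, so the sum is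
        indexed anew by \<open>t = s + \<rho>\<close>.\<close>
      have "q = form_sum (\<lambda>t. T (h (t - \<rho>))) ((\<lambda>s. s + \<rho>) ` S)"
        using T_sum[OF h(2,4)] h(1) by (simp add: form_sum_def sum.reindex inj_on_def)
      moreover have "T (h (t - \<rho>)) \<in> H t (l + \<sigma>)" if "t \<in> (\<lambda>s. s + \<rho>) ` S" for t
        using TH[OF h(4)] that by auto
      moreover have "finite ((\<lambda>s. s + \<rho>) ` S)" "(\<lambda>s. s + \<rho>) ` S \<subseteq> {..r + \<rho>}" using h(2,3) by auto
      ultimately show "q \<in> sum_space (\<lambda>s. H s (l + \<sigma>)) (r + \<rho>)"
        unfolding sum_space_def by blast
    qed
    fix p assume "p \<in> sum_space (\<lambda>s. H s l) r"
    then obtain h S where h: "p = form_sum h S" "finite S" "\<And>s. s \<in> S \<Longrightarrow> h s \<in> H s l"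
      unfolding sum_space_def by blast
    have "T (T p) = T (form_sum (\<lambda>s. T (h s)) S)" using T_sum[OF h(2,3)] h(1) by simp
    also have "\<dots> = form_sum (\<lambda>s. T (T (h s))) S"
      using h(2,3) TH HV by (intro form_linear_on_sum[OF V T]) blast+
    also have "\<dots> = zero_form" using TT[OF h(3)] by (simp add: form_sum_def zero_form_def)
    finally show "T (T p) = zero_form" .
  qed
qed

text \<open>The usual elimination: applying \<open>L\<close> and subtracting \<open>lam s0\<close>
  times the relation removes the summand \<open>s0\<close> and multiplies the others by nonzero
  factors. Only the action of \<open>L\<close> on finite sums of eigenvectors enters.\<close>

lemma eigenspaces_independent:
  assumes H: "\<And>s. form_subspace (H s)"
    and L: "\<And>h S. finite S \<Longrightarrow> (\<And>s. s \<in> S \<Longrightarrow> h s \<in> H s) \<Longrightarrow>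
      L (form_sum h S) = form_sum (\<lambda>s. form_scale (lam s) (h s)) S"
  shows "finite S \<Longrightarrow> inj_on lam S \<Longrightarrow> (\<And>s. s \<in> S \<Longrightarrow> h s \<in> H s) \<Longrightarrow>
    form_sum h S = zero_form \<Longrightarrow> s \<in> S \<Longrightarrow> h s = zero_form"
proof (induction S arbitrary: h s rule: finite_induct)
  case (insert s0 S)
  define h' where "h' s = form_scale (lam s - lam s0) (h s)" for s
  have Lz: "L zero_form = zero_form"
    using L[of "{}" h] by (simp add: form_sum_def zero_form_def)
  have sum0: "(\<Sum>s\<in>insert s0 S. h s p vs) = 0" for p vs
    using insert.prems(3) by (simp add: form_sum_def zero_form_def fun_eq_iff)
  have "form_sum (\<lambda>s. form_scale (lam s) (h s)) (insert s0 S) = zero_form"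
    using L[of "insert s0 S" h] insert.prems insert.hyps Lz by simp
  then have "(\<Sum>s\<in>insert s0 S. lam s * h s p vs) = 0" for p vs
    by (simp add: form_sum_def form_scale_def zero_form_def fun_eq_iff)
  then have "(\<Sum>s\<in>insert s0 S. (lam s - lam s0) * h s p vs) = 0" for p vs
    using sum0[of p vs] by (simp add: left_diff_distrib sum_subtractf flip: sum_distrib_left)
  then have "form_sum h' S = zero_form"
    using insert.hyps by (simp add: form_sum_def h'_def form_scale_def zero_form_def)
  moreover have "inj_on lam S" using insert.prems(1) by (rule inj_on_subset) blast
  moreover have "h' s \<in> H s" if "s \<in> S" for s
    using H insert.prems(2) that by (auto simp: h'_def form_subspace_def)
  ultimately have "h' s = zero_form" if "s \<in> S" for s
    using that by (intro insert.IH[of h'])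
  then have *: "h s = zero_form" if "s \<in> S" for s
    using that insert.prems(1) insert.hyps
    by (auto simp: h'_def form_scale_def zero_form_def fun_eq_iff inj_on_def)
  moreover have "h s0 = zero_form"
    using sum0 * insert.hyps by (simp add: zero_form_def fun_eq_iff)
  ultimately show ?case using insert.prems(4) by blast
qed simp

section \<open>Forms on coordinate space with integer degrees, including negative ones\<close>

lemma form_subspace_hom_forms: "form_subspace (hom_forms d s l)"
  unfolding hom_forms_eq using form_subspace_homogeneous
  by (auto simp: form_subspace_def form_add_def form_scale_def zero_form_def)

lemma hom_forms_C1: "\<alpha> \<in> hom_forms d s l \<Longrightarrow> C1_form d (nat l) \<alpha>"
  using form_subspace_C1[of d "nat l"] homogeneous_forms_C1
  by (auto simp: hom_forms_eq form_subspace_def split: if_splits)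

lemma ext_d_zero: "ext_d d zero_form = zero_form"
  using form_linear_on_zero[OF form_subspace_C1 form_linear_on_ext_d] .

lemma euler_contraction_zero: "euler_contraction zero_form = zero_form"
  by (simp add: interior_product_def zero_form_def)

text \<open>For \<open>s \<le> 0\<close> or \<open>l < 0\<close> the derivative is zero and lies in
  every space; otherwise natural and integer degrees correspond.\<close>

lemma ext_d_hom_forms:
  assumes "\<alpha> \<in> hom_forms d s l"
  shows "ext_d d \<alpha> \<in> hom_forms d (s - 1) (l + 1)" and "ext_d d (ext_d d \<alpha>) = zero_form"
proof -
  have zero: "zero_form \<in> hom_forms d s l" for s l
    using form_subspace_hom_forms by (simp add: form_subspace_def)
  show "ext_d d \<alpha> \<in> hom_forms d (s - 1) (l + 1)"
  proof (cases "s \<le> 0 \<or> l < 0")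
    case True
    then have "ext_d d \<alpha> = zero_form"
      using assms ext_d_homogeneous(2) ext_d_zero by (auto simp: hom_forms_eq split: if_splits)
    then show ?thesis using zero by simp
  next
    case False
    then show ?thesis
      using assms ext_d_homogeneous(1)[of \<alpha> d "nat s" "nat l"]
      by (auto simp: hom_forms_eq nat_diff_distrib nat_add_distrib split: if_splits)
  qed
  show "ext_d d (ext_d d \<alpha>) = zero_form"
    using assms ext_d_twice ext_d_zero by (auto simp: hom_forms_eq split: if_splits)
qed

lemma euler_contraction_hom_forms:
  assumes "\<alpha> \<in> hom_forms d s l"
  shows "euler_contraction \<alpha> \<in> hom_forms d (s + 1) (l - 1)"
    and "euler_contraction (euler_contraction \<alpha>) = zero_form"
proof -
  have zero: "zero_form \<in> hom_forms d s l" for s l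
    using form_subspace_hom_forms by (simp add: form_subspace_def)
  show "euler_contraction \<alpha> \<in> hom_forms d (s + 1) (l - 1)"
  proof (cases "s < 0 \<or> l \<le> 0")
    case True
    then have "euler_contraction \<alpha> = zero_form"
      using assms euler_contraction_homogeneous(2) euler_contraction_zero
      by (auto simp: hom_forms_eq split: if_splits)
    then show ?thesis using zero by simp
  next
    case False
    then show ?thesis
      using assms euler_contraction_homogeneous(1)[of \<alpha> d "nat s" "nat l"]
      by (auto simp: hom_forms_eq nat_diff_distrib nat_add_distrib split: if_splits)
  qed
  show "euler_contraction (euler_contraction \<alpha>) = zero_form"
    using hom_forms_C1[OF assms] euler_contraction_twice by (auto simp: C1_form_def)
qed


section \<open>Polynomial forms in local coordinates\<close>

text \<open>What a cell, its charts and its coordinates contribute, without the ambient manifold.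
  Regularity concerns every component index \<open>j\<close>, as Jacobians are compared as whole
  functions; the images of chart domains under \<open>J\<close> are open, so that \<open>I\<close>
  can be differentiated there.\<close>

locale cell_coordinates =
  fixes d :: nat and C :: "'m chart set" and f :: "'m set" and I :: "vec \<Rightarrow> 'm" and J :: "'m \<Rightarrow> vec"
  assumes chart_subset: "ch \<in> C \<Longrightarrow> fst ch \<subseteq> f"
    and charts_cover: "p \<in> f \<Longrightarrow> \<exists>ch\<in>C. p \<in> fst ch"
    and chart_inj: "ch \<in> C \<Longrightarrow> inj_on (snd ch) (fst ch)"
    and transition_open: "ch \<in> C \<Longrightarrow> ch' \<in> C \<Longrightarrow>
      openin (Euclidean_space d) (snd ch ` (fst ch \<inter> fst ch'))"
    and transition_C2: "ch \<in> C \<Longrightarrow> ch' \<in> C \<Longrightarrow>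
      Ck_on d (Suc (Suc 0)) (snd ch ` (fst ch \<inter> fst ch')) (\<lambda>x. snd ch' (chart_inv ch x) j)"
    and I_J: "p \<in> f \<Longrightarrow> I (J p) = p"
    and J_open: "ch \<in> C \<Longrightarrow> openin (Euclidean_space d) (J ` fst ch)"
    and J_C2: "ch \<in> C \<Longrightarrow> Ck_on d (Suc (Suc 0)) (snd ch ` fst ch) (\<lambda>x. J (chart_inv ch x) j)"
    and I_C2: "ch \<in> C \<Longrightarrow> Ck_on d (Suc (Suc 0)) (J ` fst ch) (\<lambda>y. snd ch (I y) j)"
begin

lemma chart_image_open: "ch \<in> C \<Longrightarrow> openin (Euclidean_space d) (snd ch ` fst ch)"
  using transition_open[of ch ch] by simp

lemma chart_Rspace: "ch \<in> C \<Longrightarrow> p \<in> fst ch \<Longrightarrow> snd ch p \<in> Rspace d"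
  using openin_subset[OF chart_image_open] by blast

lemma J_Rspace: "p \<in> f \<Longrightarrow> J p \<in> Rspace d"
  using charts_cover[of p] openin_subset[OF J_open] by blast

lemma chart_inv_chart: "ch \<in> C \<Longrightarrow> p \<in> fst ch \<Longrightarrow> chart_inv ch (snd ch p) = p"
  unfolding chart_inv_def using chart_inj by (rule inv_into_f_f)

lemma chart_at_mem: "p \<in> f \<Longrightarrow> chart_at C p \<in> C \<and> p \<in> fst (chart_at C p)"
  unfolding chart_at_def by (rule someI_ex) (use charts_cover in blast)

lemma tangent_Rspace:
  "v \<in> tangent_space d C p \<Longrightarrow> ch \<in> C \<Longrightarrow> p \<in> fst ch \<Longrightarrow> v ch \<in> Rspace d"
  unfolding tangent_space_def
  by (drule CollectD, drule spec[of _ ch], subst (asm) if_P) blast+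

lemma tangent_transition:
  "v \<in> tangent_space d C p \<Longrightarrow> ch \<in> C \<Longrightarrow> p \<in> fst ch \<Longrightarrow> ch' \<in> C \<Longrightarrow> p \<in> fst ch' \<Longrightarrow>
    v ch' = jacobian d (\<lambda>x. snd ch' (chart_inv ch x)) (snd ch p) (v ch)"
  unfolding tangent_space_def
  by (drule CollectD, drule spec[of _ ch], subst (asm) if_P) blast+

text \<open>\<open>diff_from\<close> relies on an arbitrarily chosen chart. The transformation rule
  of tangent vectors and the chain rule through the transition map make every chart around
  \<open>p\<close> equally valid.\<close>

lemma diff_from_chart:
  assumes v: "v \<in> tangent_space d C p" and ch: "ch \<in> C" "p \<in> fst ch"
  shows "diff_from d C J p v = jacobian d (\<lambda>x. J (chart_inv ch x)) (snd ch p) (v ch)"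
proof -
  let ?c = "chart_at C p"
  let ?T = "\<lambda>x. snd ?c (chart_inv ch x)"
  let ?W = "snd ch ` (fst ch \<inter> fst ?c)"
  have "p \<in> f" using ch chart_subset by blast
  then have c: "?c \<in> C" "p \<in> fst ?c" using chart_at_mem by blast+
  have W: "snd ch p \<in> ?W" using ch c by blast
  have "v ?c = jacobian d ?T (snd ch p) (v ch)"
    using tangent_transition[OF v ch c] .
  then have "diff_from d C J p v = jacobian d (\<lambda>x. J (chart_inv ?c x)) (?T (snd ch p)) (jacobian d ?T (snd ch p) (v ch))"
    using ch by (simp add: diff_from_def Let_def chart_inv_chart)
  also have "\<dots> = jacobian d (\<lambda>x. J (chart_inv ?c (?T x))) (snd ch p) (v ch)"
  proof (rule jacobian_compose[symmetric])
    show "?T ` ?W \<subseteq> snd ?c ` fst ?c" using ch c by (auto simp: chart_inv_chart)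
  qed (use W transition_open transition_C2 J_C2 chart_image_open ch c in blast)+
  also have "\<dots> = jacobian d (\<lambda>x. J (chart_inv ch x)) (snd ch p) (v ch)"
    using ch c by (intro jacobian_cong[OF transition_open W]) (auto simp: chart_inv_chart)
  finally show ?thesis .
qed

text \<open>Common setting for differentials of \<open>I\<close> on the image of \<open>J\<close>
  and of inverse charts. Openness of the preimages of chart domains supplies the neighbourhoods for
  the chain rule.\<close>

definition C1_param :: "vec set \<Rightarrow> (vec \<Rightarrow> 'm) \<Rightarrow> bool"
  where "C1_param V \<Phi> \<longleftrightarrow> \<Phi> ` V \<subseteq> f \<and>
    (\<forall>ch\<in>C. openin (Euclidean_space d) {y \<in> V. \<Phi> y \<in> fst ch} \<and>
      (\<forall>j. Ck_on d (Suc 0) {y \<in> V. \<Phi> y \<in> fst ch} (\<lambda>y. snd ch (\<Phi> y) j)))"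

text \<open>Near \<open>x\<close>, one chart expression of \<open>\<Phi>\<close> is the other
  followed by the transition map, so the chain rule gives the required transformation of components.
  For charts not around \<open>\<Phi> x\<close> both definitions prescribe 0.\<close>

lemma diff_into_tangent:
  assumes \<Phi>: "C1_param V \<Phi>" and x: "x \<in> V"
  shows "diff_into d C \<Phi> x u \<in> tangent_space d C (\<Phi> x)"
proof -
  have op: "openin (Euclidean_space d) {y \<in> V. \<Phi> y \<in> fst ch}"
    and Ck: "Ck_on d (Suc 0) {y \<in> V. \<Phi> y \<in> fst ch} (\<lambda>y. snd ch (\<Phi> y) j)" if "ch \<in> C" for ch j
    using \<Phi> that by (auto simp: C1_param_def)
  have R: "jacobian d (\<lambda>y. snd ch (\<Phi> y)) x u \<in> Rspace d" if "ch \<in> C" "\<Phi> x \<in> fst ch" for ch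
    by (rule jacobian_Rspace[OF op[OF that(1)]]) (use x that chart_Rspace in blast)+
  have T: "jacobian d (\<lambda>y. snd ch' (\<Phi> y)) x u =
      jacobian d (\<lambda>x. snd ch' (chart_inv ch x)) (snd ch (\<Phi> x)) (jacobian d (\<lambda>y. snd ch (\<Phi> y)) x u)"
    if ch: "ch \<in> C" "\<Phi> x \<in> fst ch" "ch' \<in> C" "\<Phi> x \<in> fst ch'" for ch ch'
  proof -
    let ?W = "{y \<in> V. \<Phi> y \<in> fst ch} \<inter> {y \<in> V. \<Phi> y \<in> fst ch'}"
    have W: "openin (Euclidean_space d) ?W" "x \<in> ?W"
      using openin_Int[OF op[OF ch(1)] op[OF ch(3)]] ch x by auto
    have "jacobian d (\<lambda>x. snd ch' (chart_inv ch x)) (snd ch (\<Phi> x)) (jacobian d (\<lambda>y. snd ch (\<Phi> y)) x u) =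
        jacobian d (\<lambda>y. snd ch' (chart_inv ch (snd ch (\<Phi> y)))) x u"
    proof (rule jacobian_compose[OF W, symmetric])
      show "(\<lambda>y. snd ch (\<Phi> y)) ` ?W \<subseteq> snd ch ` (fst ch \<inter> fst ch')" by auto
      show "Ck_on d (Suc 0) ?W (\<lambda>y. snd ch (\<Phi> y) j)" for j
        using Ck[OF ch(1)] by (rule Ck_on_subset) blast
    qed (use transition_open transition_C2 ch in blast)+
    also have "\<dots> = jacobian d (\<lambda>y. snd ch' (\<Phi> y)) x u"
      using ch by (intro jacobian_cong[OF W]) (auto simp: chart_inv_chart)
    finally show ?thesis by simp
  qed
  have v: "diff_into d C \<Phi> x u ch =
      (if ch \<in> C \<and> \<Phi> x \<in> fst ch then jacobian d (\<lambda>y. snd ch (\<Phi> y)) x u else (\<lambda>_. 0))" for ch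
    by (simp only: diff_into_def)
  show ?thesis
    unfolding tangent_space_def
  proof (intro CollectI allI)
    fix ch
    let ?in = "\<lambda>ch. ch \<in> C \<and> \<Phi> x \<in> fst ch"
    show "if ?in ch
      then diff_into d C \<Phi> x u ch \<in> Rspace d \<and>
        (\<forall>ch'\<in>C. \<Phi> x \<in> fst ch' \<longrightarrow> diff_into d C \<Phi> x u ch' =
          jacobian d (\<lambda>x. snd ch' (chart_inv ch x)) (snd ch (\<Phi> x)) (diff_into d C \<Phi> x u ch))
      else diff_into d C \<Phi> x u ch = (\<lambda>_. 0)"
    proof (cases "?in ch")
      case True
      then have ch: "ch \<in> C" "\<Phi> x \<in> fst ch" by auto
      have "diff_into d C \<Phi> x u ch' = jacobian d (\<lambda>y. snd ch' (\<Phi> y)) x u" if "?in ch'" for ch'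
        using v[of ch'] that by (simp only: if_True simp_thms)
      then have "diff_into d C \<Phi> x u ch \<in> Rspace d"
        and "\<forall>ch'\<in>C. \<Phi> x \<in> fst ch' \<longrightarrow> diff_into d C \<Phi> x u ch' =
          jacobian d (\<lambda>x. snd ch' (chart_inv ch x)) (snd ch (\<Phi> x)) (diff_into d C \<Phi> x u ch)"
        using R[OF ch] T[OF ch] ch by metis+
      then show ?thesis by (subst if_P[OF True]) (rule conjI)
    qed (simp only: v if_False)
  qed
qed

lemma diff_from_diff_into:
  assumes \<Phi>: "C1_param V \<Phi>" and x: "x \<in> V"
  shows "diff_from d C J (\<Phi> x) (diff_into d C \<Phi> x u) = jacobian d (\<lambda>y. J (\<Phi> y)) x u"
proof -
  obtain ch where ch: "ch \<in> C" "\<Phi> x \<in> fst ch"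
    using \<Phi> x charts_cover unfolding C1_param_def by blast
  let ?W = "{y \<in> V. \<Phi> y \<in> fst ch}"
  have W: "openin (Euclidean_space d) ?W" "x \<in> ?W" using \<Phi> ch x by (auto simp: C1_param_def)
  have "diff_from d C J (\<Phi> x) (diff_into d C \<Phi> x u) =
      jacobian d (\<lambda>x. J (chart_inv ch x)) (snd ch (\<Phi> x)) (jacobian d (\<lambda>y. snd ch (\<Phi> y)) x u)"
    using diff_from_chart[OF diff_into_tangent[OF assms] ch] ch by (simp add: diff_into_def)
  also have "\<dots> = jacobian d (\<lambda>y. J (chart_inv ch (snd ch (\<Phi> y)))) x u"
  proof (rule jacobian_compose[OF W, symmetric])
    show "(\<lambda>y. snd ch (\<Phi> y)) ` ?W \<subseteq> snd ch ` fst ch" by auto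
    show "Ck_on d (Suc 0) ?W (\<lambda>y. snd ch (\<Phi> y) j)" for j
      using \<Phi> ch by (auto simp: C1_param_def simp del: Ck_on.simps)
  qed (use chart_image_open J_C2 ch in blast)+
  also have "\<dots> = jacobian d (\<lambda>y. J (\<Phi> y)) x u"
    using ch by (intro jacobian_cong[OF W]) (auto simp: chart_inv_chart)
  finally show ?thesis .
qed

lemma C1_param_I: "C1_param (J ` f) I"
proof -
  have "{y \<in> J ` f. I y \<in> fst ch} = J ` fst ch" if "ch \<in> C" for ch
    using chart_subset[OF that] I_J by force
  then show ?thesis
    using J_open I_C2 I_J Ck_on_Suc by (auto simp: C1_param_def simp del: Ck_on.simps)
qed

lemma C1_param_chart_inv:
  assumes ch: "ch \<in> C"
  shows "C1_param (snd ch ` fst ch) (chart_inv ch)"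
proof -
  have "{y \<in> snd ch ` fst ch. chart_inv ch y \<in> fst ch'} = snd ch ` (fst ch \<inter> fst ch')" for ch' :: "'m chart"
    using chart_inv_chart[OF ch] by force
  moreover have "chart_inv ch ` snd ch ` fst ch \<subseteq> f"
    using chart_inv_chart[OF ch] chart_subset[OF ch] by auto
  ultimately show ?thesis
    unfolding C1_param_def
    using transition_open[OF ch] Ck_on_Suc[OF transition_C2[OF ch]] by (simp del: Ck_on.simps)
qed

text \<open>\<open>J (I y) = y\<close> holds on an open neighbourhood of \<open>J p\<close>, so the
  differentials compose to the identity, and the one of \<open>I\<close> supplies tangent vectors
  with prescribed image.\<close>

lemma diff_from_diff_into_I:
  assumes p: "p \<in> f" and u: "u \<in> Rspace d"
  shows "diff_into d C I (J p) u \<in> tangent_space d C p"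
    and "diff_from d C J p (diff_into d C I (J p) u) = u"
proof -
  obtain ch where ch: "ch \<in> C" "p \<in> fst ch" using charts_cover[OF p] by blast
  have x: "J p \<in> J ` f" using p by blast
  show "diff_into d C I (J p) u \<in> tangent_space d C p"
    using diff_into_tangent[OF C1_param_I x] p by (simp add: I_J)
  have "diff_from d C J p (diff_into d C I (J p) u) = jacobian d (\<lambda>y. J (I y)) (J p) u"
    using diff_from_diff_into[OF C1_param_I x] p by (simp add: I_J)
  also have "\<dots> = jacobian d (\<lambda>y. y) (J p) u"
    using ch chart_subset[OF ch(1)] I_J by (intro jacobian_cong[OF J_open[OF ch(1)]]) auto
  finally show "diff_from d C J p (diff_into d C I (J p) u) = u"
    using jacobian_ident[OF u] by simp
qed

abbreviation pb :: "(vec, vec) form \<Rightarrow> ('m, 'm tvec) form"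
  where "pb \<equiv> pullback d C f J"

abbreviation kappa :: "('m, 'm tvec) form \<Rightarrow> ('m, 'm tvec) form"
  where "kappa \<equiv> interior_product (\<lambda>p. diff_into d C I (J p) (J p))"

text \<open>The differential of \<open>J\<close> carries the field to X(x) = x. Its tangency at
  points of \<open>f\<close> matters because \<open>pullback\<close> is 0 on lists with an entry
  that is not a tangent vector.\<close>

lemma kappa_pullback: "kappa (pb \<alpha>) = pb (euler_contraction \<alpha>)"
proof (intro ext)
  fix p vs
  show "kappa (pb \<alpha>) p vs = pb (euler_contraction \<alpha>) p vs"
    using diff_from_diff_into_I[of p "J p"] J_Rspace[of p]
    by (auto simp: interior_product_def pullback_def)
qed

text \<open>Read in the chart chosen at \<open>p\<close>, the pullback by \<open>J\<close> is the
  pullback by \<open>?K\<close>, a C2 map from an open set into R^d, so the rule on R^d applies. The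
  Jacobian of \<open>?K\<close> on the chart components of a tangent vector is then the differential
  of \<open>J\<close>.\<close>

lemma ext_deriv_pullback:
  assumes \<alpha>: "C1_form d l \<alpha>"
  shows "ext_deriv d C f (pb \<alpha>) = pb (ext_d d \<alpha>)"
proof (intro ext)
  fix p vs
  show "ext_deriv d C f (pb \<alpha>) p vs = pb (ext_d d \<alpha>) p vs"
  proof (cases "p \<in> f \<and> set vs \<subseteq> tangent_space d C p")
    case True
    let ?c = "chart_at C p"
    let ?K = "\<lambda>x. J (chart_inv ?c x)"
    let ?V = "snd ?c ` fst ?c"
    have c: "?c \<in> C" "p \<in> fst ?c" using True chart_at_mem by blast+
    have V: "openin (Euclidean_space d) ?V" "snd ?c p \<in> ?V" using chart_image_open c by blast+
    have KV: "?K ` ?V \<subseteq> Rspace d"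
      using c chart_subset[OF c(1)] J_Rspace by (auto simp: chart_inv_chart)
    have "ext_deriv d C f (pb \<alpha>) p vs =
        ext_deriv_Rspace d (local_form d C ?c (pb \<alpha>)) (snd ?c p) (map (\<lambda>v. v ?c) vs)"
      using True by (simp add: ext_deriv_def Let_def)
    also have "\<dots> = ext_deriv_Rspace d \<alpha> (?K (snd ?c p)) (map (jacobian d ?K (snd ?c p)) (map (\<lambda>v. v ?c) vs))"
    proof (rule ext_deriv_pullback_Rspace[OF \<alpha> V KV J_C2[OF c(1)]])
      show "set (map (\<lambda>v. v ?c) vs) \<subseteq> Rspace d" using True tangent_Rspace[OF _ c] by auto
      fix y us assume y: "y \<in> ?V" and us: "set us \<subseteq> Rspace d"
      have "chart_inv ?c y \<in> f" using y c chart_subset[OF c(1)] by (auto simp: chart_inv_chart)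
      moreover have "diff_into d C (chart_inv ?c) y u \<in> tangent_space d C (chart_inv ?c y)" for u
        using diff_into_tangent[OF C1_param_chart_inv[OF c(1)] y] .
      ultimately show "local_form d C ?c (pb \<alpha>) y us = \<alpha> (?K y) (map (jacobian d ?K y) us)"
        using y us diff_from_diff_into[OF C1_param_chart_inv[OF c(1)] y]
        by (auto simp: local_form_def pullback_def comp_def)
    qed
    also have "map (jacobian d ?K (snd ?c p)) (map (\<lambda>v. v ?c) vs) = map (diff_from d C J p) vs"
      by (auto simp: diff_from_def Let_def)
    also have "?K (snd ?c p) = J p" using c by (simp add: chart_inv_chart)
    also have "ext_deriv_Rspace d \<alpha> (J p) (map (diff_from d C J p) vs) = pb (ext_d d \<alpha>) p vs"
    proof -
      \<comment> \<open>The Jacobian maps into R^d, so the cut-off in \<open>ext_d\<close> does not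
        take effect.\<close>
      have "diff_from d C J p v \<in> Rspace d" for v
        unfolding diff_from_def Let_def by (rule jacobian_Rspace[OF V KV])
      then show ?thesis using True by (auto simp: pullback_def ext_d_def)
    qed
    finally show ?thesis .
  qed (auto simp: ext_deriv_def pullback_def)
qed

lemma pullback_add: "pb (form_add \<alpha> \<beta>) = form_add (pb \<alpha>) (pb \<beta>)"
  by (simp add: pullback_def form_add_def fun_eq_iff)

lemma pullback_scale: "pb (form_scale a \<alpha>) = form_scale a (pb \<alpha>)"
  by (simp add: pullback_def form_scale_def fun_eq_iff)

lemma pullback_zero: "pb zero_form = zero_form"
  by (simp add: pullback_def zero_form_def fun_eq_iff)

lemma form_subspace_pullback: "form_subspace V \<Longrightarrow> form_subspace (pb ` V)"
  unfolding form_subspace_def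
  by (force simp flip: pullback_add pullback_scale pullback_zero)

text \<open>Every list of vectors at \<open>J p\<close> is the image of a tangent list at
  \<open>p\<close>, provided by the differential of \<open>I\<close>. A pullback thus retains all
  values of the form over the image of \<open>J\<close>.\<close>

lemma pullback_eq_zero:
  assumes "pb \<alpha> = zero_form" and p: "p \<in> f" and us: "set us \<subseteq> Rspace d"
  shows "\<alpha> (J p) us = 0"
proof -
  let ?vs = "map (diff_into d C I (J p)) us"
  have "set ?vs \<subseteq> tangent_space d C p" using us diff_from_diff_into_I(1)[OF p] by auto
  moreover have "map (diff_from d C J p) ?vs = us"
    unfolding map_map using us diff_from_diff_into_I(2)[OF p] by (intro map_idI) auto
  ultimately have "pb \<alpha> p ?vs = \<alpha> (J p) us" using p by (simp add: pullback_def del: map_map)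
  then show ?thesis using assms(1) by (simp add: zero_form_def)
qed

text \<open>If the coordinate vanishes at one point, openness of the image of \<open>J\<close>
  allows a shift by \<open>e / 2\<close> in direction \<open>k\<close>. At such a point the factor
  x_k^(s-1) is nonzero.\<close>

lemma exists_nonzero_coordinate:
  assumes "f \<noteq> {}" and k: "k < d"
  obtains p where "p \<in> f" and "J p k \<noteq> 0"
proof -
  obtain p ch where p: "p \<in> f" "ch \<in> C" "p \<in> fst ch" using assms charts_cover by blast
  obtain e where e: "e > 0"
    "\<And>y. y \<in> Rspace d \<Longrightarrow> (\<And>i. i < d \<Longrightarrow> \<bar>y i - J p i\<bar> < e) \<Longrightarrow> y \<in> J ` fst ch"
    by (rule openin_box[OF J_open[OF p(2)] imageI[OF p(3)]]) blast
  have "(J p)(k := J p k + e / 2) \<in> J ` fst ch"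
    using e(1) k J_Rspace[OF p(1)] by (intro e(2)) (auto simp: fun_upd_Rspace)
  then obtain q where q: "q \<in> fst ch" "J q = (J p)(k := J p k + e / 2)" by force
  then have "J q k = J p k + e / 2" by simp
  then show thesis
    using that[of p] that[of q] p q(1) e(1) chart_subset[OF p(2)] by (cases "J p k = 0") auto
qed

section \<open>Homogeneous forms on the cell and their complexes\<close>

abbreviation Hom :: "int \<Rightarrow> int \<Rightarrow> ('m, 'm tvec) form set"
  where "Hom s l \<equiv> pb ` hom_forms d s l"

lemma form_subspace_Hom: "form_subspace (Hom s l)"
  by (intro form_subspace_pullback form_subspace_hom_forms)

lemma Hom_C1: "Hom s l \<subseteq> pb ` {\<alpha>. C1_form d (nat l) \<alpha>}"
  using hom_forms_C1 by blast

text \<open>\<open>ext_deriv\<close> is built on \<open>deriv\<close>, whose additivity presupposes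
  differentiability; on pullbacks of C1 forms linearity is inherited from
  \<open>ext_d\<close>.\<close>

lemma form_linear_on_ext_deriv:
  "form_linear_on (pb ` {\<alpha>. C1_form d l \<alpha>}) (ext_deriv d C f)"
proof -
  have "C1_form d l (form_add \<alpha> \<beta>)" "C1_form d l (form_scale a \<alpha>)"
    "ext_d d (form_add \<alpha> \<beta>) = form_add (ext_d d \<alpha>) (ext_d d \<beta>)"
    "ext_d d (form_scale a \<alpha>) = form_scale a (ext_d d \<alpha>)"
    if "C1_form d l \<alpha>" "C1_form d l \<beta>" for \<alpha> \<beta> a
    using that form_subspace_C1[of d l] form_linear_on_ext_d[of d l]
    by (auto simp: form_subspace_def form_linear_on_def)
  note sub = this
  have "ext_deriv d C f (form_add (pb \<alpha>) (pb \<beta>)) = form_add (ext_deriv d C f (pb \<alpha>)) (ext_deriv d C f (pb \<beta>))"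
    if "C1_form d l \<alpha>" "C1_form d l \<beta>" for \<alpha> \<beta>
    using ext_deriv_pullback[OF sub(1)[OF that]] ext_deriv_pullback[OF that(1)]
      ext_deriv_pullback[OF that(2)] sub(3)[OF that] by (simp add: pullback_add)
  moreover have "ext_deriv d C f (form_scale a (pb \<alpha>)) = form_scale a (ext_deriv d C f (pb \<alpha>))"
    if "C1_form d l \<alpha>" for \<alpha> a
    using ext_deriv_pullback[OF sub(2)[OF that that]] ext_deriv_pullback[OF that]
      sub(4)[OF that that] by (simp add: pullback_scale)
  ultimately show ?thesis unfolding form_linear_on_def by blast
qed

lemma form_linear_on_kappa: "form_linear_on V kappa"
  by (simp add: form_linear_on_def interior_product_def form_add_def form_scale_def)

lemma ext_deriv_Hom:
  assumes "p \<in> Hom s l"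
  shows "ext_deriv d C f p \<in> Hom (s - 1) (l + 1)"
    and "ext_deriv d C f (ext_deriv d C f p) = zero_form"
proof -
  obtain \<alpha> where \<alpha>: "p = pb \<alpha>" "\<alpha> \<in> hom_forms d s l" using assms by blast
  note \<alpha>' = ext_d_hom_forms[OF \<alpha>(2)]
  have *: "ext_deriv d C f p = pb (ext_d d \<alpha>)"
    using ext_deriv_pullback[OF hom_forms_C1[OF \<alpha>(2)]] \<alpha>(1) by simp
  then show "ext_deriv d C f p \<in> Hom (s - 1) (l + 1)" using \<alpha>'(1) by blast
  show "ext_deriv d C f (ext_deriv d C f p) = zero_form"
    using ext_deriv_pullback[OF hom_forms_C1[OF \<alpha>'(1)]] * \<alpha>'(2) by (simp add: pullback_zero)
qed

lemma kappa_Hom: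
  assumes "p \<in> Hom s l"
  shows "kappa p \<in> Hom (s + 1) (l - 1)" and "kappa (kappa p) = zero_form"
  using assms euler_contraction_hom_forms by (auto simp: kappa_pullback pullback_zero)

text \<open>Where \<open>s\<close> and \<open>l\<close> are nonnegative the factor is
  \<open>s + l\<close>. Elsewhere the space is zero, so the truncation is harmless, and it produces
  the values prescribed for negative degrees.\<close>

lemma homotopy_Hom:
  assumes "p \<in> Hom s l"
  shows "form_add (ext_deriv d C f (kappa p)) (kappa (ext_deriv d C f p)) =
    form_scale (of_int (max 0 (s + l))) p"
proof -
  obtain \<alpha> where \<alpha>: "p = pb \<alpha>" "\<alpha> \<in> hom_forms d s l" using assms by blast
  have "ext_deriv d C f (kappa p) = pb (ext_d d (euler_contraction \<alpha>))"
    using ext_deriv_pullback[OF hom_forms_C1[OF euler_contraction_hom_forms(1)[OF \<alpha>(2)]]]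
    by (simp add: \<alpha>(1) kappa_pullback)
  moreover have "kappa (ext_deriv d C f p) = pb (euler_contraction (ext_d d \<alpha>))"
    using ext_deriv_pullback[OF hom_forms_C1[OF \<alpha>(2)]] by (simp add: \<alpha>(1) kappa_pullback)
  moreover have "form_add (ext_d d (euler_contraction \<alpha>)) (euler_contraction (ext_d d \<alpha>)) =
      form_scale (of_int (max 0 (s + l))) \<alpha>"
  proof (cases "s < 0 \<or> l < 0")
    case True
    then have "\<alpha> = zero_form" using \<alpha>(2) by (auto simp: hom_forms_eq)
    then show ?thesis
      by (simp add: euler_contraction_zero ext_d_zero) (simp add: zero_form_def form_add_def form_scale_def)
  next
    case False
    then show ?thesis
      using cartan_homotopy_formula[of \<alpha> d "nat s" "nat l"] \<alpha>(2) by (simp add: hom_forms_eq)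
  qed
  ultimately show ?thesis by (simp add: \<alpha>(1) flip: pullback_add pullback_scale)
qed

lemma direct_family_Hom: "direct_family (\<lambda>s. Hom s l)"
  unfolding direct_family_def
proof (intro allI impI ballI; elim conjE)
  fix S h s
  assume S: "finite S" "\<forall>s\<in>S. h s \<in> Hom s l" "form_sum h S = zero_form" "s \<in> S"
  let ?L = "\<lambda>p. form_add (ext_deriv d C f (kappa p)) (kappa (ext_deriv d C f p))"
  let ?V = "\<lambda>l. pb ` {\<alpha>. C1_form d (nat l) \<alpha>}"
  have V: "form_subspace (?V l)" for l by (intro form_subspace_pullback form_subspace_C1)
  have zero: "h s = zero_form" if "s \<in> S" "s < 0 \<or> l < 0" for s
    using S(2) that by (auto simp: hom_forms_eq pullback_zero split: if_splits)
  show "h s = zero_form"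
  proof (cases "s < 0 \<or> l < 0")
    case False
    have "h s p vs = 0" if "s \<in> S - {s \<in> S. 0 \<le> s}" for s p vs
    proof -
      have "s \<in> S" "s < 0" using that by auto
      then show ?thesis using zero[of s] by (simp add: zero_form_def)
    qed
    then have "form_sum h {s \<in> S. 0 \<le> s} = form_sum h S"
      unfolding form_sum_def using S(1) by (intro ext sum.mono_neutral_left) auto
    moreover have "?L (form_sum k R) = form_sum (\<lambda>s. form_scale (of_int (max 0 (s + l))) (k s)) R"
      if R: "finite R" "\<And>s. s \<in> R \<Longrightarrow> k s \<in> Hom s l" for k R
    proof -
      have kV: "\<And>s. s \<in> R \<Longrightarrow> k s \<in> ?V l" using R(2) Hom_C1 by blast
      \<comment> \<open>Linearity of \<open>ext_deriv\<close> is available on pullbacks of C1 forms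
        of one degree, so the contracted summands are first placed in such a space.\<close>
      have "\<And>s. s \<in> R \<Longrightarrow> kappa (k s) \<in> ?V (l - 1)" using kappa_Hom(1)[OF R(2)] Hom_C1 by blast
      then have "ext_deriv d C f (kappa (form_sum k R)) = form_sum (\<lambda>s. ext_deriv d C f (kappa (k s))) R"
        using form_linear_on_sum[OF V form_linear_on_kappa R(1) kV]
          form_linear_on_sum[OF V form_linear_on_ext_deriv R(1), of "\<lambda>s. kappa (k s)" "l - 1"] by simp
      moreover have "\<And>s. s \<in> R \<Longrightarrow> ext_deriv d C f (k s) \<in> ?V (l + 1)"
        using ext_deriv_Hom(1)[OF R(2)] Hom_C1 by blast
      then have "kappa (ext_deriv d C f (form_sum k R)) = form_sum (\<lambda>s. kappa (ext_deriv d C f (k s))) R"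
        using form_linear_on_sum[OF V form_linear_on_ext_deriv R(1) kV]
          form_linear_on_sum[OF V form_linear_on_kappa R(1), of "\<lambda>s. ext_deriv d C f (k s)" "l + 1"] by simp
      ultimately have "?L (form_sum k R) = form_sum (\<lambda>s. ?L (k s)) R"
        by (simp add: form_add_def form_sum_def sum.distrib)
      also have "\<dots> = form_sum (\<lambda>s. form_scale (of_int (max 0 (s + l))) (k s)) R"
        unfolding form_sum_def using homotopy_Hom[OF R(2)] by (intro ext sum.cong) auto
      finally show ?thesis .
    qed
    ultimately show ?thesis
      using eigenspaces_independent[of "\<lambda>s. Hom s l" ?L "\<lambda>s. of_int (max 0 (s + l))" "{s \<in> S. 0 \<le> s}" h s,
          OF form_subspace_Hom] S False
      by (auto simp: inj_on_def)
  qed (use zero S(4) in blast)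
qed

lemma is_complex_ext_deriv:
  "is_complex (\<lambda>r l. sum_space (\<lambda>s. Hom s l) r) (-1) 1 (ext_deriv d C f)"
  by (rule is_complex_sum_space[where V = "\<lambda>l. pb ` {\<alpha>. C1_form d (nat l) \<alpha>}"])
    (use form_subspace_Hom form_subspace_pullback[OF form_subspace_C1] Hom_C1 form_linear_on_ext_deriv
      ext_deriv_Hom in auto)

lemma is_complex_kappa:
  "is_complex (\<lambda>r l. sum_space (\<lambda>s. Hom s l) r) 1 (-1) kappa"
  by (rule is_complex_sum_space[where V = "\<lambda>l. pb ` {\<alpha>. C1_form d (nat l) \<alpha>}"])
    (use form_subspace_Hom form_subspace_pullback[OF form_subspace_C1] Hom_C1 form_linear_on_kappa
      kappa_Hom in auto)

lemma ext_deriv_Hom_nonzero: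
  assumes "f \<noteq> {}" and s: "s > 0" and l: "0 \<le> l" "l < int d"
  shows "ext_deriv d C f ` Hom s l \<noteq> {zero_form}"
proof
  assume zero: "ext_deriv d C f ` Hom s l = {zero_form}"
  \<comment> \<open>\<open>k\<close> is both the degree of the constant form and the index of the
    coordinate multiplying it. The form is built from the coordinates below \<open>k\<close>, and
    \<open>l < int d\<close> provides one more.\<close>
  define k where "k = nat l"
  have k: "k < d" using l by (simp add: k_def)
  obtain \<omega> where \<omega>: "\<omega> \<in> homogeneous_forms d 0 k"
    "\<And>x. x \<in> Rspace d \<Longrightarrow> \<omega> x (map unit_vec (rev [0..<k])) = 1"
    using exists_constant_form[of k d] k by auto
  let ?\<alpha> = "\<lambda>(x :: vec) vs. x k ^ nat s * \<omega> x vs"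
  let ?E = "map unit_vec (rev [0..<k])"
  have \<alpha>: "?\<alpha> \<in> hom_forms d s l"
    using form_on_Rspace_times_power(1)[OF \<omega>(1) k] s l by (simp add: hom_forms_eq k_def)
  have "ext_deriv d C f (pb ?\<alpha>) \<in> {zero_form}"
    using imageI[OF imageI[OF \<alpha>]] unfolding zero[symmetric] .
  then have "pb (ext_d d ?\<alpha>) = zero_form"
    using ext_deriv_pullback[OF hom_forms_C1[OF \<alpha>]] by simp
  moreover obtain p where p: "p \<in> f" "J p k \<noteq> 0"
    using exists_nonzero_coordinate[OF assms(1) k] by blast
  moreover have "set (unit_vec k # ?E) \<subseteq> Rspace d"
    using k by (auto intro: unit_vec_Rspace)
  ultimately have "ext_d d ?\<alpha> (J p) (unit_vec k # ?E) = 0" by (intro pullback_eq_zero)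
  then show False
    using form_on_Rspace_times_power(2)[OF \<omega>(1) k J_Rspace[OF p(1)], of "nat s"]
      \<omega>(2)[OF J_Rspace[OF p(1)]] p(2) s by simp
qed

end


section \<open>Coordinates of a cell\<close>

lemma is_chart_inj: "is_chart n M ch \<Longrightarrow> inj_on (snd ch) (fst ch)"
  unfolding is_chart_def
  by (metis homeomorphic_imp_injective_map openin_subset topspace_subtopology_subset)

lemma is_chart_image_open:
  assumes ch: "is_chart n M ch" and N: "openin M N"
  shows "openin (Euclidean_space n) (snd ch ` (N \<inter> fst ch))"
proof -
  have "openin (subtopology M (fst ch)) (N \<inter> fst ch)"
    using N by (rule openin_subtopology_Int)
  moreover have "open_map (subtopology M (fst ch)) (subtopology (Euclidean_space n) (snd ch ` fst ch)) (snd ch)"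
    using ch by (auto simp: is_chart_def intro: homeomorphic_imp_open_map)
  ultimately have "openin (subtopology (Euclidean_space n) (snd ch ` fst ch)) (snd ch ` (N \<inter> fst ch))"
    by (simp add: open_map_def)
  then show ?thesis using ch by (auto simp: is_chart_def intro: openin_trans_full)
qed

text \<open>The local extensions in \<open>C2_diffeo\<close> agree with \<open>I\<close> and its
  inverse only on \<open>U\<close> and on the closure of \<open>f\<close>. For the inverse this
  suffices at once, since slice charts map onto open subsets of R^d. For \<open>I\<close> it
  suffices only where \<open>U\<close> is known to contain a neighbourhood, hence the order
  \<open>J_C2\<close>, \<open>J_open\<close>, regularity of \<open>I\<close>.\<close>

theorem cell_coordinates_submanifold:
  assumes M: "smooth_manifold n M A" and f: "submanifold n M A d f"
    and I: "C2_diffeo n M A d U (M closure_of f) I"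
  shows "cell_coordinates d (sub_charts A d f) f I (inv_into U I)"
proof -
  let ?J = "inv_into U I" and ?B = "M closure_of f"
  have dn: "d \<le> n" and fM: "f \<subseteq> topspace M" using f by (auto simp: submanifold_def)
  have fB: "f \<subseteq> ?B" using fM by (rule closure_of_subset)
  have UR: "U \<subseteq> Rspace d" and bij: "bij_betw I U ?B"
    and into: "C2_into n M A d U I" and onto: "C2_from n M A d ?B ?J"
    using I by (auto simp: C2_diffeo_def)
  have JU: "?J p \<in> U" and IJ: "I (?J p) = p" if "p \<in> f" for p
    using bij that fB by (auto simp: bij_betw_def inv_into_into f_inv_into_f)
  have A: "is_chart n M ch" if "ch \<in> A" for ch using M that by (simp add: smooth_manifold_def)
  have inj: "inj_on (snd ch) (fst ch)" if "ch \<in> A" for ch using A[OF that] by (rule is_chart_inj)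
  have inv: "chart_inv ch (snd ch p) = p" if "ch \<in> A" "p \<in> fst ch" for ch p
    unfolding chart_inv_def using inj[OF that(1)] that(2) by (rule inv_into_f_f)
  have inv': "chart_inv (fst ch \<inter> f, snd ch) (snd ch p) = p" if "ch \<in> A" "p \<in> fst ch \<inter> f" for ch p
    unfolding chart_inv_def using inj[OF that(1)] that(2) by (simp add: inj_on_Int)
  \<comment> \<open>The slice condition speaks of the whole chart domain; injectivity of the chart
    carries it to every subset \<open>N\<close>, and so to intersections with other open
    sets.\<close>
  have slice: "snd ch ` (N \<inter> f) = snd ch ` N \<inter> Rspace d"
    if ch: "ch \<in> A" "slice_chart d f ch" and N: "N \<subseteq> fst ch" for ch N
  proof
    show "snd ch ` (N \<inter> f) \<subseteq> snd ch ` N \<inter> Rspace d"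
      using ch(2) N unfolding slice_chart_def by blast
    show "snd ch ` N \<inter> Rspace d \<subseteq> snd ch ` (N \<inter> f)"
    proof
      fix y assume y: "y \<in> snd ch ` N \<inter> Rspace d"
      then obtain p where p: "p \<in> N" "y = snd ch p" by blast
      have "y \<in> snd ch ` (fst ch \<inter> f)" using ch(2) N y unfolding slice_chart_def by blast
      then obtain q where q: "q \<in> fst ch \<inter> f" "y = snd ch q" by blast
      then have "p = q" using inj[OF ch(1)] p N by (auto dest: inj_onD)
      then show "y \<in> snd ch ` (N \<inter> f)" using p q by blast
    qed
  qed
  have open_slice: "openin (Euclidean_space d) (snd ch ` (N \<inter> fst ch \<inter> f))"
    if "ch \<in> A" "slice_chart d f ch" "openin M N" for ch N
    using slice[OF that(1,2), of "N \<inter> fst ch"] openin_slice[OF dn is_chart_image_open[OF A[OF that(1)] that(3)]]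
    by simp
  have image_open: "openin (Euclidean_space d) (snd ch ` (fst ch \<inter> f))"
    if "ch \<in> A" "slice_chart d f ch" for ch
    using open_slice[OF that, of "fst ch"] A[OF that(1)] by (simp add: is_chart_def)
  have zero: "snd ch p j = 0" if "ch \<in> A" "p \<in> fst ch" "n \<le> j" for ch p j
  proof -
    have "snd ch ` fst ch \<subseteq> Rspace n" using A[OF that(1)] openin_subset by (auto simp: is_chart_def)
    then show ?thesis using that(2,3) by (auto simp: Rspace_iff)
  qed
  \<comment> \<open>A local extension \<open>G\<close> lives on an open set of the ambient manifold.
    Read in \<open>ch\<close> it is C2 on an open subset of R^n, and restriction to the slice
    preserves this.\<close>
  have J_C2: "Ck_on d (Suc (Suc 0)) (snd ch ` (fst ch \<inter> f)) (\<lambda>x. ?J (chart_inv (fst ch \<inter> f, snd ch) x) j)"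
    if ch: "ch \<in> A" "slice_chart d f ch" for ch j
  proof (cases "j < d")
    case False
    note op = image_open[OF ch]
    have "?J (chart_inv (fst ch \<inter> f, snd ch) x) j = 0" if "x \<in> snd ch ` (fst ch \<inter> f)" for x
      using that False ch JU UR by (auto simp: inv' Rspace_iff subset_iff)
    then show ?thesis by (rule Ck_on_eq[OF op Ck_on_zero[OF openin_subset[OF op]]])
  next
    case True
    note op = image_open[OF ch]
    show ?thesis
    proof (rule Ck_on_local[OF op])
      fix x assume "x \<in> snd ch ` (fst ch \<inter> f)"
      then obtain p where p: "p \<in> fst ch" "p \<in> f" "x = snd ch p" by blast
      have "p \<in> ?B" using p(2) fB by blast
      obtain N G where NG: "openin M N" "p \<in> N" "\<forall>q\<in>?B \<inter> N. G q = ?J q"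
        "\<forall>ch\<in>A. \<forall>j<d. Ck_on n 2 (snd ch ` (N \<inter> fst ch)) (\<lambda>x. G (chart_inv ch x) j)"
        using bspec[OF onto[unfolded C2_from_def] \<open>p \<in> ?B\<close>] by (elim exE conjE) (rule that; assumption)
      then have N: "openin M N" "p \<in> N" "\<And>q. q \<in> ?B \<inter> N \<Longrightarrow> G q = ?J q"
        "Ck_on n 2 (snd ch ` (N \<inter> fst ch)) (\<lambda>x. G (chart_inv ch x) j)"
        using ch(1) True by (simp_all del: Ck_on.simps)
      let ?W = "snd ch ` (N \<inter> fst ch \<inter> f)"
      have W: "openin (Euclidean_space d) ?W" using open_slice[OF ch N(1)] .
      have "Ck_on d (Suc (Suc 0)) ?W (\<lambda>x. G (chart_inv ch x) j)"
        using Ck_on_slice[OF dn N(4)] slice[OF ch, of "N \<inter> fst ch"] by (simp add: numeral_2_eq_2 del: Ck_on.simps)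
      then have "Ck_on d (Suc (Suc 0)) ?W (\<lambda>x. ?J (chart_inv (fst ch \<inter> f, snd ch) x) j)"
        by (rule Ck_on_eq[OF W]) (use ch N(3) fB in \<open>auto simp: inv inv'\<close>)
      then show "\<exists>W. openin (Euclidean_space d) W \<and> x \<in> W \<and> W \<subseteq> snd ch ` (fst ch \<inter> f) \<and>
          Ck_on d (Suc (Suc 0)) W (\<lambda>x. ?J (chart_inv (fst ch \<inter> f, snd ch) x) j)"
        using W p N(2) by blast
    qed
  qed
  have J_open: "openin (Euclidean_space d) (?J ` (fst ch \<inter> f))"
    if ch: "ch \<in> A" "slice_chart d f ch" for ch
  proof -
    let ?V = "snd ch ` (fst ch \<inter> f)" and ?K = "\<lambda>x. ?J (chart_inv (fst ch \<inter> f, snd ch) x)"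
    note op = image_open[OF ch]
    have KV: "?K ` ?V = ?J ` (fst ch \<inter> f)"
      unfolding image_image using ch by (intro image_cong) (auto simp: inv')
    have "openin (Euclidean_space d) (?K ` ?V)"
    \<comment> \<open>Domain and target have the same dimension \<open>d\<close>; continuity comes
      from \<open>J_C2\<close>, and injectivity holds because \<open>I\<close> undoes
      \<open>?J\<close> on \<open>f\<close>.\<close>
    proof (rule invariance_of_domain_Euclidean_space[OF op])
      have "?J ` (fst ch \<inter> f) \<subseteq> Rspace d" using JU UR by blast
      then have "?K ` ?V \<subseteq> {x. \<forall>i\<ge>d. x i = 0}" unfolding KV topspace_Euclidean_space .
      then have "?K \<in> topspace (subtopology (Euclidean_space d) ?V) \<rightarrow> {x. \<forall>i\<ge>d. x i = 0}"
        unfolding topspace_subtopology by blast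
      moreover have "continuous_map (subtopology (Euclidean_space d) ?V) (powertop_real UNIV) ?K"
        unfolding continuous_map_componentwise_UNIV using J_C2[OF ch] by (auto intro: Ck_on_continuous simp del: Ck_on.simps)
      ultimately have "continuous_map (subtopology (Euclidean_space d) ?V)
          (subtopology (powertop_real UNIV) {x. \<forall>i\<ge>d. x i = 0}) ?K"
        unfolding continuous_map_in_subtopology by blast
      then show "continuous_map (subtopology (Euclidean_space d) ?V) (Euclidean_space d) ?K"
        unfolding Euclidean_space_def[symmetric] .
      show "inj_on ?K ?V"
      proof (rule inj_onI)
        fix x y assume "x \<in> ?V" "y \<in> ?V" and eq: "?K x = ?K y"
        then obtain p q where p: "p \<in> fst ch \<inter> f" "x = snd ch p" and q: "q \<in> fst ch \<inter> f" "y = snd ch q"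
          by blast
        then have "?J p = ?J q" using eq by (simp add: inv'[OF ch(1)])
        then have "I (?J p) = I (?J q)" by (rule arg_cong)
        then have "p = q" using p(1) q(1) by (simp only: IJ Int_iff)
        then show "x = y" using p q by simp
      qed
    qed
    then show ?thesis by (simp add: KV)
  qed
  show ?thesis
  proof
    fix p assume "p \<in> f"
    then obtain ch where ch: "ch \<in> A" "p \<in> fst ch" "slice_chart d f ch"
      using f unfolding submanifold_def by blast
    then have "(fst ch \<inter> f, snd ch) \<in> sub_charts A d f" unfolding sub_charts_def by blast
    then show "\<exists>ch\<in>sub_charts A d f. p \<in> fst ch" by (rule bexI[rotated]) (simp add: ch \<open>p \<in> f\<close>)
    show "I (?J p) = p" using IJ[OF \<open>p \<in> f\<close>] .
  next
    fix ch' assume "ch' \<in> sub_charts A d f"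
    then obtain ch where ch: "ch' = (fst ch \<inter> f, snd ch)" "ch \<in> A" "slice_chart d f ch"
      by (auto simp: sub_charts_def)
    show "fst ch' \<subseteq> f" by (simp add: ch)
    show "inj_on (snd ch') (fst ch')" using inj[OF ch(2)] by (simp add: ch(1) inj_on_Int)
    show "openin (Euclidean_space d) (?J ` fst ch')" using J_open[OF ch(2,3)] by (simp add: ch(1))
    show "Ck_on d (Suc (Suc 0)) (snd ch' ` fst ch') (\<lambda>x. ?J (chart_inv ch' x) j)" for j
      using J_C2[OF ch(2,3)] by (simp add: ch(1) del: Ck_on.simps)
    \<comment> \<open>This set is open and contained in \<open>U\<close>, so \<open>I\<close> and
      its local extension coincide on neighbourhoods and have the same derivatives. Chart components
      from \<open>n\<close> on vanish.\<close>
    show "Ck_on d (Suc (Suc 0)) (?J ` fst ch') (\<lambda>y. snd ch' (I y) j)" for j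
    proof (cases "j < n")
      case False
      note op = J_open[OF ch(2,3)]
      have "snd ch (I y) j = 0" if "y \<in> ?J ` (fst ch \<inter> f)" for y
        using that False ch by (auto simp: IJ zero)
      then have "Ck_on d (Suc (Suc 0)) (?J ` (fst ch \<inter> f)) (\<lambda>y. snd ch (I y) j)"
        by (rule Ck_on_eq[OF op Ck_on_zero[OF openin_subset[OF op]]])
      then show ?thesis by (simp add: ch(1) del: Ck_on.simps)
    next
      case True
      note op = J_open[OF ch(2,3)]
      have "Ck_on d (Suc (Suc 0)) (?J ` (fst ch \<inter> f)) (\<lambda>y. snd ch (I y) j)"
      proof (rule Ck_on_local[OF op])
        fix y assume y: "y \<in> ?J ` (fst ch \<inter> f)"
        then have "y \<in> U" using JU by blast
        obtain V G where VG: "openin (Euclidean_space d) V" "y \<in> V" "\<forall>z\<in>U \<inter> V. G z = I z"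
          "\<forall>ch\<in>A. \<forall>j<n. Ck_on d 2 {z \<in> V. G z \<in> fst ch} (\<lambda>z. snd ch (G z) j)"
          using bspec[OF into[unfolded C2_into_def] \<open>y \<in> U\<close>] by (elim exE conjE) (rule that; assumption)
        then have V: "openin (Euclidean_space d) V" "y \<in> V" "\<And>z. z \<in> U \<inter> V \<Longrightarrow> G z = I z"
          "Ck_on d 2 {z \<in> V. G z \<in> fst ch} (\<lambda>z. snd ch (G z) j)"
          using ch(2) True by (simp_all del: Ck_on.simps)
        let ?W = "V \<inter> ?J ` (fst ch \<inter> f)"
        have W: "openin (Euclidean_space d) ?W" using V(1) op by blast
        have G: "G z = I z" "I z \<in> fst ch" if "z \<in> ?W" for z
          using that V(3) JU IJ by auto
        have "Ck_on d (Suc (Suc 0)) ?W (\<lambda>z. snd ch (G z) j)"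
          using V(4) G unfolding numeral_2_eq_2 by (elim Ck_on_subset) auto
        then have "Ck_on d (Suc (Suc 0)) ?W (\<lambda>z. snd ch (I z) j)"
          by (rule Ck_on_eq[OF W]) (simp add: G(1))
        then show "\<exists>W. openin (Euclidean_space d) W \<and> y \<in> W \<and> W \<subseteq> ?J ` (fst ch \<inter> f) \<and>
            Ck_on d (Suc (Suc 0)) W (\<lambda>y. snd ch (I y) j)"
          using W V(2) y by blast
      qed
      then show ?thesis by (simp add: ch(1) del: Ck_on.simps)
    qed
    fix ch2' assume "ch2' \<in> sub_charts A d f"
    then obtain ch2 where ch2: "ch2' = (fst ch2 \<inter> f, snd ch2)" "ch2 \<in> A" "slice_chart d f ch2"
      by (auto simp: sub_charts_def)
    have eq: "snd ch' ` (fst ch' \<inter> fst ch2') = snd ch ` (fst ch2 \<inter> fst ch \<inter> f)"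
      by (auto simp: ch(1) ch2(1))
    have "openin M (fst ch2)" using A[OF ch2(2)] by (simp add: is_chart_def)
    then have op: "openin (Euclidean_space d) (snd ch ` (fst ch2 \<inter> fst ch \<inter> f))"
      using open_slice[OF ch(2,3)] by blast
    then show "openin (Euclidean_space d) (snd ch' ` (fst ch' \<inter> fst ch2'))" by (simp add: eq)
    show "Ck_on d (Suc (Suc 0)) (snd ch' ` (fst ch' \<inter> fst ch2')) (\<lambda>x. snd ch2' (chart_inv ch' x) j)" for j
    proof (cases "j < n")
      case False
      have "snd ch2' (chart_inv ch' x) j = 0" if "x \<in> snd ch ` (fst ch2 \<inter> fst ch \<inter> f)" for x
        using that False ch(2) ch2(2) by (auto simp: ch(1) ch2(1) inv' zero)
      then show ?thesis
        unfolding eq by (rule Ck_on_eq[OF op Ck_on_zero[OF openin_subset[OF op]]])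
    next
      case True
      have "Ck_on n (Suc (Suc 0)) (snd ch ` (fst ch2 \<inter> fst ch)) (\<lambda>x. snd ch2 (chart_inv ch x) j)"
        unfolding Int_commute[of "fst ch2"] using M ch(2) ch2(2) True unfolding smooth_manifold_def smooth_transition_def smooth_on_def by blast
      from Ck_on_slice[OF dn this]
      have "Ck_on d (Suc (Suc 0)) (snd ch ` (fst ch2 \<inter> fst ch \<inter> f)) (\<lambda>x. snd ch2 (chart_inv ch x) j)"
        unfolding slice[OF ch(2,3) inf_le2] .
      then show ?thesis
        unfolding eq by (rule Ck_on_eq[OF op]) (use ch(2) in \<open>auto simp: ch(1) ch2(1) inv inv'\<close>)
    qed
  qed
qed

theorem lemma24:
  fixes \<Omega> :: "'m topology" and A :: "'m chart set" and n :: nat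
    and g :: "'m \<Rightarrow> 'm tvec \<Rightarrow> 'm tvec \<Rightarrow> real"
    and \<M> :: "'m set set" and U :: "'m set \<Rightarrow> vec set" and I :: "'m set \<Rightarrow> vec \<Rightarrow> 'm"
  assumes "smooth_manifold n \<Omega> A" and "compact_space \<Omega>" and "riemannian_metric n \<Omega> A g"
    and "mesh n \<Omega> A \<M>" and "affine_compatible_coordinates n \<Omega> A \<M> U I"
  shows "(\<forall>d\<le>n. \<forall>f\<in>cells n \<Omega> A \<M> d.
            (\<forall>l. direct_family (\<lambda>s. cell_hom_forms A U I d f s l)) \<and>
            is_complex (cell_poly_forms A U I d f) (-1) 1 (cell_d A d f) \<and>
            is_complex (cell_poly_forms A U I d f) 1 (-1) (cell_kappa A U I d f)) \<and>
         (\<exists>lam :: int \<Rightarrow> int \<Rightarrow> real.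
            (\<forall>s l. s < 0 \<longrightarrow> lam s l = lam (s + l) 0) \<and>
            (\<forall>s l. s < 0 \<and> s + l < 0 \<longrightarrow> lam (s + l) 0 = 0) \<and>
            (\<forall>d\<le>n. \<forall>f\<in>cells n \<Omega> A \<M> d.
               (\<forall>s l. \<forall>p\<in>cell_hom_forms A U I d f s l.
                  form_add (cell_d A d f (cell_kappa A U I d f p))
                           (cell_kappa A U I d f (cell_d A d f p)) = form_scale (lam s l) p) \<and>
               (\<forall>s l. s < 0 \<longrightarrow> cell_hom_forms A U I d f s l = {zero_form}) \<and>
               (\<forall>s s' l. d > 0 \<and> 0 \<le> l \<and> l \<le> int d \<and> 0 \<le> s \<and> 0 \<le> s' \<and> lam s l = lam s' l
                  \<longrightarrow> s = s') \<and>
               (\<forall>s l. 0 \<le> s \<and> 0 \<le> l \<and> l \<le> int d \<longrightarrow> (lam s l = 0 \<longleftrightarrow> s = 0 \<and> l = 0)) \<and>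
               (\<forall>s l. s > 0 \<and> 0 \<le> l \<and> l < int d \<longrightarrow>
                  cell_d A d f ` cell_hom_forms A U I d f s l \<noteq> {zero_form})))"
proof -
  \<comment> \<open>One function for all dimensions and cells. Truncating \<open>s + l\<close> at 0
    yields the values fixed for \<open>s < 0\<close>, and changes nothing where \<open>s\<close> and
    \<open>l\<close> are nonnegative.\<close>
  let ?lam = "\<lambda>s l. of_int (max 0 (s + l)) :: real"
  have cell: "cell_coordinates d (sub_charts A d f) f (I f) (cell_J U I f)" and ne: "f \<noteq> {}"
    if "d \<le> n" "f \<in> cells n \<Omega> A \<M> d" for d f
  proof -
    show "cell_coordinates d (sub_charts A d f) f (I f) (cell_J U I f)"
      unfolding cell_J_def using that assms(1,5)
      by (intro cell_coordinates_submanifold) (auto simp: cells_def affine_compatible_coordinates_def)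
    show "f \<noteq> {}" using that assms(4) by (auto simp: cells_def mesh_def)
  qed
  have kappa: "cell_kappa A U I d f =
      interior_product (\<lambda>p. diff_into d (sub_charts A d f) (I f) (cell_J U I f p) (cell_J U I f p))" for d f
    by (simp add: cell_kappa_def cell_field_def[abs_def])
  have poly: "cell_poly_forms A U I d f = (\<lambda>r l. sum_space (\<lambda>s. cell_hom_forms A U I d f s l) r)" for d f
    by (simp add: cell_poly_forms_def sum_space_def fun_eq_iff)
  note [simp] = kappa poly cell_hom_forms_def cell_d_def
  have "direct_family (\<lambda>s. cell_hom_forms A U I d f s l)"
    "is_complex (cell_poly_forms A U I d f) (-1) 1 (cell_d A d f)"
    "is_complex (cell_poly_forms A U I d f) 1 (-1) (cell_kappa A U I d f)"
    if "d \<le> n" "f \<in> cells n \<Omega> A \<M> d" for d f l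
    using cell_coordinates.direct_family_Hom[OF cell[OF that]]
      cell_coordinates.is_complex_ext_deriv[OF cell[OF that]]
      cell_coordinates.is_complex_kappa[OF cell[OF that]] by simp_all
  moreover have "form_add (cell_d A d f (cell_kappa A U I d f p)) (cell_kappa A U I d f (cell_d A d f p)) =
      form_scale (?lam s l) p"
    if "d \<le> n" "f \<in> cells n \<Omega> A \<M> d" "p \<in> cell_hom_forms A U I d f s l" for d f s l p
    using cell_coordinates.homotopy_Hom[OF cell[OF that(1,2)]] that(3) by simp
  moreover have "cell_hom_forms A U I d f s l = {zero_form}"
    if "d \<le> n" "f \<in> cells n \<Omega> A \<M> d" "s < 0" for d f s l
    using that(3) cell_coordinates.pullback_zero[OF cell[OF that(1,2)]] by (simp add: hom_forms_def)
  moreover have "cell_d A d f ` cell_hom_forms A U I d f s l \<noteq> {zero_form}"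
    if "d \<le> n" "f \<in> cells n \<Omega> A \<M> d" "s > 0" "0 \<le> l" "l < int d" for d f s l
    using cell_coordinates.ext_deriv_Hom_nonzero[OF cell[OF that(1,2)] ne[OF that(1,2)] that(3-5)] by simp
  ultimately show ?thesis
    by (intro conjI exI[of _ ?lam]) (auto simp del: kappa poly cell_hom_forms_def cell_d_def)
qed

end
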